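(* Let $\Bbbk$ be a field, let $H$ be a Hopf algebra over $\Bbbk$ and let $\mathfrak g$ be a Lie algebra over $\Bbbk$ acting on $H$ by $\Bbbk$-biderivations. Then $H$, with the induced action of the universal enveloping algebra $U(\mathfrak g)$, is a $U(\mathfrak g)$-module Hopf algebra, and hence one can form the Hopf algebra $H\rtimes U(\mathfrak g)$.
   Context: All Hopf algebras are assumed to have bijective antipode. Sweedler notation $\Delta(a)=a_{(1)}\otimes a_{(2)}$ is used. A Lie algebra $\mathfrak g$ acts on $H$ by $\Bbbk$-biderivations if $H$ is a $\mathfrak g$-module such that for all $x\in\mathfrak g$ and $a,b\in H$: (derivation) $x\cdot(ab)=(x\cdot a)b+a(x\cdot b)$; (coderivation) $\Delta(x\cdot a)=x\cdot a_{(1)}\otimes a_{(2)}+a_{(1)}\otimes x\cdot a_{(2)}$ and $\varepsilon(x\cdot a)=0$. Let $L$ be a Hopf algebra. An $L$-module Hopf algebra is a Hopf algebra $H$ which is a left $L$-module such that for all $\ell\in L$, $a,b\in H$: $\ell\cdot(ab)=(\ell_{(1)}\cdot a)(\ell_{(2)}\cdot b)$; $\ell\cdot 1=\varepsilon(\ell)1$; $\Delta(\ell\cdot a)=\ell_{(1)}\cdot a_{(1)}\otimes \ell_{(2)}\cdot a_{(2)}$; $\varepsilon(\ell\cdot a)=\varepsilon(\ell)\varepsilon(a)$; $\ell_{(1)}\otimes \ell_{(2)}\cdot a=\ell_{(2)}\otimes\ell_{(1)}\cdot a$. For an $L$-module Hopf algebra $H$, $H\rtimes L$ denotes the vector space $H\otimes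 L$ with the tensor product coalgebra structure and the smash product multiplication $(a\otimes \ell)(b\otimes m)=a(\ell_{(1)}\cdot b)\otimes \ell_{(2)}m$. *)

theory Defs
  imports "HOL-Algebra.Module" "HOL-Algebra.QuotRing"
begin

section \<open>Linear and bilinear maps\<close>

text \<open>
  A \<open>K\<close>-vector space is a \<^locale>\<open>module\<close> over a \<^locale>\<open>field\<close> \<open>K\<close>. The library's record of
  modules extends that of rings; unless a space is declared to be an algebra, the multiplication
  and unit fields of its record carry no meaning.
\<close>

definition linear_map ::
    "('k, 'c) ring_scheme \<Rightarrow> ('k, 'a, 'm) module_scheme \<Rightarrow> ('k, 'b, 'n) module_scheme \<Rightarrow> ('a \<Rightarrow> 'b) \<Rightarrow> bool"
  where "linear_map K M N f \<longleftrightarrow>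
    f \<in> carrier M \<rightarrow> carrier N \<and>
    (\<forall>x\<in>carrier M. \<forall>y\<in>carrier M. f (x \<oplus>\<^bsub>M\<^esub> y) = f x \<oplus>\<^bsub>N\<^esub> f y) \<and>
    (\<forall>c\<in>carrier K. \<forall>x\<in>carrier M. f (c \<odot>\<^bsub>M\<^esub> x) = c \<odot>\<^bsub>N\<^esub> f x)"

definition bilinear_map ::
    "('k, 'c) ring_scheme \<Rightarrow> ('k, 'a, 'm) module_scheme \<Rightarrow> ('k, 'b, 'n) module_scheme
      \<Rightarrow> ('k, 'p, 'q) module_scheme \<Rightarrow> ('a \<Rightarrow> 'b \<Rightarrow> 'p) \<Rightarrow> bool"
  where "bilinear_map K M N P f \<longleftrightarrow>
    (\<forall>x\<in>carrier M. linear_map K N P (\<lambda>y. f x y)) \<and>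
    (\<forall>y\<in>carrier N. linear_map K M P (\<lambda>x. f x y))"

definition self_module :: "('k, 'c) ring_scheme \<Rightarrow> ('k, 'k) module"
  where "self_module K =
    \<lparr>carrier = carrier K, mult = mult K, one = one K, zero = zero K, add = add K, smult = mult K\<rparr>"


section \<open>Free modules and quotients\<close>

text \<open>Finitely supported functions supported in \<open>X\<close>.\<close>

definition free_module :: "('k, 'c) ring_scheme \<Rightarrow> 'x set \<Rightarrow> ('k, 'x \<Rightarrow> 'k) module"
  where "free_module K X =
    \<lparr>carrier = {\<phi>. range \<phi> \<subseteq> carrier K \<and> finite {x. \<phi> x \<noteq> \<zero>\<^bsub>K\<^esub>} \<and> {x. \<phi> x \<noteq> \<zero>\<^bsub>K\<^esub>} \<subseteq> X},
     mult = (\<lambda>\<phi> \<psi> x. \<zero>\<^bsub>K\<^esub>), one = (\<lambda>x. \<zero>\<^bsub>K\<^esub>),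
     zero = (\<lambda>x. \<zero>\<^bsub>K\<^esub>), add = (\<lambda>\<phi> \<psi> x. \<phi> x \<oplus>\<^bsub>K\<^esub> \<psi> x),
     smult = (\<lambda>c \<phi> x. c \<otimes>\<^bsub>K\<^esub> \<phi> x)\<rparr>"

definition free_gen :: "('k, 'c) ring_scheme \<Rightarrow> 'x \<Rightarrow> 'x \<Rightarrow> 'k"
  where "free_gen K x = (\<lambda>y. if y = x then \<one>\<^bsub>K\<^esub> else \<zero>\<^bsub>K\<^esub>)"

text \<open>The linear extension to the free module of a map \<open>h\<close> given on generators.\<close>

definition free_lift ::
    "('k, 'c) ring_scheme \<Rightarrow> ('k, 'p, 'q) module_scheme \<Rightarrow> ('x \<Rightarrow> 'p) \<Rightarrow> ('x \<Rightarrow> 'k) \<Rightarrow> 'p"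
  where "free_lift K P h \<phi> = (\<Oplus>\<^bsub>P\<^esub>x\<in>{x. \<phi> x \<noteq> \<zero>\<^bsub>K\<^esub>}. \<phi> x \<odot>\<^bsub>P\<^esub> h x)"

definition span_submodule ::
    "('k, 'c) ring_scheme \<Rightarrow> ('k, 'a, 'm) module_scheme \<Rightarrow> 'a set \<Rightarrow> 'a set"
  where "span_submodule K M S = \<Inter>{N. submodule N K M \<and> S \<subseteq> N}"

text \<open>
  The quotient of \<open>M\<close> by \<open>N\<close>, with the operations of \<^const>\<open>FactRing\<close>. Its multiplication is
  meaningful when \<open>M\<close> is an algebra and \<open>N\<close> a two-sided ideal.
\<close>

definition quot_module :: "('k, 'a, 'm) module_scheme \<Rightarrow> 'a set \<Rightarrow> ('k, 'a set) module"
  where "quot_module M N =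
    \<lparr>carrier = carrier (M Quot N), mult = mult (M Quot N), one = one (M Quot N),
     zero = zero (M Quot N), add = add (M Quot N),
     smult = (\<lambda>c A. \<Union>a\<in>A. N +>\<^bsub>M\<^esub> (c \<odot>\<^bsub>M\<^esub> a))\<rparr>"

text \<open>
  The map on a quotient of a free module induced by the linear extension of \<open>h\<close>. It is evaluated on
  an arbitrary representative, so it is only meaningful if that extension vanishes on the
  submodule factored out.
\<close>

definition quot_lift ::
    "('k, 'c) ring_scheme \<Rightarrow> ('k, 'p, 'q) module_scheme \<Rightarrow> ('x \<Rightarrow> 'p) \<Rightarrow> ('x \<Rightarrow> 'k) set \<Rightarrow> 'p"
  where "quot_lift K P h A = free_lift K P h (SOME \<phi>. \<phi> \<in> A)"


section \<open>Tensor products\<close>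

definition tensor_rels ::
    "('k, 'c) ring_scheme \<Rightarrow> ('k, 'a, 'm) module_scheme \<Rightarrow> ('k, 'b, 'n) module_scheme \<Rightarrow> ('a \<times> 'b \<Rightarrow> 'k) set"
  where "tensor_rels K M N =
    (let F = free_module K (carrier M \<times> carrier N); e = (\<lambda>x y. free_gen K (x, y)) in
      {e (x \<oplus>\<^bsub>M\<^esub> x') y \<ominus>\<^bsub>F\<^esub> (e x y \<oplus>\<^bsub>F\<^esub> e x' y) | x x' y.
          x \<in> carrier M \<and> x' \<in> carrier M \<and> y \<in> carrier N} \<union>
      {e x (y \<oplus>\<^bsub>N\<^esub> y') \<ominus>\<^bsub>F\<^esub> (e x y \<oplus>\<^bsub>F\<^esub> e x y') | x y y'.
          x \<in> carrier M \<and> y \<in> carrier N \<and> y' \<in> carrier N} \<union>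
      {e (c \<odot>\<^bsub>M\<^esub> x) y \<ominus>\<^bsub>F\<^esub> c \<odot>\<^bsub>F\<^esub> e x y | c x y.
          c \<in> carrier K \<and> x \<in> carrier M \<and> y \<in> carrier N} \<union>
      {e x (c \<odot>\<^bsub>N\<^esub> y) \<ominus>\<^bsub>F\<^esub> c \<odot>\<^bsub>F\<^esub> e x y | c x y.
          c \<in> carrier K \<and> x \<in> carrier M \<and> y \<in> carrier N})"

definition tensor_null ::
    "('k, 'c) ring_scheme \<Rightarrow> ('k, 'a, 'm) module_scheme \<Rightarrow> ('k, 'b, 'n) module_scheme \<Rightarrow> ('a \<times> 'b \<Rightarrow> 'k) set"
  where "tensor_null K M N =
    span_submodule K (free_module K (carrier M \<times> carrier N)) (tensor_rels K M N)"

definition tensor ::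
    "('k, 'c) ring_scheme \<Rightarrow> ('k, 'a, 'm) module_scheme \<Rightarrow> ('k, 'b, 'n) module_scheme
      \<Rightarrow> ('k, ('a \<times> 'b \<Rightarrow> 'k) set) module"
  where "tensor K M N = quot_module (free_module K (carrier M \<times> carrier N)) (tensor_null K M N)"

definition tens ::
    "('k, 'c) ring_scheme \<Rightarrow> ('k, 'a, 'm) module_scheme \<Rightarrow> ('k, 'b, 'n) module_scheme
      \<Rightarrow> 'a \<Rightarrow> 'b \<Rightarrow> ('a \<times> 'b \<Rightarrow> 'k) set"
  where "tens K M N x y =
    tensor_null K M N +>\<^bsub>free_module K (carrier M \<times> carrier N)\<^esub> free_gen K (x, y)"

text \<open>The linear map \<open>x \<otimes> y \<mapsto> f x y\<close> from a tensor product to \<open>P\<close> induced by a bilinear map \<open>f\<close>.\<close>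

definition tensor_lift ::
    "('k, 'c) ring_scheme \<Rightarrow> ('k, 'p, 'q) module_scheme \<Rightarrow> ('a \<Rightarrow> 'b \<Rightarrow> 'p) \<Rightarrow> ('a \<times> 'b \<Rightarrow> 'k) set \<Rightarrow> 'p"
  where "tensor_lift K P f t = quot_lift K P (\<lambda>(x, y). f x y) t"


section \<open>Algebras, coalgebras and Hopf algebras\<close>

text \<open>Unital associative algebras; the library's \<^locale>\<open>algebra\<close> is restricted to commutative ones.\<close>

locale assoc_algebra = module K A + ring A for K and A +
  assumes smult_mult_left: "\<lbrakk>c \<in> carrier K; x \<in> carrier A; y \<in> carrier A\<rbrakk>
      \<Longrightarrow> (c \<odot>\<^bsub>A\<^esub> x) \<otimes>\<^bsub>A\<^esub> y = c \<odot>\<^bsub>A\<^esub> (x \<otimes>\<^bsub>A\<^esub> y)"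
    and smult_mult_right: "\<lbrakk>c \<in> carrier K; x \<in> carrier A; y \<in> carrier A\<rbrakk>
      \<Longrightarrow> x \<otimes>\<^bsub>A\<^esub> (c \<odot>\<^bsub>A\<^esub> y) = c \<odot>\<^bsub>A\<^esub> (x \<otimes>\<^bsub>A\<^esub> y)"

definition tensor_algebra_prod ::
    "('k, 'c) ring_scheme \<Rightarrow> ('k, 'a, 'm) module_scheme \<Rightarrow> ('k, 'b, 'n) module_scheme
      \<Rightarrow> ('k, ('a \<times> 'b \<Rightarrow> 'k) set) module"
  where "tensor_algebra_prod K A B = (tensor K A B)
    \<lparr>mult := (\<lambda>s t.
       tensor_lift K (tensor K A B) (\<lambda>a b.
         tensor_lift K (tensor K A B) (\<lambda>a' b'. tens K A B (a \<otimes>\<^bsub>A\<^esub> a') (b \<otimes>\<^bsub>B\<^esub> b')) t) s),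
     one := tens K A B \<one>\<^bsub>A\<^esub> \<one>\<^bsub>B\<^esub>\<rparr>"

record ('k, 'a) hopf = "('k, 'a) module" +
  comul :: "'a \<Rightarrow> ('a \<times> 'a \<Rightarrow> 'k) set"
  counit :: "'a \<Rightarrow> 'k"

text \<open>
  Sweedler notation: \<open>sweedler K C P f x\<close> is \<open>f x\<^sub>(\<^sub>1\<^sub>) x\<^sub>(\<^sub>2\<^sub>)\<close>, where \<open>f\<close> is bilinear with values in \<open>P\<close>.
\<close>

definition sweedler ::
    "('k, 'c) ring_scheme \<Rightarrow> ('k, 'a, 'e) hopf_scheme \<Rightarrow> ('k, 'p, 'q) module_scheme
      \<Rightarrow> ('a \<Rightarrow> 'a \<Rightarrow> 'p) \<Rightarrow> 'a \<Rightarrow> 'p"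
  where "sweedler K C P f x = tensor_lift K P f (comul C x)"

text \<open>
  Coassociativity is expressed in \<open>(C \<otimes> C) \<otimes> C\<close>, i.e. after rebracketing the right-hand side.
\<close>

locale coalgebra = module K C for K and C :: "('k, 'a, 'e) hopf_scheme" (structure) +
  assumes comul_linear: "linear_map K C (tensor K C C) (comul C)"
    and counit_linear: "linear_map K C (self_module K) (counit C)"
    and coassoc: "x \<in> carrier C \<Longrightarrow>
      sweedler K C (tensor K (tensor K C C) C) (\<lambda>y z.
        sweedler K C (tensor K (tensor K C C) C) (\<lambda>u v.
          tens K (tensor K C C) C (tens K C C u v) z) y) x =
      sweedler K C (tensor K (tensor K C C) C) (\<lambda>y z.
        sweedler K C (tensor K (tensor K C C) C) (\<lambda>u v.
          tens K (tensor K C C) C (tens K C C y u) v) z) x"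
    and counit_left: "x \<in> carrier C \<Longrightarrow> sweedler K C C (\<lambda>y z. counit C y \<odot>\<^bsub>C\<^esub> z) x = x"
    and counit_right: "x \<in> carrier C \<Longrightarrow> sweedler K C C (\<lambda>y z. counit C z \<odot>\<^bsub>C\<^esub> y) x = x"

locale bialgebra = assoc_algebra K A + coalgebra K A
  for K and A :: "('k, 'a, 'e) hopf_scheme" +
  assumes comul_mult: "\<lbrakk>x \<in> carrier A; y \<in> carrier A\<rbrakk> \<Longrightarrow>
      comul A (x \<otimes>\<^bsub>A\<^esub> y) = comul A x \<otimes>\<^bsub>tensor_algebra_prod K A A\<^esub> comul A y"
    and comul_one: "comul A \<one>\<^bsub>A\<^esub> = \<one>\<^bsub>tensor_algebra_prod K A A\<^esub>"
    and counit_mult: "\<lbrakk>x \<in> carrier A; y \<in> carrier A\<rbrakk> \<Longrightarrow>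
      counit A (x \<otimes>\<^bsub>A\<^esub> y) = counit A x \<otimes>\<^bsub>K\<^esub> counit A y"
    and counit_one: "counit A \<one>\<^bsub>A\<^esub> = \<one>\<^bsub>K\<^esub>"

definition is_antipode ::
    "('k, 'c) ring_scheme \<Rightarrow> ('k, 'a, 'e) hopf_scheme \<Rightarrow> ('a \<Rightarrow> 'a) \<Rightarrow> bool"
  where "is_antipode K A S \<longleftrightarrow> linear_map K A A S \<and>
    (\<forall>x\<in>carrier A. sweedler K A A (\<lambda>y z. S y \<otimes>\<^bsub>A\<^esub> z) x = counit A x \<odot>\<^bsub>A\<^esub> \<one>\<^bsub>A\<^esub>) \<and>
    (\<forall>x\<in>carrier A. sweedler K A A (\<lambda>y z. y \<otimes>\<^bsub>A\<^esub> S z) x = counit A x \<odot>\<^bsub>A\<^esub> \<one>\<^bsub>A\<^esub>)"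

text \<open>All Hopf algebras are required to have a bijective antipode.\<close>

locale hopf_algebra = bialgebra K A for K and A :: "('k, 'a, 'e) hopf_scheme" +
  assumes bij_antipode: "\<exists>S. is_antipode K A S \<and> bij_betw S (carrier A) (carrier A)"


section \<open>Lie algebras and actions by biderivations\<close>

record ('k, 'g) lie = "('k, 'g) module" +
  bracket :: "'g \<Rightarrow> 'g \<Rightarrow> 'g"

locale lie_algebra = module K G for K and G :: "('k, 'g, 'e) lie_scheme" (structure) +
  assumes bracket_bilinear: "bilinear_map K G G G (bracket G)"
    and bracket_self: "x \<in> carrier G \<Longrightarrow> bracket G x x = \<zero>\<^bsub>G\<^esub>"
    and jacobi: "\<lbrakk>x \<in> carrier G; y \<in> carrier G; z \<in> carrier G\<rbrakk> \<Longrightarrow>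
      bracket G x (bracket G y z) \<oplus>\<^bsub>G\<^esub> bracket G y (bracket G z x)
        \<oplus>\<^bsub>G\<^esub> bracket G z (bracket G x y) = \<zero>\<^bsub>G\<^esub>"

definition lie_module_action ::
    "('k, 'c) ring_scheme \<Rightarrow> ('k, 'g, 'e) lie_scheme \<Rightarrow> ('k, 'a, 'm) module_scheme
      \<Rightarrow> ('g \<Rightarrow> 'a \<Rightarrow> 'a) \<Rightarrow> bool"
  where "lie_module_action K G M act \<longleftrightarrow> bilinear_map K G M M act \<and>
    (\<forall>x\<in>carrier G. \<forall>y\<in>carrier G. \<forall>a\<in>carrier M.
      act (bracket G x y) a = act x (act y a) \<ominus>\<^bsub>M\<^esub> act y (act x a))"

definition acts_by_biderivations ::
    "('k, 'c) ring_scheme \<Rightarrow> ('k, 'g, 'e) lie_scheme \<Rightarrow> ('k, 'a, 'm) hopf_scheme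
      \<Rightarrow> ('g \<Rightarrow> 'a \<Rightarrow> 'a) \<Rightarrow> bool"
  where "acts_by_biderivations K G H act \<longleftrightarrow> lie_module_action K G H act \<and>
    (\<forall>x\<in>carrier G. \<forall>a\<in>carrier H. \<forall>b\<in>carrier H.
      act x (a \<otimes>\<^bsub>H\<^esub> b) = (act x a \<otimes>\<^bsub>H\<^esub> b) \<oplus>\<^bsub>H\<^esub> (a \<otimes>\<^bsub>H\<^esub> act x b)) \<and>
    (\<forall>x\<in>carrier G. \<forall>a\<in>carrier H.
      comul H (act x a) = sweedler K H (tensor K H H)
        (\<lambda>a1 a2. tens K H H (act x a1) a2 \<oplus>\<^bsub>tensor K H H\<^esub> tens K H H a1 (act x a2)) a) \<and>
    (\<forall>x\<in>carrier G. \<forall>a\<in>carrier H. counit H (act x a) = \<zero>\<^bsub>K\<^esub>)"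


section \<open>The universal enveloping algebra\<close>

text \<open>
  The free algebra on \<open>X\<close> has the words in \<open>X\<close> as a basis; the product is the bilinear extension of
  concatenation of words.
\<close>

definition free_algebra :: "('k, 'c) ring_scheme \<Rightarrow> 'x set \<Rightarrow> ('k, 'x list \<Rightarrow> 'k) module"
  where "free_algebra K X = (free_module K (lists X))
    \<lparr>mult := (\<lambda>\<phi> \<psi> w. \<Oplus>\<^bsub>K\<^esub>i\<in>{..length w}. \<phi> (take i w) \<otimes>\<^bsub>K\<^esub> \<psi> (drop i w)),
     one := free_gen K []\<rparr>"

text \<open>
  The first two families of relations turn the free algebra on the set \<open>G\<close> into the tensor algebra
  of the vector space \<open>G\<close>.
\<close>

definition uea_rels :: "('k, 'c) ring_scheme \<Rightarrow> ('k, 'g, 'e) lie_scheme \<Rightarrow> ('g list \<Rightarrow> 'k) set"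
  where "uea_rels K G =
    (let F = free_algebra K (carrier G); e = (\<lambda>x. free_gen K [x]) in
      {e (x \<oplus>\<^bsub>G\<^esub> y) \<ominus>\<^bsub>F\<^esub> (e x \<oplus>\<^bsub>F\<^esub> e y) | x y. x \<in> carrier G \<and> y \<in> carrier G} \<union>
      {e (c \<odot>\<^bsub>G\<^esub> x) \<ominus>\<^bsub>F\<^esub> c \<odot>\<^bsub>F\<^esub> e x | c x. c \<in> carrier K \<and> x \<in> carrier G} \<union>
      {(e x \<otimes>\<^bsub>F\<^esub> e y \<ominus>\<^bsub>F\<^esub> e y \<otimes>\<^bsub>F\<^esub> e x) \<ominus>\<^bsub>F\<^esub> e (bracket G x y) | x y.
          x \<in> carrier G \<and> y \<in> carrier G})"

definition uea_ideal :: "('k, 'c) ring_scheme \<Rightarrow> ('k, 'g, 'e) lie_scheme \<Rightarrow> ('g list \<Rightarrow> 'k) set"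
  where "uea_ideal K G = Idl\<^bsub>free_algebra K (carrier G)\<^esub> (uea_rels K G)"

definition uea_algebra ::
    "('k, 'c) ring_scheme \<Rightarrow> ('k, 'g, 'e) lie_scheme \<Rightarrow> ('k, ('g list \<Rightarrow> 'k) set) module"
  where "uea_algebra K G = quot_module (free_algebra K (carrier G)) (uea_ideal K G)"

definition uea_incl ::
    "('k, 'c) ring_scheme \<Rightarrow> ('k, 'g, 'e) lie_scheme \<Rightarrow> 'g \<Rightarrow> ('g list \<Rightarrow> 'k) set"
  where "uea_incl K G x = uea_ideal K G +>\<^bsub>free_algebra K (carrier G)\<^esub> free_gen K [x]"

text \<open>
  The algebra homomorphism from the enveloping algebra to \<open>A\<close> extending \<open>f\<close>, sending
  \<open>x\<^sub>1\<dots>x\<^sub>n\<close> to \<open>f x\<^sub>1 \<cdots> f x\<^sub>n\<close>.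
\<close>

definition uea_lift ::
    "('k, 'c) ring_scheme \<Rightarrow> ('k, 'a, 'm) module_scheme \<Rightarrow> ('g \<Rightarrow> 'a) \<Rightarrow> ('g list \<Rightarrow> 'k) set \<Rightarrow> 'a"
  where "uea_lift K A f = quot_lift K A (\<lambda>w. foldr (\<lambda>x a. f x \<otimes>\<^bsub>A\<^esub> a) w \<one>\<^bsub>A\<^esub>)"

text \<open>
  Comultiplication and counit are the algebra homomorphisms with \<open>x \<mapsto> x \<otimes> 1 + 1 \<otimes> x\<close> and
  \<open>x \<mapsto> 0\<close> for \<open>x\<close> in the Lie algebra.
\<close>

definition uea ::
    "('k, 'c) ring_scheme \<Rightarrow> ('k, 'g, 'e) lie_scheme \<Rightarrow> ('k, ('g list \<Rightarrow> 'k) set) hopf"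
  where "uea K G = (let U = uea_algebra K G in
    \<lparr>carrier = carrier U, mult = mult U, one = one U, zero = zero U, add = add U, smult = smult U,
     comul = uea_lift K (tensor_algebra_prod K U U)
       (\<lambda>x. tens K U U (uea_incl K G x) \<one>\<^bsub>U\<^esub> \<oplus>\<^bsub>tensor K U U\<^esub> tens K U U \<one>\<^bsub>U\<^esub> (uea_incl K G x)),
     counit = uea_lift K (self_module K) (\<lambda>x. \<zero>\<^bsub>K\<^esub>)\<rparr>)"

text \<open>
  The action of the enveloping algebra induced by a Lie module structure, with
  \<open>(x\<^sub>1\<dots>x\<^sub>n) \<cdot> a = x\<^sub>1 \<cdot> (\<dots> (x\<^sub>n \<cdot> a))\<close>.
\<close>

definition uea_action ::
    "('k, 'c) ring_scheme \<Rightarrow> ('k, 'a, 'm) module_scheme \<Rightarrow> ('g \<Rightarrow> 'a \<Rightarrow> 'a)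
      \<Rightarrow> ('g list \<Rightarrow> 'k) set \<Rightarrow> 'a \<Rightarrow> 'a"
  where "uea_action K M act u a = quot_lift K M (\<lambda>w. foldr act w a) u"


section \<open>Module Hopf algebras and smash products\<close>

definition left_module_action ::
    "('k, 'c) ring_scheme \<Rightarrow> ('k, 'l, 'e) module_scheme \<Rightarrow> ('k, 'a, 'm) module_scheme
      \<Rightarrow> ('l \<Rightarrow> 'a \<Rightarrow> 'a) \<Rightarrow> bool"
  where "left_module_action K L M act \<longleftrightarrow> bilinear_map K L M M act \<and>
    (\<forall>a\<in>carrier M. act \<one>\<^bsub>L\<^esub> a = a) \<and>
    (\<forall>l\<in>carrier L. \<forall>m\<in>carrier L. \<forall>a\<in>carrier M. act (l \<otimes>\<^bsub>L\<^esub> m) a = act l (act m a))"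

locale module_hopf_algebra = L: hopf_algebra K L + H: hopf_algebra K H
  for K and L :: "('k, 'l, 'e) hopf_scheme" and H :: "('k, 'a, 'm) hopf_scheme" +
  fixes act :: "'l \<Rightarrow> 'a \<Rightarrow> 'a"
  assumes action: "left_module_action K L H act"
    and act_mult: "\<lbrakk>l \<in> carrier L; a \<in> carrier H; b \<in> carrier H\<rbrakk> \<Longrightarrow>
      act l (a \<otimes>\<^bsub>H\<^esub> b) = sweedler K L H (\<lambda>l1 l2. act l1 a \<otimes>\<^bsub>H\<^esub> act l2 b) l"
    and act_one: "l \<in> carrier L \<Longrightarrow> act l \<one>\<^bsub>H\<^esub> = counit L l \<odot>\<^bsub>H\<^esub> \<one>\<^bsub>H\<^esub>"
    and act_comul: "\<lbrakk>l \<in> carrier L; a \<in> carrier H\<rbrakk> \<Longrightarrow>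
      comul H (act l a) =
        sweedler K L (tensor K H H) (\<lambda>l1 l2.
          sweedler K H (tensor K H H) (\<lambda>a1 a2. tens K H H (act l1 a1) (act l2 a2)) a) l"
    and act_counit: "\<lbrakk>l \<in> carrier L; a \<in> carrier H\<rbrakk> \<Longrightarrow>
      counit H (act l a) = counit L l \<otimes>\<^bsub>K\<^esub> counit H a"
    and act_cocommute: "\<lbrakk>l \<in> carrier L; a \<in> carrier H\<rbrakk> \<Longrightarrow>
      sweedler K L (tensor K L H) (\<lambda>l1 l2. tens K L H l1 (act l2 a)) l =
      sweedler K L (tensor K L H) (\<lambda>l1 l2. tens K L H l2 (act l1 a)) l"

text \<open>
  On \<open>H \<otimes> L\<close>: the smash product multiplication
  \<open>(a \<otimes> l)(b \<otimes> m) = a (l\<^sub>(\<^sub>1\<^sub>) \<cdot> b) \<otimes> l\<^sub>(\<^sub>2\<^sub>) m\<close>, and the tensor product coalgebra structure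
  \<open>a \<otimes> l \<mapsto> (a\<^sub>(\<^sub>1\<^sub>) \<otimes> l\<^sub>(\<^sub>1\<^sub>)) \<otimes> (a\<^sub>(\<^sub>2\<^sub>) \<otimes> l\<^sub>(\<^sub>2\<^sub>))\<close>, \<open>a \<otimes> l \<mapsto> \<epsilon>(a) \<epsilon>(l)\<close>.
\<close>

definition smash ::
    "('k, 'c) ring_scheme \<Rightarrow> ('k, 'a, 'm) hopf_scheme \<Rightarrow> ('k, 'l, 'e) hopf_scheme
      \<Rightarrow> ('l \<Rightarrow> 'a \<Rightarrow> 'a) \<Rightarrow> ('k, ('a \<times> 'l \<Rightarrow> 'k) set) hopf"
  where "smash K H L act = (let T = tensor K H L; TT = tensor K T T in
    \<lparr>carrier = carrier T,
     mult = (\<lambda>s t.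
       tensor_lift K T (\<lambda>a l.
         tensor_lift K T (\<lambda>b m.
           sweedler K L T (\<lambda>l1 l2. tens K H L (a \<otimes>\<^bsub>H\<^esub> act l1 b) (l2 \<otimes>\<^bsub>L\<^esub> m)) l) t) s),
     one = tens K H L \<one>\<^bsub>H\<^esub> \<one>\<^bsub>L\<^esub>,
     zero = zero T, add = add T, smult = smult T,
     comul = tensor_lift K TT (\<lambda>a l.
       sweedler K H TT (\<lambda>a1 a2.
         sweedler K L TT (\<lambda>l1 l2. tens K T T (tens K H L a1 l1) (tens K H L a2 l2)) l) a),
     counit = tensor_lift K (self_module K) (\<lambda>a l. counit H a \<otimes>\<^bsub>K\<^esub> counit L l)\<rparr>)"

end

theory Submission
  imports Defs
begin

text \<open>
  The enveloping algebra is spanned by monomials \<open>x\<^sub>1 \<dots> x\<^sub>n\<close> in elements of the Lie algebra, so a statement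
  that is linear in an element of it follows by induction once it holds for \<open>1\<close> and passes from \<open>u\<close> to \<open>x u\<close>. As \<open>x\<close> is
  primitive, a Sweedler sum of \<open>f u\<^sub>1 u\<^sub>2\<close> over \<open>x u\<close> in place of \<open>u\<close> becomes the sum of \<open>f (x u\<^sub>1) u\<^sub>2 + f u\<^sub>1 (x u\<^sub>2)\<close> over \<open>u\<close>. This product
  rule (\<open>uea_sweedler_incl_mult\<close>) makes all induction steps short. It yields coassociativity,
  cocommutativity, the counit laws and the antipode of the enveloping algebra
  (\<open>uea_hopf_algebra\<close>, \<open>uea_cocommutative\<close>). It also yields the axioms of a module Hopf algebra
  (\<open>uea_module_hopf_algebra\<close>): a biderivation obeys the same product rule with respect to the
  product and the coproduct of \<open>H\<close>.

  All maps out of the enveloping algebra come from one construction. A Lie module structure makes the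
  free algebra act, its annihilator is a two-sided ideal containing the defining relations, and so the
  enveloping algebra acts as well. The comultiplication, the counit and the antipode are actions
  applied to a unit element.

  The last part is obtained from the statement that the smash product of a module Hopf
  algebra \<open>H\<close> with any cocommutative Hopf algebra \<open>L\<close> is a Hopf algebra (\<open>smash_hopf_algebra\<close>).
  Associativity and the coalgebra laws are computations with Sweedler sums. Multiplicativity of the
  coproduct amounts to exchanging the middle factors of a fourfold coproduct in \<open>L\<close>. The antipode is
  \<open>a \<otimes> l \<mapsto> (1 \<otimes> S l) (S a \<otimes> 1)\<close>; it is bijective because \<open>S \<otimes> S\<close> is and because
  \<open>a \<otimes> l \<mapsto> (1 \<otimes> l) (a \<otimes> 1)\<close> has the inverse \<open>a \<otimes> l \<mapsto> S l\<^sub>1 \<cdot> a \<otimes> l\<^sub>2\<close>.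

  Tensor products are quotients of free modules. Everything about them is reduced to the universal
  property: bilinear maps induce linear maps (\<open>tensor_lift_tens\<close>, \<open>tensor_lift_linear\<close>), and
  linear maps that agree on pure tensors are equal (\<open>tensor_linear_eq\<close>). From this follow the
  rules that justify the usual manipulations of Sweedler sums, in particular reordering
  (\<open>sweedler_swap\<close>) and coassociativity for arbitrary trilinear maps (\<open>sweedler_coassoc\<close>).
\<close>

section \<open>Linear maps and modules\<close>

lemma (in abelian_group) minus_zeroD:
  assumes "x \<ominus> y = \<zero>" "x \<in> carrier G" "y \<in> carrier G"
  shows "x = y"
  using minus_equality[of x "\<ominus> y"] minus_minus[of y] assms by (simp add: a_minus_def)

lemma linear_mapI:
  assumes "\<And>x. x \<in> carrier M \<Longrightarrow> f x \<in> carrier N"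
    and "\<And>x y. x \<in> carrier M \<Longrightarrow> y \<in> carrier M \<Longrightarrow> f (x \<oplus>\<^bsub>M\<^esub> y) = f x \<oplus>\<^bsub>N\<^esub> f y"
    and "\<And>c x. c \<in> carrier K \<Longrightarrow> x \<in> carrier M \<Longrightarrow> f (c \<odot>\<^bsub>M\<^esub> x) = c \<odot>\<^bsub>N\<^esub> f x"
  shows "linear_map K M N f"
  using assms by (auto simp: linear_map_def)

lemma linear_map_closed: "linear_map K M N f \<Longrightarrow> x \<in> carrier M \<Longrightarrow> f x \<in> carrier N"
  and linear_map_add: "linear_map K M N f \<Longrightarrow> x \<in> carrier M \<Longrightarrow> y \<in> carrier M
    \<Longrightarrow> f (x \<oplus>\<^bsub>M\<^esub> y) = f x \<oplus>\<^bsub>N\<^esub> f y"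
  and linear_map_smult: "linear_map K M N f \<Longrightarrow> c \<in> carrier K \<Longrightarrow> x \<in> carrier M
    \<Longrightarrow> f (c \<odot>\<^bsub>M\<^esub> x) = c \<odot>\<^bsub>N\<^esub> f x"
  by (auto simp: linear_map_def)

lemma linear_map_zero:
  assumes "module K M" "module K N" "linear_map K M N f"
  shows "f \<zero>\<^bsub>M\<^esub> = \<zero>\<^bsub>N\<^esub>"
proof -
  interpret M: module K M by fact
  interpret N: module K N by fact
  have "f (\<zero>\<^bsub>K\<^esub> \<odot>\<^bsub>M\<^esub> \<zero>\<^bsub>M\<^esub>) = \<zero>\<^bsub>K\<^esub> \<odot>\<^bsub>N\<^esub> f \<zero>\<^bsub>M\<^esub>"
    by (rule linear_map_smult[OF assms(3)]) auto
  then show ?thesis using linear_map_closed[OF assms(3), of "\<zero>\<^bsub>M\<^esub>"] by simp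
qed

lemma linear_map_neg:
  assumes "module K M" "module K N" "linear_map K M N f" "x \<in> carrier M"
  shows "f (\<ominus>\<^bsub>M\<^esub> x) = \<ominus>\<^bsub>N\<^esub> f x"
proof -
  interpret M: module K M by fact
  interpret N: module K N by fact
  have "\<ominus>\<^bsub>M\<^esub> x = (\<ominus>\<^bsub>K\<^esub> \<one>\<^bsub>K\<^esub>) \<odot>\<^bsub>M\<^esub> x" using M.smult_l_minus[of "\<one>\<^bsub>K\<^esub>" x] assms(4) by simp
  moreover have "\<ominus>\<^bsub>N\<^esub> f x = (\<ominus>\<^bsub>K\<^esub> \<one>\<^bsub>K\<^esub>) \<odot>\<^bsub>N\<^esub> f x"
    using N.smult_l_minus[of "\<one>\<^bsub>K\<^esub>" "f x"] linear_map_closed[OF assms(3,4)] by simp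
  ultimately show ?thesis using linear_map_smult[OF assms(3) _ assms(4)] by simp
qed

lemma linear_map_minus:
  assumes "module K M" "module K N" "linear_map K M N f" "x \<in> carrier M" "y \<in> carrier M"
  shows "f (x \<ominus>\<^bsub>M\<^esub> y) = f x \<ominus>\<^bsub>N\<^esub> f y"
proof -
  interpret M: module K M by fact
  show ?thesis unfolding a_minus_def
    using linear_map_add[OF assms(3,4), of "\<ominus>\<^bsub>M\<^esub> y"] linear_map_neg[OF assms(1-3)] assms(5) by simp
qed

lemma linear_map_cong:
  assumes "\<And>x. x \<in> carrier M \<Longrightarrow> f x = g x" "linear_map K M N f" "module K M"
  shows "linear_map K M N g"
proof -
  interpret M: module K M by fact
  show ?thesis using assms(1,2) unfolding linear_map_def by (auto simp flip: assms(1))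
qed

lemma linear_map_inv_into:
  assumes M: "module K M" and f: "linear_map K M N f" and bij: "bij_betw f (carrier M) (carrier N)"
  shows "linear_map K N M (inv_into (carrier M) f)"
proof -
  interpret M: module K M by fact
  let ?g = "inv_into (carrier M) f"
  note gf = bij_betw_inv_into_left[OF bij] and fg = bij_betw_inv_into_right[OF bij]
  have c: "?g y \<in> carrier M" if "y \<in> carrier N" for y
    using bij_betwE[OF bij_betw_inv_into[OF bij]] that by blast
  show ?thesis
  proof (rule linear_mapI)
    fix x y assume xy: "x \<in> carrier N" "y \<in> carrier N"
    have "?g (f (?g x \<oplus>\<^bsub>M\<^esub> ?g y)) = ?g x \<oplus>\<^bsub>M\<^esub> ?g y" by (rule gf) (simp add: c xy)
    then show "?g (x \<oplus>\<^bsub>N\<^esub> y) = ?g x \<oplus>\<^bsub>M\<^esub> ?g y" by (simp add: linear_map_add[OF f] c xy fg)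
  next
    fix k x assume kx: "k \<in> carrier K" "x \<in> carrier N"
    have "?g (f (k \<odot>\<^bsub>M\<^esub> ?g x)) = k \<odot>\<^bsub>M\<^esub> ?g x" by (rule gf) (simp add: c kx)
    then show "?g (k \<odot>\<^bsub>N\<^esub> x) = k \<odot>\<^bsub>M\<^esub> ?g x" by (simp add: linear_map_smult[OF f] c kx fg)
  qed (rule c)
qed

lemma bilinear_mapI:
  assumes "\<And>x. x \<in> carrier M \<Longrightarrow> linear_map K N P (\<lambda>y. f x y)"
    and "\<And>y. y \<in> carrier N \<Longrightarrow> linear_map K M P (\<lambda>x. f x y)"
  shows "bilinear_map K M N P f"
  using assms by (auto simp: bilinear_map_def)

lemma bilinear_mapD:
  assumes "bilinear_map K M N P f"
  shows "x \<in> carrier M \<Longrightarrow> linear_map K N P (\<lambda>y. f x y)"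
    and "y \<in> carrier N \<Longrightarrow> linear_map K M P (\<lambda>x. f x y)"
  using assms by (auto simp: bilinear_map_def)

text \<open>
  Tensor algebras, enveloping algebras and smash products repackage the carrier and the module operations
  of one record in a record of another type; the transfer lemmas move the algebraic laws along.
\<close>

lemma abelian_group_transfer:
  assumes "abelian_group M" and "carrier N = carrier M" "zero N = zero M" "add N = add M"
  shows "abelian_group N"
proof -
  interpret M: abelian_group M by fact
  show ?thesis
    by (rule abelian_groupI) (auto simp: assms M.a_assoc intro: M.a_comm M.l_neg)
qed

lemma module_transfer:
  assumes "module K M"
    and "carrier N = carrier M" "zero N = zero M" "add N = add M" "smult N = smult M"
  shows "module K N"
proof -
  interpret M: module K M by fact
  show ?thesis
    by (intro moduleI abelian_groupI M.R.is_cring)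
      (auto simp: assms M.smult_l_distr M.smult_r_distr M.smult_assoc1 M.a_assoc intro: M.a_comm M.l_neg)
qed

lemma self_module_simps [simp]:
  "carrier (self_module K) = carrier K" "zero (self_module K) = zero K"
  "add (self_module K) = add K" "smult (self_module K) = mult K"
  "mult (self_module K) = mult K" "one (self_module K) = one K"
  by (auto simp: self_module_def)

lemma self_module_assoc_algebra:
  assumes "cring K" shows "assoc_algebra K (self_module K)"
proof -
  interpret cring K by fact
  have m: "module K (self_module K)"
    by (intro moduleI abelian_groupI is_cring)
      (auto simp: l_distr r_distr m_assoc a_assoc intro: a_comm l_neg)
  have r: "ring (self_module K)"
    by (intro ringI module.axioms(2)[OF m] monoidI) (auto simp: l_distr r_distr m_assoc)
  show ?thesis
    by (intro assoc_algebra.intro m r assoc_algebra_axioms.intro) (auto simp: m_assoc m_lcomm)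
qed

lemma assoc_algebra_module: "assoc_algebra K A \<Longrightarrow> module K A"
  and assoc_algebra_ring: "assoc_algebra K A \<Longrightarrow> ring A"
  by (auto simp: assoc_algebra_def)

lemma self_module_module: "cring K \<Longrightarrow> module K (self_module K)"
  by (intro assoc_algebra_module self_module_assoc_algebra)


section \<open>Free modules\<close>

lemma free_module_simps [simp]:
  "zero (free_module K X) = (\<lambda>x. \<zero>\<^bsub>K\<^esub>)"
  "add (free_module K X) = (\<lambda>\<phi> \<psi> x. \<phi> x \<oplus>\<^bsub>K\<^esub> \<psi> x)"
  "smult (free_module K X) = (\<lambda>c \<phi> x. c \<otimes>\<^bsub>K\<^esub> \<phi> x)"
  by (auto simp: free_module_def)

lemma free_module_carrier:
  "\<phi> \<in> carrier (free_module K X) \<longleftrightarrow> (\<forall>x. \<phi> x \<in> carrier K) \<and> finite {x. \<phi> x \<noteq> \<zero>\<^bsub>K\<^esub>} \<and>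
    {x. \<phi> x \<noteq> \<zero>\<^bsub>K\<^esub>} \<subseteq> X"
  by (auto simp: free_module_def)

lemma free_module_module:
  assumes "cring K" shows "module K (free_module K X)"
proof -
  interpret cring K by fact
  have add: "(\<lambda>x. \<phi> x \<oplus>\<^bsub>K\<^esub> \<psi> x) \<in> carrier (free_module K X)"
    if "\<phi> \<in> carrier (free_module K X)" "\<psi> \<in> carrier (free_module K X)" for \<phi> \<psi>
  proof -
    have "{x. \<phi> x \<oplus>\<^bsub>K\<^esub> \<psi> x \<noteq> \<zero>\<^bsub>K\<^esub>} \<subseteq> {x. \<phi> x \<noteq> \<zero>\<^bsub>K\<^esub>} \<union> {x. \<psi> x \<noteq> \<zero>\<^bsub>K\<^esub>}" by auto
    then show ?thesis using that unfolding free_module_carrier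
      by (meson a_closed finite_Un finite_subset le_sup_iff subset_trans)
  qed
  have smult: "(\<lambda>x. c \<otimes>\<^bsub>K\<^esub> \<phi> x) \<in> carrier (free_module K X)"
    if "c \<in> carrier K" "\<phi> \<in> carrier (free_module K X)" for c \<phi>
  proof -
    have "{x. c \<otimes>\<^bsub>K\<^esub> \<phi> x \<noteq> \<zero>\<^bsub>K\<^esub>} \<subseteq> {x. \<phi> x \<noteq> \<zero>\<^bsub>K\<^esub>}" using that(1) by auto
    then show ?thesis using that unfolding free_module_carrier
      by (meson m_closed finite_subset subset_trans)
  qed
  have el: "\<phi> x \<in> carrier K" if "\<phi> \<in> carrier (free_module K X)" for \<phi> x
    using that by (auto simp: free_module_carrier)
  show ?thesis
  proof (intro moduleI abelian_groupI is_cring)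
    fix \<phi> assume p: "\<phi> \<in> carrier (free_module K X)"
    show "\<exists>\<psi>\<in>carrier (free_module K X). \<psi> \<oplus>\<^bsub>free_module K X\<^esub> \<phi> = \<zero>\<^bsub>free_module K X\<^esub>"
    proof (rule bexI)
      show "(\<lambda>x. (\<ominus>\<^bsub>K\<^esub> \<one>\<^bsub>K\<^esub>) \<otimes>\<^bsub>K\<^esub> \<phi> x) \<in> carrier (free_module K X)" using p by (intro smult) auto
      show "(\<lambda>x. (\<ominus>\<^bsub>K\<^esub> \<one>\<^bsub>K\<^esub>) \<otimes>\<^bsub>K\<^esub> \<phi> x) \<oplus>\<^bsub>free_module K X\<^esub> \<phi> = \<zero>\<^bsub>free_module K X\<^esub>"
        using el[OF p] by (auto simp: l_minus l_neg)
    qed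
  next
    show "\<zero>\<^bsub>free_module K X\<^esub> \<in> carrier (free_module K X)" by (simp add: free_module_carrier)
  qed (simp_all add: add smult el l_distr r_distr m_assoc a_assoc a_comm a_lcomm)
qed

lemma free_gen_closed:
  assumes "cring K" "x \<in> X" shows "free_gen K x \<in> carrier (free_module K X)"
proof -
  interpret cring K by fact
  have "{y. free_gen K x y \<noteq> \<zero>\<^bsub>K\<^esub>} \<subseteq> {x}" by (auto simp: free_gen_def)
  then show ?thesis using assms(2)
    by (auto simp: free_module_carrier intro: finite_subset) (auto simp: free_gen_def)
qed

text \<open>
  The sum defining a linear extension runs over the support of its argument. To add two such sums,
  both are extended to the union of the supports.
\<close>

lemma free_lift_superset:
  assumes P: "module K P" and h: "h \<in> X \<rightarrow> carrier P" and \<phi>: "\<phi> \<in> carrier (free_module K X)"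
    and A: "finite A" "{x. \<phi> x \<noteq> \<zero>\<^bsub>K\<^esub>} \<subseteq> A" "A \<subseteq> X"
  shows "free_lift K P h \<phi> = (\<Oplus>\<^bsub>P\<^esub>x\<in>A. \<phi> x \<odot>\<^bsub>P\<^esub> h x)"
proof -
  interpret P: module K P by fact
  show ?thesis unfolding free_lift_def
    using A h \<phi> by (intro P.add.finprod_mono_neutral_cong_left) (auto simp: free_module_carrier Pi_def)
qed

lemma free_lift_linear:
  assumes P: "module K P" and h: "h \<in> X \<rightarrow> carrier P"
  shows "linear_map K (free_module K X) P (free_lift K P h)"
proof -
  interpret P: module K P by fact
  interpret F: module K "free_module K X" by (intro free_module_module P.R.is_cring)
  note c = free_module_carrier
  show ?thesis
  proof (rule linear_mapI)
    fix \<phi> assume p: "\<phi> \<in> carrier (free_module K X)"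
    then show "free_lift K P h \<phi> \<in> carrier P"
      unfolding free_lift_def using h by (intro P.finsum_closed) (auto simp: c Pi_def)
    fix c assume k: "c \<in> carrier K"
    let ?A = "{x. \<phi> x \<noteq> \<zero>\<^bsub>K\<^esub>}"
    have A: "finite ?A" "?A \<subseteq> X" using p by (auto simp: c)
    have "free_lift K P h (c \<odot>\<^bsub>free_module K X\<^esub> \<phi>) = (\<Oplus>\<^bsub>P\<^esub>x\<in>?A. (c \<odot>\<^bsub>free_module K X\<^esub> \<phi>) x \<odot>\<^bsub>P\<^esub> h x)"
      by (rule free_lift_superset[OF P h F.smult_closed[OF k p] A(1) _ A(2)]) (use k in auto)
    also have "\<dots> = (\<Oplus>\<^bsub>P\<^esub>x\<in>?A. c \<odot>\<^bsub>P\<^esub> (\<phi> x \<odot>\<^bsub>P\<^esub> h x))"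
      using k p h A(2) by (intro P.finsum_cong') (auto simp: P.smult_assoc1 c Pi_def subset_iff)
    also have "\<dots> = c \<odot>\<^bsub>P\<^esub> free_lift K P h \<phi>"
      unfolding free_lift_def using k p h A
      by (intro P.finsum_smult_ldistr[symmetric]) (auto simp: c Pi_def)
    finally show "free_lift K P h (c \<odot>\<^bsub>free_module K X\<^esub> \<phi>) = c \<odot>\<^bsub>P\<^esub> free_lift K P h \<phi>" .
  next
    fix \<phi> \<psi> assume p: "\<phi> \<in> carrier (free_module K X)" "\<psi> \<in> carrier (free_module K X)"
    let ?A = "{x. \<phi> x \<noteq> \<zero>\<^bsub>K\<^esub>} \<union> {x. \<psi> x \<noteq> \<zero>\<^bsub>K\<^esub>}"
    have A: "finite ?A" "?A \<subseteq> X" using p by (auto simp: c)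
    have "free_lift K P h (\<phi> \<oplus>\<^bsub>free_module K X\<^esub> \<psi>) = (\<Oplus>\<^bsub>P\<^esub>x\<in>?A. (\<phi> \<oplus>\<^bsub>free_module K X\<^esub> \<psi>) x \<odot>\<^bsub>P\<^esub> h x)"
      by (rule free_lift_superset[OF P h F.a_closed[OF p] A(1) _ A(2)]) auto
    also have "\<dots> = (\<Oplus>\<^bsub>P\<^esub>x\<in>?A. \<phi> x \<odot>\<^bsub>P\<^esub> h x \<oplus>\<^bsub>P\<^esub> \<psi> x \<odot>\<^bsub>P\<^esub> h x)"
      using p h A(2) by (intro P.finsum_cong') (auto simp: P.smult_l_distr c Pi_def subset_iff)
    also have "\<dots> = (\<Oplus>\<^bsub>P\<^esub>x\<in>?A. \<phi> x \<odot>\<^bsub>P\<^esub> h x) \<oplus>\<^bsub>P\<^esub> (\<Oplus>\<^bsub>P\<^esub>x\<in>?A. \<psi> x \<odot>\<^bsub>P\<^esub> h x)"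
      using p h A(2) by (intro P.finsum_addf) (auto simp: c Pi_def subset_iff)
    also have "\<dots> = free_lift K P h \<phi> \<oplus>\<^bsub>P\<^esub> free_lift K P h \<psi>"
      using free_lift_superset[OF P h p(1) A(1) _ A(2)] free_lift_superset[OF P h p(2) A(1) _ A(2)] by simp
    finally show "free_lift K P h (\<phi> \<oplus>\<^bsub>free_module K X\<^esub> \<psi>) = free_lift K P h \<phi> \<oplus>\<^bsub>P\<^esub> free_lift K P h \<psi>" .
  qed
qed

lemma free_lift_gen:
  assumes P: "module K P" and h: "h \<in> X \<rightarrow> carrier P" and x: "x \<in> X"
  shows "free_lift K P h (free_gen K x) = h x"
proof -
  interpret P: module K P by fact
  have "free_lift K P h (free_gen K x) = (\<Oplus>\<^bsub>P\<^esub>y\<in>{x}. free_gen K x y \<odot>\<^bsub>P\<^esub> h y)"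
    using x by (intro free_lift_superset[OF P h] free_gen_closed P.R.is_cring) (auto simp: free_gen_def)
  also have "\<dots> = h x" using h x by (auto simp: free_gen_def Pi_def)
  finally show ?thesis .
qed

text \<open>The induction removes one point of the support at a time.\<close>

lemma free_module_induct [consumes 2, case_names zero step]:
  assumes K: "cring K" and "\<phi> \<in> carrier (free_module K X)"
    and zero: "Q (\<lambda>x. \<zero>\<^bsub>K\<^esub>)"
    and step: "\<And>c x \<psi>. c \<in> carrier K \<Longrightarrow> x \<in> X \<Longrightarrow> \<psi> \<in> carrier (free_module K X) \<Longrightarrow> Q \<psi>
      \<Longrightarrow> Q (c \<odot>\<^bsub>free_module K X\<^esub> free_gen K x \<oplus>\<^bsub>free_module K X\<^esub> \<psi>)"
  shows "Q \<phi>"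
proof -
  interpret cring K by fact
  have "finite {x. \<phi> x \<noteq> \<zero>\<^bsub>K\<^esub>}" using assms(2) by (auto simp: free_module_carrier)
  then show ?thesis using assms(2)
  proof (induction "{x. \<phi> x \<noteq> \<zero>\<^bsub>K\<^esub>}" arbitrary: \<phi> rule: finite_induct)
    case empty
    then have "\<phi> = (\<lambda>x. \<zero>\<^bsub>K\<^esub>)" by auto
    then show ?case using zero by simp
  next
    case (insert x A)
    define \<psi> where "\<psi> = \<phi>(x := \<zero>\<^bsub>K\<^esub>)"
    have A: "A = {y. \<psi> y \<noteq> \<zero>\<^bsub>K\<^esub>}" using insert by (auto simp: \<psi>_def)
    have "\<psi> \<in> carrier (free_module K X)"
      using insert(2-) A insert(1) unfolding free_module_carrier by (auto simp: \<psi>_def)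
    then have "Q (\<phi> x \<odot>\<^bsub>free_module K X\<^esub> free_gen K x \<oplus>\<^bsub>free_module K X\<^esub> \<psi>)"
      using insert A by (intro step) (auto simp: free_module_carrier)
    also have "\<phi> x \<odot>\<^bsub>free_module K X\<^esub> free_gen K x \<oplus>\<^bsub>free_module K X\<^esub> \<psi> = \<phi>"
      using insert.prems by (auto simp: free_gen_def \<psi>_def free_module_carrier fun_eq_iff)
    finally show ?case .
  qed
qed

lemma free_module_linear_eq:
  assumes "module K P" "linear_map K (free_module K X) P f" "linear_map K (free_module K X) P g"
    and "\<And>x. x \<in> X \<Longrightarrow> f (free_gen K x) = g (free_gen K x)"
    and "\<phi> \<in> carrier (free_module K X)"
  shows "f \<phi> = g \<phi>"
proof -
  have K: "cring K" using assms(1) by (rule module.axioms)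
  note F = free_module_module[OF K, of X]
  interpret F: module K "free_module K X" by (rule F)
  from K assms(5) show ?thesis
  proof (induction rule: free_module_induct)
    case zero
    then show ?case using linear_map_zero[OF F assms(1,2)] linear_map_zero[OF F assms(1,3)] by simp
  next
    case (step c x \<psi>)
    note cl = free_gen_closed[OF K step(2)] F.smult_closed[OF step(1) free_gen_closed[OF K step(2)]]
    show ?case
      by (simp only: step assms(4) cl linear_map_add[OF assms(2)] linear_map_add[OF assms(3)]
          linear_map_smult[OF assms(2)] linear_map_smult[OF assms(3)])
  qed
qed


section \<open>Submodules and quotients\<close>

lemma submodule_span:
  assumes "module K M" "S \<subseteq> carrier M"
  shows "submodule (span_submodule K M S) K M" "S \<subseteq> span_submodule K M S"
proof -
  interpret module K M by fact
  show "S \<subseteq> span_submodule K M S" by (auto simp: span_submodule_def)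
  have ex: "submodule (carrier M) K M \<and> S \<subseteq> carrier M" using assms(2) carrier_is_submodule by simp
  show "submodule (span_submodule K M S) K M"
  proof (rule submoduleI)
    show "span_submodule K M S \<subseteq> carrier M" using ex by (auto simp: span_submodule_def)
    show "\<zero>\<^bsub>M\<^esub> \<in> span_submodule K M S"
      by (auto simp: span_submodule_def submodule_def dest: subgroup.one_closed)
  next
    fix a b assume a: "a \<in> span_submodule K M S" and b: "b \<in> span_submodule K M S"
    show "\<ominus>\<^bsub>M\<^esub> a \<in> span_submodule K M S"
      using a submoduleE(3) unfolding span_submodule_def by blast
    show "a \<oplus>\<^bsub>M\<^esub> b \<in> span_submodule K M S"
      using a b submoduleE(5) unfolding span_submodule_def by blast
  next
    fix c x assume "c \<in> carrier K" "x \<in> span_submodule K M S"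
    then show "c \<odot>\<^bsub>M\<^esub> x \<in> span_submodule K M S"
      using submoduleE(4) unfolding span_submodule_def by blast
  qed
qed

lemma span_submodule_least: "submodule N K M \<Longrightarrow> S \<subseteq> N \<Longrightarrow> span_submodule K M S \<subseteq> N"
  by (auto simp: span_submodule_def)

lemma submodule_kernel:
  assumes "module K M" "module K N" "linear_map K M N f"
  shows "submodule {x \<in> carrier M. f x = \<zero>\<^bsub>N\<^esub>} K M"
proof -
  interpret M: module K M by fact
  interpret N: module K N by fact
  show ?thesis
    by (rule M.submoduleI)
      (auto simp: linear_map_zero[OF assms] linear_map_neg[OF assms] linear_map_add[OF assms(3)]
        linear_map_smult[OF assms(3)])
qed

locale submodule_quotient = module K M for K and M (structure) +
  fixes N
  assumes N: "submodule N K M"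
begin

sublocale abelian_subgroup N M
  using N by (intro abelian_subgroupI3 additive_subgroupI abelian_group_axioms) (simp add: submodule_def)

lemma quot_simps:
  "zero (quot_module M N) = N" "carrier (quot_module M N) = a_rcosets N"
  "add (quot_module M N) = set_add M"
  by (simp_all add: quot_module_def FactRing_def)

lemma coset_closed: "x \<in> carrier M \<Longrightarrow> N +> x \<in> carrier (quot_module M N)"
  by (auto simp: quot_simps intro: a_rcosetsI a_subset)

lemma quot_cases:
  assumes "A \<in> carrier (quot_module M N)" obtains x where "x \<in> carrier M" "A = N +> x"
  using assms by (auto simp: quot_simps A_RCOSETS_def')

lemma coset_add: "x \<in> carrier M \<Longrightarrow> y \<in> carrier M \<Longrightarrow>
   (N +> x) \<oplus>\<^bsub>quot_module M N\<^esub> (N +> y) = N +> (x \<oplus> y)"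
  by (simp add: quot_simps a_rcos_sum)

lemma coset_eq_iff:
  assumes "x \<in> carrier M" "y \<in> carrier M"
  shows "N +> x = N +> y \<longleftrightarrow> x \<ominus> y \<in> N"
proof -
  have "N +> x = N +> y \<longleftrightarrow> x \<in> N +> y"
    using a_repr_independence'[OF _ assms(2), of x] a_rcos_self[OF assms(1)] by metis
  then show ?thesis using a_rcos_module[OF assms(2,1)] by (simp add: a_minus_def)
qed

lemma coset_smult:
  assumes c: "c \<in> carrier K" and x: "x \<in> carrier M"
  shows "c \<odot>\<^bsub>quot_module M N\<^esub> (N +> x) = N +> (c \<odot> x)"
proof -
  have "N +> (c \<odot> a) = N +> (c \<odot> x)" if a: "a \<in> N +> x" for a
  proof -
    have ac: "a \<in> carrier M" using a x by (rule a_elemrcos_carrier[rotated])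
    have "a \<ominus> x \<in> N" using a_rcos_module[OF x ac] a by (simp add: a_minus_def)
    then have "c \<odot> (a \<ominus> x) \<in> N" using submoduleE(4)[OF N c] by simp
    then have "c \<odot> a \<ominus> c \<odot> x \<in> N" using c x ac by (simp add: a_minus_def smult_r_distr smult_r_minus)
    then show ?thesis using c x ac by (simp add: coset_eq_iff)
  qed
  then have "(\<Union>a\<in>N +> x. N +> (c \<odot> a)) = (\<Union>a\<in>N +> x. N +> (c \<odot> x))" by (intro SUP_cong refl)
  also have "\<dots> = N +> (c \<odot> x)" using a_rcos_self[OF x] by blast
  finally show ?thesis by (simp add: quot_module_def)
qed

lemma quot_module_module: "module K (quot_module M N)"
proof (intro moduleI R.is_cring)
  have "abelian_group (M Quot N)"
    by (rule comm_group_abelian_groupI)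
      (use a_factorgroup_is_comm_group in \<open>simp add: A_FactGroup_def' FactRing_def\<close>)
  then interpret Q: abelian_group "M Quot N" .
  show "abelian_group (quot_module M N)"
    by (rule abelian_group_transfer[OF Q.abelian_group_axioms]) (simp_all add: quot_module_def)
qed (auto elim!: quot_cases simp: coset_smult coset_add coset_closed smult_l_distr smult_r_distr smult_assoc1)

lemma coset_linear: "linear_map K M (quot_module M N) (\<lambda>x. N +> x)"
  by (rule linear_mapI) (auto simp: coset_smult coset_add coset_closed)

end

text \<open>
  Two representatives of a coset differ by an element on which the linear extension vanishes, so the
  choice made by \<open>quot_lift\<close> does not matter. The module structure on the finitely supported functions is left
  open in order to cover free modules as well as free algebras.
\<close>

lemma quot_lift_coset:
  fixes M :: "('k, 'x \<Rightarrow> 'k, 'm) module_scheme"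
  assumes "submodule_quotient K M N" and P: "module K P"
    and lin: "linear_map K M P (free_lift K P h)"
    and null: "\<And>x. x \<in> N \<Longrightarrow> free_lift K P h x = \<zero>\<^bsub>P\<^esub>" and x: "x \<in> carrier M"
  shows "quot_lift K P h (N +>\<^bsub>M\<^esub> x) = free_lift K P h x"
proof -
  interpret submodule_quotient K M N by fact
  interpret P: module K P by fact
  define y where "y = (SOME y. y \<in> N +>\<^bsub>M\<^esub> x)"
  have y: "y \<in> N +>\<^bsub>M\<^esub> x" unfolding y_def by (rule someI[of "\<lambda>y. y \<in> N +>\<^bsub>M\<^esub> x", OF a_rcos_self[OF x]])
  then have yc: "y \<in> carrier M" using x by (metis a_elemrcos_carrier)
  have "y \<ominus>\<^bsub>M\<^esub> x \<in> N" using a_rcos_module[OF x yc] y by (simp add: a_minus_def)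
  then have "free_lift K P h (y \<ominus>\<^bsub>M\<^esub> x) = \<zero>\<^bsub>P\<^esub>" by (rule null)
  then have "free_lift K P h y \<ominus>\<^bsub>P\<^esub> free_lift K P h x = \<zero>\<^bsub>P\<^esub>"
    by (simp only: linear_map_minus[OF module_axioms P lin yc x])
  then have "free_lift K P h y = free_lift K P h x"
    by (rule P.minus_zeroD[OF _ linear_map_closed[OF lin yc] linear_map_closed[OF lin x]])
  then show ?thesis by (simp only: quot_lift_def y_def)
qed

lemma quot_lift_linear:
  fixes M :: "('k, 'x \<Rightarrow> 'k, 'm) module_scheme"
  assumes "submodule_quotient K M N" "module K P"
    and lin: "linear_map K M P (free_lift K P h)"
    and "\<And>x. x \<in> N \<Longrightarrow> free_lift K P h x = \<zero>\<^bsub>P\<^esub>"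
  shows "linear_map K (quot_module M N) P (quot_lift K P h)"
proof -
  interpret submodule_quotient K M N by fact
  show ?thesis
  proof (rule linear_mapI)
    note q = quot_lift_coset[OF assms] and l = linear_map_closed[OF lin] linear_map_add[OF lin] linear_map_smult[OF lin]
    fix A assume "A \<in> carrier (quot_module M N)"
    then obtain x where x: "x \<in> carrier M" "A = N +>\<^bsub>M\<^esub> x" by (rule quot_cases)
    show "quot_lift K P h A \<in> carrier P" by (simp add: x q l)
    show "quot_lift K P h (c \<odot>\<^bsub>quot_module M N\<^esub> A) = c \<odot>\<^bsub>P\<^esub> quot_lift K P h A"
      if "c \<in> carrier K" for c using that by (simp add: x q l coset_smult)
    fix B assume "B \<in> carrier (quot_module M N)"
    then obtain y where y: "y \<in> carrier M" "B = N +>\<^bsub>M\<^esub> y" by (rule quot_cases)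
    show "quot_lift K P h (A \<oplus>\<^bsub>quot_module M N\<^esub> B) = quot_lift K P h A \<oplus>\<^bsub>P\<^esub> quot_lift K P h B"
      by (simp add: x y q l coset_add)
  qed
qed

section \<open>Tensor products\<close>

lemma bilinear_map_pair: "bilinear_map K M N P f \<Longrightarrow> (\<lambda>(x, y). f x y) \<in> carrier M \<times> carrier N \<rightarrow> carrier P"
  by (auto simp: bilinear_map_def linear_map_def)

lemma tensor_rels_closed:
  assumes "module K M" "module K N"
  shows "tensor_rels K M N \<subseteq> carrier (free_module K (carrier M \<times> carrier N))"
proof -
  interpret M: module K M by fact
  interpret N: module K N by fact
  interpret F: module K "free_module K (carrier M \<times> carrier N)" by (intro free_module_module M.R.is_cring)
  have e: "free_gen K (x, y) \<in> carrier (free_module K (carrier M \<times> carrier N))"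
    if "x \<in> carrier M" "y \<in> carrier N" for x y using that by (intro free_gen_closed M.R.is_cring) auto
  show ?thesis
    unfolding tensor_rels_def Let_def
    by (intro Un_least subsetI; clarify; intro F.minus_closed F.a_closed F.smult_closed e; simp)
qed

lemma tensor_quotient:
  assumes "module K M" "module K N"
  shows "submodule_quotient K (free_module K (carrier M \<times> carrier N)) (tensor_null K M N)"
proof -
  interpret M: module K M by fact
  have F: "module K (free_module K (carrier M \<times> carrier N))" by (intro free_module_module M.R.is_cring)
  show ?thesis
    unfolding tensor_null_def
    by (intro submodule_quotient.intro F submodule_quotient_axioms.intro submodule_span tensor_rels_closed assms)
qed

text \<open>
  From here on almost every step is an identity between multilinear expressions, whose only side
  conditions are linearity in a variable and membership in a carrier. These rules establish such
  conditions by plain resolution: which rule decomposes an expression is determined by its outermost operation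
  and by the argument in which the variable occurs. So \<open>(rule multilin | assumption)+\<close>, with
  the facts about the structures at hand added, needs no search.
\<close>

named_theorems multilin \<open>introduction rules for linearity and for membership in carriers\<close>

lemma tensor_module [multilin]: "module K M \<Longrightarrow> module K N \<Longrightarrow> module K (tensor K M N)"
  unfolding tensor_def by (intro submodule_quotient.quot_module_module tensor_quotient)

lemma tens_closed [multilin]:
  assumes "module K M" "module K N" "x \<in> carrier M" "y \<in> carrier N"
  shows "tens K M N x y \<in> carrier (tensor K M N)"
proof -
  interpret M: module K M by fact
  show ?thesis unfolding tensor_def tens_def
    using assms
    by (intro submodule_quotient.coset_closed[OF tensor_quotient] free_gen_closed M.R.is_cring) auto
qed

text \<open>
  Each of the four families of relations is one of the four laws that make up bilinearity.
\<close>

lemma tens_bilinear: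
  assumes "module K M" "module K N"
  shows "bilinear_map K M N (tensor K M N) (tens K M N)"
proof -
  let ?F = "free_module K (carrier M \<times> carrier N)" and ?N = "tensor_null K M N"
  interpret M: module K M by fact
  interpret N: module K N by fact
  interpret Q: submodule_quotient K ?F ?N by (intro tensor_quotient assms)
  let ?e = "\<lambda>x y. free_gen K (x, y)"
  have e: "free_gen K (x, y) \<in> carrier ?F"
    if "x \<in> carrier M" "y \<in> carrier N" for x y using that by (intro free_gen_closed M.R.is_cring) auto
  note t = tensor_def tens_def
  have null: "r \<in> ?N" if "r \<in> tensor_rels K M N" for r
    using submodule_span(2)[OF Q.module_axioms tensor_rels_closed[OF assms]] that
    by (auto simp: tensor_null_def)
  have eq: "?N +>\<^bsub>?F\<^esub> r = ?N +>\<^bsub>?F\<^esub> s"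
    if "r \<ominus>\<^bsub>?F\<^esub> s \<in> tensor_rels K M N" "r \<in> carrier ?F" "s \<in> carrier ?F" for r s
    using Q.coset_eq_iff[OF that(2,3)] null[OF that(1)] by blast
  note R = tensor_rels_def[of K M N, unfolded Let_def]
  show ?thesis
  proof (intro bilinear_mapI linear_mapI)
    fix x y z assume c: "x \<in> carrier M" "y \<in> carrier N" "z \<in> carrier N"
    have "?N +>\<^bsub>?F\<^esub> ?e x (y \<oplus>\<^bsub>N\<^esub> z) = ?N +>\<^bsub>?F\<^esub> (?e x y \<oplus>\<^bsub>?F\<^esub> ?e x z)"
      by (rule eq) (use c in \<open>unfold R, blast\<close>, (intro Q.M.a_closed e N.a_closed c)+)
    then show "tens K M N x (y \<oplus>\<^bsub>N\<^esub> z) = tens K M N x y \<oplus>\<^bsub>tensor K M N\<^esub> tens K M N x z"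
      unfolding t using c by (simp only: Q.coset_add e)
  next
    fix x y z assume c: "x \<in> carrier M" "z \<in> carrier M" "y \<in> carrier N"
    have "?N +>\<^bsub>?F\<^esub> ?e (x \<oplus>\<^bsub>M\<^esub> z) y = ?N +>\<^bsub>?F\<^esub> (?e x y \<oplus>\<^bsub>?F\<^esub> ?e z y)"
      by (rule eq) (use c in \<open>unfold R, blast\<close>, (intro Q.M.a_closed e M.a_closed c)+)
    then show "tens K M N (x \<oplus>\<^bsub>M\<^esub> z) y = tens K M N x y \<oplus>\<^bsub>tensor K M N\<^esub> tens K M N z y"
      unfolding t using c by (simp only: Q.coset_add e)
  next
    fix x y k assume c: "x \<in> carrier M" "k \<in> carrier K" "y \<in> carrier N"
    have "?N +>\<^bsub>?F\<^esub> ?e (k \<odot>\<^bsub>M\<^esub> x) y = ?N +>\<^bsub>?F\<^esub> (k \<odot>\<^bsub>?F\<^esub> ?e x y)"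
      by (rule eq) (use c in \<open>unfold R, blast\<close>, (intro Q.smult_closed e M.smult_closed c)+)
    then show "tens K M N (k \<odot>\<^bsub>M\<^esub> x) y = k \<odot>\<^bsub>tensor K M N\<^esub> tens K M N x y"
      unfolding t using c by (simp only: Q.coset_smult e)
    have "?N +>\<^bsub>?F\<^esub> ?e x (k \<odot>\<^bsub>N\<^esub> y) = ?N +>\<^bsub>?F\<^esub> (k \<odot>\<^bsub>?F\<^esub> ?e x y)"
      by (rule eq) (use c in \<open>unfold R, blast\<close>, (intro Q.smult_closed e N.smult_closed c)+)
    then show "tens K M N x (k \<odot>\<^bsub>N\<^esub> y) = k \<odot>\<^bsub>tensor K M N\<^esub> tens K M N x y"
      unfolding t using c by (simp only: Q.coset_smult e)
  qed (intro tens_closed assms; assumption)+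
qed

text \<open>
  The kernel of the linear extension of a bilinear map is a submodule, and it contains the relations
  by bilinearity. Hence it contains everything that is factored out.
\<close>

lemma tensor_lift_null:
  assumes "module K M" "module K N" "module K P" and f: "bilinear_map K M N P f"
    and r: "r \<in> tensor_null K M N"
  shows "free_lift K P (\<lambda>(x, y). f x y) r = \<zero>\<^bsub>P\<^esub>"
proof -
  let ?F = "free_module K (carrier M \<times> carrier N)" and ?h = "\<lambda>(x, y). f x y"
  interpret M: module K M by fact
  interpret N: module K N by fact
  interpret P: module K P by fact
  interpret F: module K ?F by (intro free_module_module M.R.is_cring)
  have e: "free_gen K (x, y) \<in> carrier ?F"
    if "x \<in> carrier M" "y \<in> carrier N" for x y using that by (intro free_gen_closed M.R.is_cring) auto
  note h = bilinear_map_pair[OF f]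
  note lin = free_lift_linear[OF assms(3) h]
  have gen: "free_lift K P ?h (free_gen K (x, y)) = f x y" if "x \<in> carrier M" "y \<in> carrier N" for x y
    using free_lift_gen[OF assms(3) h, of "(x, y)"] that by simp
  have fc: "f x y \<in> carrier P" if "x \<in> carrier M" "y \<in> carrier N" for x y
    using linear_map_closed[OF bilinear_mapD(1)[OF f]] that by auto
  have ker: "r \<ominus>\<^bsub>?F\<^esub> s \<in> {r \<in> carrier ?F. free_lift K P ?h r = \<zero>\<^bsub>P\<^esub>}"
    if "r \<in> carrier ?F" "s \<in> carrier ?F" "free_lift K P ?h r = free_lift K P ?h s" for r s
    using linear_map_minus[OF F.module_axioms assms(3) lin that(1,2)] that(3)
      linear_map_closed[OF lin that(2)] F.minus_closed[OF that(1,2)] by (simp add: a_minus_def P.r_neg)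
  have "tensor_rels K M N \<subseteq> {r \<in> carrier ?F. free_lift K P ?h r = \<zero>\<^bsub>P\<^esub>}"
    unfolding tensor_rels_def Let_def
    by (intro Un_least subsetI; elim CollectE exE conjE; hypsubst; rule ker)
      ((intro e F.a_closed F.smult_closed M.a_closed N.a_closed M.smult_closed N.smult_closed; assumption)
        | (simp only: gen linear_map_add[OF lin] linear_map_smult[OF lin]
        e M.a_closed N.a_closed M.smult_closed N.smult_closed
        linear_map_add[OF bilinear_mapD(1)[OF f]] linear_map_add[OF bilinear_mapD(2)[OF f]]
        linear_map_smult[OF bilinear_mapD(1)[OF f]] linear_map_smult[OF bilinear_mapD(2)[OF f]]))+
  then show ?thesis
    using r span_submodule_least[OF submodule_kernel[OF F.module_axioms assms(3) lin]]
    unfolding tensor_null_def by auto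
qed

lemma tensor_lift_tens:
  assumes "module K M" "module K N" "module K P" "bilinear_map K M N P f"
    and "x \<in> carrier M" "y \<in> carrier N"
  shows "tensor_lift K P f (tens K M N x y) = f x y"
proof -
  interpret M: module K M by fact
  have e: "free_gen K (x, y) \<in> carrier (free_module K (carrier M \<times> carrier N))"
    using assms(5,6) by (intro free_gen_closed M.R.is_cring) auto
  note h = bilinear_map_pair[OF assms(4)]
  have "tensor_lift K P f (tens K M N x y) = free_lift K P (\<lambda>(x, y). f x y) (free_gen K (x, y))"
    unfolding tensor_lift_def tens_def
    by (rule quot_lift_coset[OF tensor_quotient[OF assms(1,2)] assms(3) free_lift_linear[OF assms(3) h]
        tensor_lift_null[OF assms(1-4)] e])
  then show ?thesis using free_lift_gen[OF assms(3) h, of "(x, y)"] assms(5,6) by simp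
qed

lemma tensor_lift_linear:
  assumes "module K M" "module K N" "module K P" "bilinear_map K M N P f"
  shows "linear_map K (tensor K M N) P (tensor_lift K P f)"
  unfolding tensor_def tensor_lift_def
  by (rule quot_lift_linear[OF tensor_quotient[OF assms(1,2)] assms(3)
        free_lift_linear[OF assms(3) bilinear_map_pair[OF assms(4)]] tensor_lift_null[OF assms]])

lemma tensor_linear_eq:
  assumes MN: "module K M" "module K N" and P: "module K P"
    and f: "linear_map K (tensor K M N) P f" and g: "linear_map K (tensor K M N) P g"
    and eq: "\<And>x y. x \<in> carrier M \<Longrightarrow> y \<in> carrier N \<Longrightarrow> f (tens K M N x y) = g (tens K M N x y)"
    and t: "t \<in> carrier (tensor K M N)"
  shows "f t = g t"
proof -
  let ?F = "free_module K (carrier M \<times> carrier N)" and ?N = "tensor_null K M N"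
  interpret submodule_quotient K ?F ?N by (intro tensor_quotient MN)
  obtain \<phi> where \<phi>: "\<phi> \<in> carrier ?F" "t = ?N +>\<^bsub>?F\<^esub> \<phi>"
    using t unfolding tensor_def by (rule quot_cases)
  have comp: "linear_map K ?F P (\<lambda>\<phi>. h (?N +>\<^bsub>?F\<^esub> \<phi>))" if h: "linear_map K (tensor K M N) P h" for h
    using h coset_linear unfolding tensor_def by (auto simp: linear_map_def Pi_def)
  show ?thesis unfolding \<phi>(2)
    by (rule free_module_linear_eq[OF P comp[OF f] comp[OF g] _ \<phi>(1)]) (use eq in \<open>auto simp: tens_def\<close>)
qed

section \<open>Rules for multilinear expressions\<close>

lemma linear_ident [multilin]: "linear_map K M M (\<lambda>x. x)"
  by (simp add: linear_map_def)

lemma linear_comp: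
  assumes "linear_map K N P f" "linear_map K M N g"
  shows "linear_map K M P (\<lambda>x. f (g x))"
  using assms by (auto simp: linear_map_def Pi_def)

lemma linear_zero [multilin]:
  assumes "module K P" shows "linear_map K M P (\<lambda>x. \<zero>\<^bsub>P\<^esub>)"
proof -
  interpret P: module K P by fact
  show ?thesis by (rule linear_mapI) auto
qed

lemma linear_add [multilin]:
  assumes "module K P" "linear_map K M P f" "linear_map K M P g"
  shows "linear_map K M P (\<lambda>x. f x \<oplus>\<^bsub>P\<^esub> g x)"
proof -
  interpret P: module K P by fact
  note c = linear_map_closed[OF assms(2)] linear_map_closed[OF assms(3)]
  show ?thesis using assms(2,3)
    by (intro linear_mapI)
      (simp_all add: c linear_map_add linear_map_smult P.smult_r_distr P.a_assoc P.a_lcomm)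
qed

lemma linear_neg [multilin]:
  assumes "module K P" "linear_map K M P f"
  shows "linear_map K M P (\<lambda>x. \<ominus>\<^bsub>P\<^esub> f x)"
proof -
  interpret P: module K P by fact
  note c = linear_map_closed[OF assms(2)]
  show ?thesis using assms(2)
    by (intro linear_mapI) (simp_all add: c linear_map_add linear_map_smult P.smult_r_minus P.minus_add)
qed

lemma linear_minus [multilin]:
  assumes "module K P" "linear_map K M P f" "linear_map K M P g"
  shows "linear_map K M P (\<lambda>x. f x \<ominus>\<^bsub>P\<^esub> g x)"
  unfolding a_minus_def using assms by (intro linear_add linear_neg)

lemma linear_smult_right [multilin]:
  assumes "module K P" "linear_map K M P f" "c \<in> carrier K"
  shows "linear_map K M P (\<lambda>x. c \<odot>\<^bsub>P\<^esub> f x)"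
proof -
  interpret P: module K P by fact
  note cl = linear_map_closed[OF assms(2)]
  show ?thesis using assms(2,3)
    by (intro linear_mapI)
      (simp_all add: cl linear_map_add linear_map_smult P.smult_r_distr P.R.m_comm flip: P.smult_assoc1)
qed

lemma linear_smult_left [multilin]:
  assumes "module K P" "linear_map K M (self_module K) f" "p \<in> carrier P"
  shows "linear_map K M P (\<lambda>x. f x \<odot>\<^bsub>P\<^esub> p)"
proof -
  interpret P: module K P by fact
  note cl = linear_map_closed[OF assms(2), simplified]
  show ?thesis using assms(2,3)
    by (intro linear_mapI)
      (simp_all add: cl linear_map_add linear_map_smult P.smult_l_distr P.smult_assoc1)
qed

lemma linear_mult_left [multilin]:
  assumes "assoc_algebra K A" "linear_map K M A f" "b \<in> carrier A"
  shows "linear_map K M A (\<lambda>x. f x \<otimes>\<^bsub>A\<^esub> b)"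
proof -
  interpret A: assoc_algebra K A by fact
  note c = linear_map_closed[OF assms(2)]
  show ?thesis using assms(2,3)
    by (intro linear_mapI) (simp_all add: c linear_map_add linear_map_smult A.l_distr A.smult_mult_left)
qed

lemma linear_mult_right [multilin]:
  assumes "assoc_algebra K A" "linear_map K M A f" "b \<in> carrier A"
  shows "linear_map K M A (\<lambda>x. b \<otimes>\<^bsub>A\<^esub> f x)"
proof -
  interpret A: assoc_algebra K A by fact
  note c = linear_map_closed[OF assms(2)]
  show ?thesis using assms(2,3)
    by (intro linear_mapI) (simp_all add: c linear_map_add linear_map_smult A.r_distr A.smult_mult_right)
qed

lemma linear_scalar_left [multilin]:
  assumes "cring K" "linear_map K M (self_module K) f" "b \<in> carrier K"
  shows "linear_map K M (self_module K) (\<lambda>x. f x \<otimes>\<^bsub>K\<^esub> b)"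
  using linear_mult_left[OF self_module_assoc_algebra[OF assms(1)] assms(2)] assms(3) by simp

lemma linear_scalar_right [multilin]:
  assumes "cring K" "linear_map K M (self_module K) f" "b \<in> carrier K"
  shows "linear_map K M (self_module K) (\<lambda>x. b \<otimes>\<^bsub>K\<^esub> f x)"
  using linear_mult_right[OF self_module_assoc_algebra[OF assms(1)] assms(2)] assms(3) by simp

lemma linear_tens_left [multilin]:
  assumes "module K M" "module K N" "linear_map K Q M f" "y \<in> carrier N"
  shows "linear_map K Q (tensor K M N) (\<lambda>x. tens K M N (f x) y)"
  by (rule linear_comp[OF bilinear_mapD(2)[OF tens_bilinear[OF assms(1,2)] assms(4)] assms(3)])

lemma linear_tens_right [multilin]:
  assumes "module K M" "module K N" "linear_map K Q N f" "y \<in> carrier M"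
  shows "linear_map K Q (tensor K M N) (\<lambda>x. tens K M N y (f x))"
  by (rule linear_comp[OF bilinear_mapD(1)[OF tens_bilinear[OF assms(1,2)] assms(4)] assms(3)])

lemmas [multilin] = bilinear_mapI self_module_module

lemma add_closed [multilin]: "module K P \<Longrightarrow> x \<in> carrier P \<Longrightarrow> y \<in> carrier P \<Longrightarrow> x \<oplus>\<^bsub>P\<^esub> y \<in> carrier P"
  by (rule abelian_monoid.a_closed[OF abelian_group.axioms(1)[OF module.axioms(2)]])

lemma neg_closed [multilin]: "module K P \<Longrightarrow> x \<in> carrier P \<Longrightarrow> \<ominus>\<^bsub>P\<^esub> x \<in> carrier P"
  by (rule abelian_group.a_inv_closed[OF module.axioms(2)])

lemma minus_closed [multilin]: "module K P \<Longrightarrow> x \<in> carrier P \<Longrightarrow> y \<in> carrier P \<Longrightarrow> x \<ominus>\<^bsub>P\<^esub> y \<in> carrier P"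
  by (rule abelian_group.minus_closed[OF module.axioms(2)])

lemma zero_closed [multilin]: "module K P \<Longrightarrow> \<zero>\<^bsub>P\<^esub> \<in> carrier P"
  by (rule abelian_monoid.zero_closed[OF abelian_group.axioms(1)[OF module.axioms(2)]])

lemma smult_closed [multilin]:
  "module K P \<Longrightarrow> c \<in> carrier K \<Longrightarrow> x \<in> carrier P \<Longrightarrow> c \<odot>\<^bsub>P\<^esub> x \<in> carrier P"
  by (rule module.smult_closed)

lemma mult_closed [multilin]:
  "assoc_algebra K A \<Longrightarrow> x \<in> carrier A \<Longrightarrow> y \<in> carrier A \<Longrightarrow> x \<otimes>\<^bsub>A\<^esub> y \<in> carrier A"
  by (rule monoid.m_closed[OF ring.is_monoid[OF assoc_algebra_ring]])

lemma one_closed [multilin]: "assoc_algebra K A \<Longrightarrow> \<one>\<^bsub>A\<^esub> \<in> carrier A"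
  by (rule monoid.one_closed[OF ring.is_monoid[OF assoc_algebra_ring]])

lemma scalar_mult_closed [multilin]:
  "cring K \<Longrightarrow> x \<in> carrier K \<Longrightarrow> y \<in> carrier K \<Longrightarrow> x \<otimes>\<^bsub>K\<^esub> y \<in> carrier K"
  by (rule monoid.m_closed[OF ring.is_monoid[OF cring.axioms(1)]])

text \<open>
  When the bilinear map depends linearly on a parameter, so does the induced map, because linearity in the
  parameter is an identity between linear maps on the tensor product and may be tested on pure tensors.
\<close>

lemma linear_tensor_lift_fun:
  assumes "module K M" "module K N" "module K P" "t \<in> carrier (tensor K M N)"
    and "\<And>z. z \<in> carrier Q \<Longrightarrow> bilinear_map K M N P (F z)"
    and "\<And>x y. x \<in> carrier M \<Longrightarrow> y \<in> carrier N \<Longrightarrow> linear_map K Q P (\<lambda>z. F z x y)"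
    and "module K Q"
  shows "linear_map K Q P (\<lambda>z. tensor_lift K P (F z) t)"
proof -
  interpret P: module K P by fact
  interpret Q: module K Q by fact
  note lift = tensor_lift_linear[OF assms(1-3)] and tens = tensor_lift_tens[OF assms(1-3)]
  show ?thesis
  proof (rule linear_mapI)
    fix z assume z: "z \<in> carrier Q"
    show "tensor_lift K P (F z) t \<in> carrier P"
      by (rule linear_map_closed[OF lift[OF assms(5)[OF z]] assms(4)])
    show "tensor_lift K P (F (c \<odot>\<^bsub>Q\<^esub> z)) t = c \<odot>\<^bsub>P\<^esub> tensor_lift K P (F z) t" if c: "c \<in> carrier K" for c
    proof (rule tensor_linear_eq[OF assms(1-3) _ _ _ assms(4)])
      show "linear_map K (tensor K M N) P (tensor_lift K P (F (c \<odot>\<^bsub>Q\<^esub> z)))"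
        using z c by (intro lift assms(5)) simp
      show "linear_map K (tensor K M N) P (\<lambda>t. c \<odot>\<^bsub>P\<^esub> tensor_lift K P (F z) t)"
        using z c by (intro linear_smult_right lift assms)
    qed (use z c in \<open>simp add: tens assms(5) linear_map_smult[OF assms(6)]\<close>)
    fix w assume w: "w \<in> carrier Q"
    show "tensor_lift K P (F (z \<oplus>\<^bsub>Q\<^esub> w)) t = tensor_lift K P (F z) t \<oplus>\<^bsub>P\<^esub> tensor_lift K P (F w) t"
    proof (rule tensor_linear_eq[OF assms(1-3) _ _ _ assms(4)])
      show "linear_map K (tensor K M N) P (tensor_lift K P (F (z \<oplus>\<^bsub>Q\<^esub> w)))"
        using z w by (intro lift assms(5)) simp
      show "linear_map K (tensor K M N) P (\<lambda>t. tensor_lift K P (F z) t \<oplus>\<^bsub>P\<^esub> tensor_lift K P (F w) t)"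
        using z w by (intro linear_add lift assms)
    qed (use z w in \<open>simp add: tens assms(5) linear_map_add[OF assms(6)]\<close>)
  qed
qed

lemma tensor_lift_cong:
  assumes "module K M" "module K N" "module K P" "t \<in> carrier (tensor K M N)"
    and "bilinear_map K M N P f" "bilinear_map K M N P g"
    and "\<And>x y. x \<in> carrier M \<Longrightarrow> y \<in> carrier N \<Longrightarrow> f x y = g x y"
  shows "tensor_lift K P f t = tensor_lift K P g t"
  by (rule tensor_linear_eq[OF assms(1-3) tensor_lift_linear[OF assms(1-3,5)]
        tensor_lift_linear[OF assms(1-3,6)] _ assms(4)])
    (simp add: tensor_lift_tens[OF assms(1-3,5)] tensor_lift_tens[OF assms(1-3,6)] assms(7))

lemma linear_tensor_lift:
  assumes "module K M" "module K N" "module K P" "module K Q" "t \<in> carrier (tensor K M N)"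
    and f: "bilinear_map K M N P f" and g: "linear_map K P Q g"
  shows "g (tensor_lift K P f t) = tensor_lift K Q (\<lambda>x y. g (f x y)) t"
proof -
  have b: "bilinear_map K M N Q (\<lambda>x y. g (f x y))"
    by (intro bilinear_mapI linear_comp[OF g] bilinear_mapD[OF f])
  show ?thesis
    by (rule tensor_linear_eq[OF assms(1,2,4) linear_comp[OF g tensor_lift_linear[OF assms(1-3) f]]
          tensor_lift_linear[OF assms(1,2,4) b] _ assms(5)])
      (simp add: tensor_lift_tens[OF assms(1-3) f] tensor_lift_tens[OF assms(1,2,4) b])
qed

section \<open>The tensor product of two algebras\<close>

lemma tensor_algebra_prod_simps [simp]:
  "carrier (tensor_algebra_prod K A B) = carrier (tensor K A B)"
  "zero (tensor_algebra_prod K A B) = zero (tensor K A B)"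
  "add (tensor_algebra_prod K A B) = add (tensor K A B)"
  "smult (tensor_algebra_prod K A B) = smult (tensor K A B)"
  "one (tensor_algebra_prod K A B) = tens K A B \<one>\<^bsub>A\<^esub> \<one>\<^bsub>B\<^esub>"
  by (simp_all add: tensor_algebra_prod_def)

lemma tensor_algebra_prod_mult:
  "mult (tensor_algebra_prod K A B) = (\<lambda>s t. tensor_lift K (tensor K A B) (\<lambda>a b.
     tensor_lift K (tensor K A B) (\<lambda>a' b'. tens K A B (a \<otimes>\<^bsub>A\<^esub> a') (b \<otimes>\<^bsub>B\<^esub> b')) t) s)"
  by (simp add: tensor_algebra_prod_def)

lemma linear_map_tensor_algebra_prod [simp]:
  "linear_map K M (tensor_algebra_prod K A B) f = linear_map K M (tensor K A B) f"
  "linear_map K (tensor_algebra_prod K A B) M g = linear_map K (tensor K A B) M g"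
  by (simp_all add: linear_map_def)

lemma tensor_algebra_mult_bilinear:
  assumes A: "assoc_algebra K A" and B: "assoc_algebra K B"
  shows "bilinear_map K (tensor K A B) (tensor K A B) (tensor K A B) (mult (tensor_algebra_prod K A B))"
    and "\<lbrakk>a \<in> carrier A; a' \<in> carrier A; b \<in> carrier B; b' \<in> carrier B\<rbrakk> \<Longrightarrow>
      tens K A B a b \<otimes>\<^bsub>tensor_algebra_prod K A B\<^esub> tens K A B a' b' = tens K A B (a \<otimes>\<^bsub>A\<^esub> a') (b \<otimes>\<^bsub>B\<^esub> b')"
proof -
  note m = assoc_algebra_module[OF A] assoc_algebra_module[OF B]
    tensor_module[OF assoc_algebra_module[OF A] assoc_algebra_module[OF B]]
  have 1: "bilinear_map K A B (tensor K A B) (\<lambda>a' b'. tens K A B (a \<otimes>\<^bsub>A\<^esub> a') (b \<otimes>\<^bsub>B\<^esub> b'))"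
    if "a \<in> carrier A" "b \<in> carrier B" for a b
    by (rule A B m that multilin | assumption)+
  have 2: "bilinear_map K A B (tensor K A B)
     (\<lambda>a b. tensor_lift K (tensor K A B) (\<lambda>a' b'. tens K A B (a \<otimes>\<^bsub>A\<^esub> a') (b \<otimes>\<^bsub>B\<^esub> b')) t)"
    if t: "t \<in> carrier (tensor K A B)" for t
    by (rule bilinear_mapI; rule linear_tensor_lift_fun[OF m t];
        (rule A B m 1 multilin | assumption)+)
  show "bilinear_map K (tensor K A B) (tensor K A B) (tensor K A B) (mult (tensor_algebra_prod K A B))"
    unfolding tensor_algebra_prod_mult
  proof (rule bilinear_mapI)
    fix s assume s: "s \<in> carrier (tensor K A B)"
    show "linear_map K (tensor K A B) (tensor K A B) (\<lambda>t. tensor_lift K (tensor K A B) (\<lambda>a b.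
         tensor_lift K (tensor K A B) (\<lambda>a' b'. tens K A B (a \<otimes>\<^bsub>A\<^esub> a') (b \<otimes>\<^bsub>B\<^esub> b')) t) s)"
      by (rule linear_tensor_lift_fun[OF m s 2 _ m(3)], assumption)
        (intro tensor_lift_linear m 1; assumption)
    show "linear_map K (tensor K A B) (tensor K A B) (\<lambda>t. tensor_lift K (tensor K A B) (\<lambda>a b.
         tensor_lift K (tensor K A B) (\<lambda>a' b'. tens K A B (a \<otimes>\<^bsub>A\<^esub> a') (b \<otimes>\<^bsub>B\<^esub> b')) s) t)"
      by (intro tensor_lift_linear m 2 s)
  qed
  assume c: "a \<in> carrier A" "a' \<in> carrier A" "b \<in> carrier B" "b' \<in> carrier B"
  show "tens K A B a b \<otimes>\<^bsub>tensor_algebra_prod K A B\<^esub> tens K A B a' b' = tens K A B (a \<otimes>\<^bsub>A\<^esub> a') (b \<otimes>\<^bsub>B\<^esub> b')"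
    unfolding tensor_algebra_prod_mult
    using c by (simp add: tensor_lift_tens[OF m 2] tensor_lift_tens[OF m 1] tens_closed[OF m(1,2)])
qed

text \<open>
  The associativity and unit laws are identities between multilinear maps, so it suffices to verify them
  on pure tensors, where they hold componentwise.
\<close>

lemma tensor_algebra_prod_assoc_algebra:
  assumes A: "assoc_algebra K A" and B: "assoc_algebra K B"
  shows "assoc_algebra K (tensor_algebra_prod K A B)"
proof -
  let ?T = "tensor K A B" and ?P = "tensor_algebra_prod K A B"
  interpret A: assoc_algebra K A by fact
  interpret B: assoc_algebra K B by fact
  note m = assoc_algebra_module[OF A] assoc_algebra_module[OF B]
    tensor_module[OF assoc_algebra_module[OF A] assoc_algebra_module[OF B]]
  note bil = tensor_algebra_mult_bilinear(1)[OF A B] and mt = tensor_algebra_mult_bilinear(2)[OF A B]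
  note l = bilinear_mapD(2)[OF bil] and r = bilinear_mapD(1)[OF bil]
  have ll: "linear_map K Q ?T (\<lambda>x. f x \<otimes>\<^bsub>?P\<^esub> t)"
    if "t \<in> carrier ?T" "linear_map K Q ?T f" for Q :: "('a, 'z, 'w) module_scheme" and f t
    by (rule linear_comp[OF l[OF that(1)] that(2)])
  have rr: "linear_map K Q ?T (\<lambda>x. t \<otimes>\<^bsub>?P\<^esub> f x)"
    if "t \<in> carrier ?T" "linear_map K Q ?T f" for Q :: "('a, 'z, 'w) module_scheme" and f t
    by (rule linear_comp[OF r[OF that(1)] that(2)])
  have closed: "s \<otimes>\<^bsub>?P\<^esub> t \<in> carrier ?T" if "s \<in> carrier ?T" "t \<in> carrier ?T" for s t
    by (rule linear_map_closed[OF l[OF that(2)] that(1)])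
  note tc = tens_closed[OF m(1,2)]
  have assoc: "(s \<otimes>\<^bsub>?P\<^esub> t) \<otimes>\<^bsub>?P\<^esub> u = s \<otimes>\<^bsub>?P\<^esub> (t \<otimes>\<^bsub>?P\<^esub> u)"
    if "s \<in> carrier ?T" "t \<in> carrier ?T" "u \<in> carrier ?T" for s t u
  proof (rule tensor_linear_eq[OF m _ _ _ that(1)])
    fix a b assume ab: "a \<in> carrier A" "b \<in> carrier B"
    show "(tens K A B a b \<otimes>\<^bsub>?P\<^esub> t) \<otimes>\<^bsub>?P\<^esub> u = tens K A B a b \<otimes>\<^bsub>?P\<^esub> (t \<otimes>\<^bsub>?P\<^esub> u)"
    proof (rule tensor_linear_eq[OF m _ _ _ that(2)])
      fix c d assume cd: "c \<in> carrier A" "d \<in> carrier B"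
      show "(tens K A B a b \<otimes>\<^bsub>?P\<^esub> tens K A B c d) \<otimes>\<^bsub>?P\<^esub> u = tens K A B a b \<otimes>\<^bsub>?P\<^esub> (tens K A B c d \<otimes>\<^bsub>?P\<^esub> u)"
        by (rule tensor_linear_eq[OF m _ _ _ that(3)])
          (use ab cd in \<open>simp_all add: mt A.m_assoc B.m_assoc\<close>, (intro ll rr tc closed linear_ident that; simp)+)
    qed (intro ll rr tc ab closed linear_ident that)+
  qed (intro ll rr closed linear_ident that)+
  have one: "\<one>\<^bsub>?P\<^esub> \<otimes>\<^bsub>?P\<^esub> t = t" "t \<otimes>\<^bsub>?P\<^esub> \<one>\<^bsub>?P\<^esub> = t" if t: "t \<in> carrier ?T" for t
    by (rule tensor_linear_eq[OF m _ _ _ t];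
        (simp add: mt)?; (intro ll rr tc linear_ident; simp)?)+
  show ?thesis
  proof (intro assoc_algebra.intro assoc_algebra_axioms.intro ringI monoidI)
    show "module K ?P" by (rule module_transfer[OF m(3)]) simp_all
    then show "abelian_group ?P" by (rule module.axioms)
  qed (simp_all add: assoc one closed tc del: tensor_algebra_prod_simps(5)
      add: linear_map_add[OF l, simplified] linear_map_add[OF r, simplified]
      linear_map_smult[OF l, simplified] linear_map_smult[OF r, simplified], simp add: tc)
qed

lemma tensor_algebra_prod_mult_closed:
  assumes "assoc_algebra K A" "assoc_algebra K B" "s \<in> carrier (tensor K A B)" "t \<in> carrier (tensor K A B)"
  shows "s \<otimes>\<^bsub>tensor_algebra_prod K A B\<^esub> t \<in> carrier (tensor K A B)"
  using mult_closed[OF tensor_algebra_prod_assoc_algebra[OF assms(1,2)]] assms(3,4) by simp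

section \<open>Sweedler calculus\<close>

text \<open>
  Most rules for Sweedler sums depend only on the linearity of the comultiplication. They are stated in
  this generality because the coalgebra laws of the enveloping algebra are themselves verified with them.
\<close>

definition linear_comul :: "('k, 'c) ring_scheme \<Rightarrow> ('k, 'a, 'e) hopf_scheme \<Rightarrow> bool"
  where "linear_comul K C \<longleftrightarrow> module K C \<and> linear_map K C (tensor K C C) (comul C)"

lemma linear_comulD: "linear_comul K C \<Longrightarrow> module K C" "linear_comul K C \<Longrightarrow> linear_map K C (tensor K C C) (comul C)"
  by (simp_all add: linear_comul_def)

lemma coalgebra_linear_comul [multilin]: "coalgebra K C \<Longrightarrow> linear_comul K C"
  by (simp add: linear_comul_def coalgebra_def coalgebra_axioms_def)

lemma comul_closed: "linear_comul K C \<Longrightarrow> x \<in> carrier C \<Longrightarrow> comul C x \<in> carrier (tensor K C C)"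
  by (rule linear_map_closed[OF linear_comulD(2)])

lemma sweedler_closed [multilin]:
  assumes "linear_comul K C" "module K P" "x \<in> carrier C" "bilinear_map K C C P f"
  shows "sweedler K C P f x \<in> carrier P"
  unfolding sweedler_def
  by (intro linear_map_closed[OF tensor_lift_linear[OF _ _ assms(2,4)]] linear_comulD(1) comul_closed assms)

lemma linear_sweedler [multilin]:
  assumes "linear_comul K C" "module K P" "bilinear_map K C C P f" "linear_map K M C g"
  shows "linear_map K M P (\<lambda>x. sweedler K C P f (g x))"
  unfolding sweedler_def
  by (rule linear_comp[OF linear_comp[OF tensor_lift_linear[OF _ _ assms(2,3)]
        linear_comulD(2)[OF assms(1)]] assms(4)]; intro linear_comulD(1) assms)

lemma linear_sweedler_fun [multilin]:
  assumes "linear_comul K C" "module K P" "module K Q" "x \<in> carrier C"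
    and "\<And>z. z \<in> carrier Q \<Longrightarrow> bilinear_map K C C P (\<lambda>u v. F z u v)"
    and "\<And>u v. u \<in> carrier C \<Longrightarrow> v \<in> carrier C \<Longrightarrow> linear_map K Q P (\<lambda>z. F z u v)"
  shows "linear_map K Q P (\<lambda>z. sweedler K C P (\<lambda>u v. F z u v) x)"
  unfolding sweedler_def
  by (rule linear_tensor_lift_fun[where F = F]; (intro linear_comulD(1) comul_closed assms; assumption?)?)

lemma linear_sweedler_commute:
  assumes "linear_comul K C" "module K P" "module K Q" "linear_map K P Q g"
    and "bilinear_map K C C P f" "x \<in> carrier C"
  shows "g (sweedler K C P f x) = sweedler K C Q (\<lambda>u v. g (f u v)) x"
  unfolding sweedler_def
  by (rule linear_tensor_lift[OF _ _ assms(2,3) _ assms(5,4)]; intro linear_comulD(1) comul_closed assms)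

lemma sweedler_cong:
  assumes "linear_comul K C" "module K P" "x \<in> carrier C"
    and "bilinear_map K C C P f" "bilinear_map K C C P g"
    and "\<And>u v. u \<in> carrier C \<Longrightarrow> v \<in> carrier C \<Longrightarrow> f u v = g u v"
  shows "sweedler K C P f x = sweedler K C P g x"
  unfolding sweedler_def
  by (rule tensor_lift_cong[OF _ _ assms(2) _ assms(4,5,6)]; (intro linear_comulD(1) comul_closed assms)?)

lemma sweedler_add:
  assumes "linear_comul K C" "module K P" "x \<in> carrier C"
    and "bilinear_map K C C P f" "bilinear_map K C C P g"
  shows "sweedler K C P (\<lambda>u v. f u v \<oplus>\<^bsub>P\<^esub> g u v) x = sweedler K C P f x \<oplus>\<^bsub>P\<^esub> sweedler K C P g x"
proof -
  note m = linear_comulD(1)[OF assms(1)]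
  note l = tensor_lift_linear[OF m m assms(2)] and t = tensor_lift_tens[OF m m assms(2)]
  note c = comul_closed[OF assms(1,3)]
  have b: "bilinear_map K C C P (\<lambda>u v. f u v \<oplus>\<^bsub>P\<^esub> g u v)"
    by (intro bilinear_mapI linear_add assms(2) bilinear_mapD[OF assms(4)] bilinear_mapD[OF assms(5)]; assumption)
  show ?thesis
    unfolding sweedler_def
    by (rule tensor_linear_eq[OF m m assms(2) l[OF b] linear_add[OF assms(2) l[OF assms(4)] l[OF assms(5)]] _ c])
      (simp add: t b assms)
qed

lemma comul_eq_sweedler:
  assumes "linear_comul K C" "x \<in> carrier C"
  shows "comul C x = sweedler K C (tensor K C C) (tens K C C) x"
proof -
  note m = linear_comulD(1)[OF assms(1)]
  show ?thesis unfolding sweedler_def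
    by (rule tensor_linear_eq[OF m m tensor_module[OF m m] linear_ident
          tensor_lift_linear[OF m m tensor_module[OF m m] tens_bilinear[OF m m]] _ comul_closed[OF assms]])
      (simp add: tensor_lift_tens[OF m m tensor_module[OF m m] tens_bilinear[OF m m]])
qed

text \<open>
  Independent Sweedler sums commute: as functions of the first coproduct both sides are linear, and for a
  pure tensor in its place the outer sum disappears.
\<close>

lemma sweedler_swap:
  assumes CD: "linear_comul K C" "linear_comul K D" and P: "module K P" and x: "x \<in> carrier C" and y: "y \<in> carrier D"
    and F: "\<And>v p q. v \<in> carrier C \<Longrightarrow> p \<in> carrier D \<Longrightarrow> q \<in> carrier D \<Longrightarrow> linear_map K C P (\<lambda>u. F u v p q)"
      "\<And>u p q. u \<in> carrier C \<Longrightarrow> p \<in> carrier D \<Longrightarrow> q \<in> carrier D \<Longrightarrow> linear_map K C P (\<lambda>v. F u v p q)"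
      "\<And>u v q. u \<in> carrier C \<Longrightarrow> v \<in> carrier C \<Longrightarrow> q \<in> carrier D \<Longrightarrow> linear_map K D P (\<lambda>p. F u v p q)"
      "\<And>u v p. u \<in> carrier C \<Longrightarrow> v \<in> carrier C \<Longrightarrow> p \<in> carrier D \<Longrightarrow> linear_map K D P (\<lambda>q. F u v p q)"
  shows "sweedler K C P (\<lambda>u v. sweedler K D P (\<lambda>p q. F u v p q) y) x =
    sweedler K D P (\<lambda>p q. sweedler K C P (\<lambda>u v. F u v p q) x) y"
proof -
  note m = linear_comulD(1)[OF CD(1)] linear_comulD(1)[OF CD(2)]
  note T = tensor_module[OF m(1) m(1)]
  have b: "bilinear_map K D D P (\<lambda>p q. F u v p q)" if "u \<in> carrier C" "v \<in> carrier C" for u v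
    by (intro bilinear_mapI F that)
  have b': "bilinear_map K C C P (\<lambda>u v. F u v p q)" if "p \<in> carrier D" "q \<in> carrier D" for p q
    by (intro bilinear_mapI F that)
  have o: "bilinear_map K C C P (\<lambda>u v. sweedler K D P (\<lambda>p q. F u v p q) y)"
    by (intro bilinear_mapI linear_sweedler_fun CD P m y b F)
  have bt: "bilinear_map K D D P (\<lambda>p q. tensor_lift K P (\<lambda>u v. F u v p q) t)" if "t \<in> carrier (tensor K C C)" for t
    by (intro bilinear_mapI linear_tensor_lift_fun[OF m(1) m(1) P] that F b' m)
  have "sweedler K C P (\<lambda>u v. sweedler K D P (\<lambda>p q. F u v p q) y) x =
      tensor_lift K P (\<lambda>u v. sweedler K D P (\<lambda>p q. F u v p q) y) (comul C x)"
    by (simp add: sweedler_def)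
  also have "\<dots> = sweedler K D P (\<lambda>p q. tensor_lift K P (\<lambda>u v. F u v p q) (comul C x)) y"
  proof (rule tensor_linear_eq[OF m(1) m(1) P _ _ _ comul_closed[OF CD(1) x]])
    show "linear_map K (tensor K C C) P (tensor_lift K P (\<lambda>u v. sweedler K D P (\<lambda>p q. F u v p q) y))"
      by (rule tensor_lift_linear[OF m(1) m(1) P o])
    show "linear_map K (tensor K C C) P (\<lambda>t. sweedler K D P (\<lambda>p q. tensor_lift K P (\<lambda>u v. F u v p q) t) y)"
      by (intro linear_sweedler_fun CD P T y bt tensor_lift_linear m b')
  next
    fix u v assume uv: "u \<in> carrier C" "v \<in> carrier C"
    show "tensor_lift K P (\<lambda>u v. sweedler K D P (\<lambda>p q. F u v p q) y) (tens K C C u v) =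
      sweedler K D P (\<lambda>p q. tensor_lift K P (\<lambda>u v. F u v p q) (tens K C C u v)) y"
      unfolding tensor_lift_tens[OF m(1) m(1) P o uv]
      by (rule sweedler_cong[OF CD(2) P y b[OF uv] bt]) (simp_all add: uv tens_closed m tensor_lift_tens[OF m(1) m(1) P b'])
  qed
  finally show ?thesis by (simp add: sweedler_def)
qed

lemma coalgebra_module: "coalgebra K C \<Longrightarrow> module K C"
  by (simp add: coalgebra_def)

lemma linear_counit [multilin]:
  "coalgebra K C \<Longrightarrow> linear_map K M C f \<Longrightarrow> linear_map K M (self_module K) (\<lambda>x. counit C (f x))"
  by (rule linear_comp[OF coalgebra.counit_linear])

lemma counit_closed [multilin]: "coalgebra K C \<Longrightarrow> x \<in> carrier C \<Longrightarrow> counit C x \<in> carrier K"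
  using linear_map_closed[OF coalgebra.counit_linear] by simp

text \<open>
  The coassociativity law of a coalgebra is the instance of the following lemma for the universal trilinear
  map. The general form results from applying to that instance the linear map induced by \<open>F\<close>.
\<close>

lemma sweedler_coassoc:
  assumes C: "coalgebra K C" and P: "module K P" and x: "x \<in> carrier C"
    and F: "\<And>v w. v \<in> carrier C \<Longrightarrow> w \<in> carrier C \<Longrightarrow> linear_map K C P (\<lambda>u. F u v w)"
      "\<And>u w. u \<in> carrier C \<Longrightarrow> w \<in> carrier C \<Longrightarrow> linear_map K C P (\<lambda>v. F u v w)"
      "\<And>u v. u \<in> carrier C \<Longrightarrow> v \<in> carrier C \<Longrightarrow> linear_map K C P (\<lambda>w. F u v w)"
  shows "sweedler K C P (\<lambda>y z. sweedler K C P (\<lambda>u v. F u v z) y) x =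
    sweedler K C P (\<lambda>y z. sweedler K C P (\<lambda>u v. F y u v) z) x"
proof -
  note m = coalgebra_module[OF C] and L = coalgebra_linear_comul[OF C]
  let ?T = "tensor K C C" let ?TT = "tensor K ?T C"
  note T = tensor_module[OF m m] and TT = tensor_module[OF tensor_module[OF m m] m]
  have b: "bilinear_map K C C P (\<lambda>u v. F u v w)" if "w \<in> carrier C" for w
    by (intro bilinear_mapI F that)
  have b2: "bilinear_map K ?T C P (\<lambda>s z. tensor_lift K P (\<lambda>u v. F u v z) s)"
    by (intro bilinear_mapI linear_tensor_lift_fun[OF m m P] tensor_lift_linear m P b F)
  let ?g = "tensor_lift K P (\<lambda>s z. tensor_lift K P (\<lambda>u v. F u v z) s)"
  have g: "linear_map K ?TT P ?g" by (rule tensor_lift_linear[OF T m P b2])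
  have gt: "?g (tens K ?T C (tens K C C u v) w) = F u v w"
    if "u \<in> carrier C" "v \<in> carrier C" "w \<in> carrier C" for u v w
    using that by (simp add: tensor_lift_tens[OF T m P b2] tensor_lift_tens[OF m m P b] tens_closed m)
  note r = C m P T TT F g multilin
  have "?g (sweedler K C ?TT (\<lambda>y z. sweedler K C ?TT (\<lambda>u v. tens K ?T C (tens K C C u v) z) y) x)
    = sweedler K C P (\<lambda>y z. ?g (sweedler K C ?TT (\<lambda>u v. tens K ?T C (tens K C C u v) z) y)) x"
    by (rule linear_sweedler_commute[OF L TT P g _ x]) (rule r | assumption)+
  also have "\<dots> = sweedler K C P (\<lambda>y z. sweedler K C P (\<lambda>u v. ?g (tens K ?T C (tens K C C u v) z)) y) x"
    by (rule sweedler_cong[OF L P x]; (rule linear_sweedler_commute[OF L TT P g] | rule r linear_comp[OF g] | assumption)+)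
  also have "\<dots> = sweedler K C P (\<lambda>y z. sweedler K C P (\<lambda>u v. F u v z) y) x"
    by (rule sweedler_cong[OF L P x]; ((rule sweedler_cong[OF L P])?; (rule gt r linear_comp[OF g] | assumption)+))
  finally have 1: "?g (sweedler K C ?TT (\<lambda>y z. sweedler K C ?TT (\<lambda>u v. tens K ?T C (tens K C C u v) z) y) x)
    = sweedler K C P (\<lambda>y z. sweedler K C P (\<lambda>u v. F u v z) y) x" .
  have "?g (sweedler K C ?TT (\<lambda>y z. sweedler K C ?TT (\<lambda>u v. tens K ?T C (tens K C C y u) v) z) x)
    = sweedler K C P (\<lambda>y z. ?g (sweedler K C ?TT (\<lambda>u v. tens K ?T C (tens K C C y u) v) z)) x"
    by (rule linear_sweedler_commute[OF L TT P g _ x]) (rule r | assumption)+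
  also have "\<dots> = sweedler K C P (\<lambda>y z. sweedler K C P (\<lambda>u v. ?g (tens K ?T C (tens K C C y u) v)) z) x"
    by (rule sweedler_cong[OF L P x]; (rule linear_sweedler_commute[OF L TT P g] | rule r linear_comp[OF g] | assumption)+)
  also have "\<dots> = sweedler K C P (\<lambda>y z. sweedler K C P (\<lambda>u v. F y u v) z) x"
    by (rule sweedler_cong[OF L P x]; ((rule sweedler_cong[OF L P])?; (rule gt r linear_comp[OF g] | assumption)+))
  finally show ?thesis using 1 coalgebra.coassoc[OF C x] by simp
qed

lemma sweedler_counit:
  assumes C: "coalgebra K C" and P: "module K P" and x: "x \<in> carrier C" and f: "linear_map K C P f"
  shows sweedler_counit_left: "sweedler K C P (\<lambda>y z. counit C y \<odot>\<^bsub>P\<^esub> f z) x = f x"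
    and sweedler_counit_right: "sweedler K C P (\<lambda>y z. counit C z \<odot>\<^bsub>P\<^esub> f y) x = f x"
proof -
  note m = coalgebra_module[OF C] and L = coalgebra_linear_comul[OF C]
  note r = C m P x multilin
  have "f (sweedler K C C (\<lambda>y z. counit C y \<odot>\<^bsub>C\<^esub> z) x) = sweedler K C P (\<lambda>y z. f (counit C y \<odot>\<^bsub>C\<^esub> z)) x"
    by (rule linear_sweedler_commute[OF L m P f _ x]) (rule r | assumption)+
  also have "\<dots> = sweedler K C P (\<lambda>y z. counit C y \<odot>\<^bsub>P\<^esub> f z) x"
    by (rule sweedler_cong[OF L P x];
      (rule linear_map_smult[OF f] r linear_comp[OF f] linear_map_closed[OF f] f | assumption)+)
  finally show "sweedler K C P (\<lambda>y z. counit C y \<odot>\<^bsub>P\<^esub> f z) x = f x"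
    by (simp add: coalgebra.counit_left[OF C x])
  have "f (sweedler K C C (\<lambda>y z. counit C z \<odot>\<^bsub>C\<^esub> y) x) = sweedler K C P (\<lambda>y z. f (counit C z \<odot>\<^bsub>C\<^esub> y)) x"
    by (rule linear_sweedler_commute[OF L m P f _ x]) (rule r | assumption)+
  also have "\<dots> = sweedler K C P (\<lambda>y z. counit C z \<odot>\<^bsub>P\<^esub> f y) x"
    by (rule sweedler_cong[OF L P x];
      (rule linear_map_smult[OF f] r linear_comp[OF f] linear_map_closed[OF f] f | assumption)+)
  finally show "sweedler K C P (\<lambda>y z. counit C z \<odot>\<^bsub>P\<^esub> f y) x = f x"
    by (simp add: coalgebra.counit_right[OF C x])
qed

lemma bialgebraD:
  "bialgebra K A \<Longrightarrow> coalgebra K A" "bialgebra K A \<Longrightarrow> assoc_algebra K A" "hopf_algebra K A \<Longrightarrow> bialgebra K A"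
  by (simp_all add: bialgebra_def hopf_algebra_def)

text \<open>
  This turns multiplicativity of a coproduct into the rule for Sweedler sums over a product.
\<close>

lemma tensor_lift_mult:
  assumes A: "assoc_algebra K A" and B: "assoc_algebra K B" and P: "module K P" and f: "bilinear_map K A B P f"
    and s: "s \<in> carrier (tensor K A B)" and t: "t \<in> carrier (tensor K A B)"
  shows "tensor_lift K P f (s \<otimes>\<^bsub>tensor_algebra_prod K A B\<^esub> t) =
    tensor_lift K P (\<lambda>a b. tensor_lift K P (\<lambda>a' b'. f (a \<otimes>\<^bsub>A\<^esub> a') (b \<otimes>\<^bsub>B\<^esub> b')) t) s"
proof -
  let ?T = "tensor K A B"
  note m = assoc_algebra_module[OF A] assoc_algebra_module[OF B]
  note T = tensor_module[OF m]
  note f1 = linear_comp[OF bilinear_mapD(1)[OF f]] and f2 = linear_comp[OF bilinear_mapD(2)[OF f]]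
  note lf = tensor_lift_linear[OF m P f]
  have i: "bilinear_map K A B P (\<lambda>a' b'. f (a \<otimes>\<^bsub>A\<^esub> a') (b \<otimes>\<^bsub>B\<^esub> b'))" if "a \<in> carrier A" "b \<in> carrier B" for a b
    by (rule f1 f2 A B m that P multilin | assumption)+
  have o: "bilinear_map K A B P (\<lambda>a b. tensor_lift K P (\<lambda>a' b'. f (a \<otimes>\<^bsub>A\<^esub> a') (b \<otimes>\<^bsub>B\<^esub> b')) t)"
    by (rule bilinear_mapI; rule linear_tensor_lift_fun[OF m P t];
        (rule A B m i f1 f2 multilin | assumption)+)
  note mult = tensor_algebra_mult_bilinear[OF A B]
  show ?thesis
  proof (rule tensor_linear_eq[OF m P _ _ _ s])
    show "linear_map K ?T P (\<lambda>s. tensor_lift K P f (s \<otimes>\<^bsub>tensor_algebra_prod K A B\<^esub> t))"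
      by (rule linear_comp[OF lf bilinear_mapD(2)[OF mult(1) t]])
    show "linear_map K ?T P (tensor_lift K P (\<lambda>a b. tensor_lift K P (\<lambda>a' b'. f (a \<otimes>\<^bsub>A\<^esub> a') (b \<otimes>\<^bsub>B\<^esub> b')) t))"
      by (rule tensor_lift_linear[OF m P o])
    fix a b assume ab: "a \<in> carrier A" "b \<in> carrier B"
    note tab = tens_closed[OF m ab]
    show "tensor_lift K P f (tens K A B a b \<otimes>\<^bsub>tensor_algebra_prod K A B\<^esub> t) =
      tensor_lift K P (\<lambda>a b. tensor_lift K P (\<lambda>a' b'. f (a \<otimes>\<^bsub>A\<^esub> a') (b \<otimes>\<^bsub>B\<^esub> b')) t) (tens K A B a b)"
      unfolding tensor_lift_tens[OF m P o ab]
    proof (rule tensor_linear_eq[OF m P _ _ _ t])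
      show "linear_map K ?T P (\<lambda>t. tensor_lift K P f (tens K A B a b \<otimes>\<^bsub>tensor_algebra_prod K A B\<^esub> t))"
        by (rule linear_comp[OF lf bilinear_mapD(1)[OF mult(1) tab]])
      show "linear_map K ?T P (tensor_lift K P (\<lambda>a' b'. f (a \<otimes>\<^bsub>A\<^esub> a') (b \<otimes>\<^bsub>B\<^esub> b')))"
        by (rule tensor_lift_linear[OF m P i[OF ab]])
      fix a' b' assume c: "a' \<in> carrier A" "b' \<in> carrier B"
      show "tensor_lift K P f (tens K A B a b \<otimes>\<^bsub>tensor_algebra_prod K A B\<^esub> tens K A B a' b') =
        tensor_lift K P (\<lambda>a' b'. f (a \<otimes>\<^bsub>A\<^esub> a') (b \<otimes>\<^bsub>B\<^esub> b')) (tens K A B a' b')"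
        using ab c by (simp add: mult(2) tensor_lift_tens[OF m P f] tensor_lift_tens[OF m P i] mult_closed[OF A] mult_closed[OF B])
    qed
  qed
qed

lemma sweedler_mult:
  assumes A: "bialgebra K A" and P: "module K P" and f: "bilinear_map K A A P f"
    and x: "x \<in> carrier A" and y: "y \<in> carrier A"
  shows "sweedler K A P f (x \<otimes>\<^bsub>A\<^esub> y) =
    sweedler K A P (\<lambda>u v. sweedler K A P (\<lambda>p q. f (u \<otimes>\<^bsub>A\<^esub> p) (v \<otimes>\<^bsub>A\<^esub> q)) y) x"
  unfolding sweedler_def bialgebra.comul_mult[OF A x y]
  by (rule tensor_lift_mult[OF bialgebraD(2)[OF A] bialgebraD(2)[OF A] P f]; intro comul_closed coalgebra_linear_comul bialgebraD(1) A x y)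

lemma sweedler_one:
  assumes A: "bialgebra K A" and P: "module K P" and f: "bilinear_map K A A P f"
  shows "sweedler K A P f \<one>\<^bsub>A\<^esub> = f \<one>\<^bsub>A\<^esub> \<one>\<^bsub>A\<^esub>"
  unfolding sweedler_def bialgebra.comul_one[OF A] tensor_algebra_prod_simps
  by (rule tensor_lift_tens[OF _ _ P f]; intro assoc_algebra_module[OF bialgebraD(2)[OF A]]
      one_closed[OF bialgebraD(2)[OF A]])

section \<open>Cocommutative coalgebras\<close>

definition cocommutative :: "('k, 'c) ring_scheme \<Rightarrow> ('k, 'a, 'e) hopf_scheme \<Rightarrow> bool"
  where "cocommutative K C \<longleftrightarrow>
    (\<forall>x\<in>carrier C. comul C x = sweedler K C (tensor K C C) (\<lambda>u v. tens K C C v u) x)"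

lemma sweedler_flip:
  assumes C: "coalgebra K C" and coc: "cocommutative K C" and P: "module K P"
    and f: "bilinear_map K C C P f" and x: "x \<in> carrier C"
  shows "sweedler K C P f x = sweedler K C P (\<lambda>u v. f v u) x"
proof -
  note m = coalgebra_module[OF C]
  note T = tensor_module[OF m m] and L = coalgebra_linear_comul[OF C]
  note g = tensor_lift_linear[OF m m P f] and gt = tensor_lift_tens[OF m m P f]
  note r = C m L T P bilinear_mapD[OF f] linear_comp[OF g] g multilin
  have "sweedler K C P f x = tensor_lift K P f (sweedler K C (tensor K C C) (\<lambda>u v. tens K C C v u) x)"
    unfolding sweedler_def[of K C P f] using coc x by (simp add: cocommutative_def)
  also have "\<dots> = sweedler K C P (\<lambda>u v. tensor_lift K P f (tens K C C v u)) x"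
    by (rule linear_sweedler_commute[OF L T P g _ x]) (rule r | assumption)+
  also have "\<dots> = sweedler K C P (\<lambda>u v. f v u) x"
    by (rule sweedler_cong[OF L P x]; (rule gt r | assumption)+)
  finally show ?thesis .
qed

text \<open>
  By coassociativity a fourfold coproduct may be bracketed so that its two middle factors are the halves
  of a single coproduct, and those are exchanged by cocommutativity.
\<close>

lemma sweedler_middle_swap:
  assumes C: "coalgebra K C" and coc: "cocommutative K C" and P: "module K P" and c: "c \<in> carrier C"
    and E: "\<And>q u v. q \<in> carrier C \<Longrightarrow> u \<in> carrier C \<Longrightarrow> v \<in> carrier C \<Longrightarrow> linear_map K C P (\<lambda>p. E p q u v)"
      "\<And>p u v. p \<in> carrier C \<Longrightarrow> u \<in> carrier C \<Longrightarrow> v \<in> carrier C \<Longrightarrow> linear_map K C P (\<lambda>q. E p q u v)"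
      "\<And>p q v. p \<in> carrier C \<Longrightarrow> q \<in> carrier C \<Longrightarrow> v \<in> carrier C \<Longrightarrow> linear_map K C P (\<lambda>u. E p q u v)"
      "\<And>p q u. p \<in> carrier C \<Longrightarrow> q \<in> carrier C \<Longrightarrow> u \<in> carrier C \<Longrightarrow> linear_map K C P (\<lambda>v. E p q u v)"
  shows "sweedler K C P (\<lambda>x y. sweedler K C P (\<lambda>p q. sweedler K C P (\<lambda>u v. E p q u v) y) x) c =
    sweedler K C P (\<lambda>x y. sweedler K C P (\<lambda>p u. sweedler K C P (\<lambda>q v. E p q u v) y) x) c"
proof -
  let ?s = "sweedler K C P"
  note m = coalgebra_module[OF C] and L = coalgebra_linear_comul[OF C]
  have normal: "?s (\<lambda>x y. ?s (\<lambda>p q. ?s (\<lambda>u v. E p q u v) y) x) c =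
      ?s (\<lambda>p r. ?s (\<lambda>x v. ?s (\<lambda>q u. E p q u v) x) r) c"
    if E: "\<And>q u v. q \<in> carrier C \<Longrightarrow> u \<in> carrier C \<Longrightarrow> v \<in> carrier C \<Longrightarrow> linear_map K C P (\<lambda>p. E p q u v)"
      "\<And>p u v. p \<in> carrier C \<Longrightarrow> u \<in> carrier C \<Longrightarrow> v \<in> carrier C \<Longrightarrow> linear_map K C P (\<lambda>q. E p q u v)"
      "\<And>p q v. p \<in> carrier C \<Longrightarrow> q \<in> carrier C \<Longrightarrow> v \<in> carrier C \<Longrightarrow> linear_map K C P (\<lambda>u. E p q u v)"
      "\<And>p q u. p \<in> carrier C \<Longrightarrow> q \<in> carrier C \<Longrightarrow> u \<in> carrier C \<Longrightarrow> linear_map K C P (\<lambda>v. E p q u v)"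
    for E
  proof -
    note r = m L P E multilin
    have "?s (\<lambda>x y. ?s (\<lambda>p q. ?s (\<lambda>u v. E p q u v) y) x) c = ?s (\<lambda>p r. ?s (\<lambda>q y. ?s (\<lambda>u v. E p q u v) y) r) c"
      by (rule sweedler_coassoc[OF C P c]) (rule r | assumption)+
    also have "\<dots> = ?s (\<lambda>p r. ?s (\<lambda>x v. ?s (\<lambda>q u. E p q u v) x) r) c"
      by (rule sweedler_cong[OF L P c]; (rule sweedler_coassoc[OF C P, symmetric] r | assumption)+)
    finally show ?thesis .
  qed
  note r = m L P E multilin
  have "?s (\<lambda>x y. ?s (\<lambda>p q. ?s (\<lambda>u v. E p q u v) y) x) c = ?s (\<lambda>p r. ?s (\<lambda>x v. ?s (\<lambda>q u. E p q u v) x) r) c"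
    by (rule normal[OF E])
  also have "\<dots> = ?s (\<lambda>p r. ?s (\<lambda>x v. ?s (\<lambda>q u. E p u q v) x) r) c"
  proof (rule sweedler_cong[OF L P c])
    fix p r assume pr: "p \<in> carrier C" "r \<in> carrier C"
    show "?s (\<lambda>x v. ?s (\<lambda>q u. E p q u v) x) r = ?s (\<lambda>x v. ?s (\<lambda>q u. E p u q v) x) r"
      by (rule sweedler_cong[OF L P pr(2)]; (rule sweedler_flip[OF C coc P] pr r | assumption)+)
  qed (rule r | assumption)+
  also have "\<dots> = ?s (\<lambda>x y. ?s (\<lambda>p u. ?s (\<lambda>q v. E p q u v) y) x) c"
    by (rule normal[symmetric]) (rule E; assumption)+
  finally show ?thesis .
qed

section \<open>The free algebra\<close>

lemma free_algebra_simps [simp]: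
  "carrier (free_algebra K X) = carrier (free_module K (lists X))"
  "zero (free_algebra K X) = zero (free_module K (lists X))"
  "add (free_algebra K X) = add (free_module K (lists X))"
  "smult (free_algebra K X) = smult (free_module K (lists X))"
  "one (free_algebra K X) = free_gen K []"
  by (simp_all add: free_algebra_def)

lemma free_algebra_mult:
  "(\<phi> \<otimes>\<^bsub>free_algebra K X\<^esub> \<psi>) w = (\<Oplus>\<^bsub>K\<^esub>i\<in>{..length w}. \<phi> (take i w) \<otimes>\<^bsub>K\<^esub> \<psi> (drop i w))"
  by (simp add: free_algebra_def)

lemma linear_map_free_algebra [simp]:
  "linear_map K (free_algebra K X) P f = linear_map K (free_module K (lists X)) P f"
  "linear_map K Q (free_algebra K X) g = linear_map K Q (free_module K (lists X)) g"
  by (simp_all add: linear_map_def)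

lemma free_algebra_mult_closed:
  assumes "cring K" and \<phi>: "\<phi> \<in> carrier (free_module K (lists X))" and \<psi>: "\<psi> \<in> carrier (free_module K (lists X))"
  shows "\<phi> \<otimes>\<^bsub>free_algebra K X\<^esub> \<psi> \<in> carrier (free_module K (lists X))"
proof -
  interpret cring K by fact
  note c = \<phi>[unfolded free_module_carrier] \<psi>[unfolded free_module_carrier]
  \<comment> \<open>The product is supported on concatenations of words from the two supports.\<close>
  let ?S = "(\<lambda>(u, v). u @ v) ` ({w. \<phi> w \<noteq> \<zero>\<^bsub>K\<^esub>} \<times> {w. \<psi> w \<noteq> \<zero>\<^bsub>K\<^esub>})"
  have supp: "w \<in> ?S" if w: "(\<phi> \<otimes>\<^bsub>free_algebra K X\<^esub> \<psi>) w \<noteq> \<zero>\<^bsub>K\<^esub>" for w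
  proof (rule ccontr)
    assume n: "w \<notin> ?S"
    have "\<phi> (take i w) \<otimes>\<^bsub>K\<^esub> \<psi> (drop i w) = \<zero>\<^bsub>K\<^esub>" for i
    proof (cases "\<phi> (take i w) = \<zero>\<^bsub>K\<^esub> \<or> \<psi> (drop i w) = \<zero>\<^bsub>K\<^esub>")
      case False
      then have "(\<lambda>(u, v). u @ v) (take i w, drop i w) \<in> ?S" by (intro imageI) simp
      then show ?thesis using n by simp
    qed (use c in auto)
    then have "(\<phi> \<otimes>\<^bsub>free_algebra K X\<^esub> \<psi>) w = \<zero>\<^bsub>K\<^esub>" by (simp add: free_algebra_mult)
    then show False using w by simp
  qed
  have "finite ?S" using c by (intro finite_imageI finite_cartesian_product) simp_all
  moreover have "?S \<subseteq> lists X"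
  proof
    fix w assume "w \<in> ?S"
    then obtain u v where uv: "\<phi> u \<noteq> \<zero>\<^bsub>K\<^esub>" "\<psi> v \<noteq> \<zero>\<^bsub>K\<^esub>" "w = u @ v" by auto
    have "u \<in> lists X" using c(1) uv(1) by blast
    moreover have "v \<in> lists X" using c(2) uv(2) by blast
    ultimately show "w \<in> lists X" by (simp only: uv append_in_lists_conv simp_thms)
  qed
  moreover have "(\<phi> \<otimes>\<^bsub>free_algebra K X\<^esub> \<psi>) w \<in> carrier K" for w
    unfolding free_algebra_mult using c by (intro finsum_closed) auto
  moreover have "{w. (\<phi> \<otimes>\<^bsub>free_algebra K X\<^esub> \<psi>) w \<noteq> \<zero>\<^bsub>K\<^esub>} \<subseteq> ?S" using supp by blast
  ultimately show ?thesis unfolding free_module_carrier by (intro conjI allI; iprover intro: finite_subset subset_trans)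
qed

lemma free_algebra_mult_bilinear:
  assumes "cring K"
  shows "bilinear_map K (free_module K (lists X)) (free_module K (lists X)) (free_module K (lists X))
    (mult (free_algebra K X))"
proof -
  interpret cring K by fact
  let ?F = "free_module K (lists X)"
  have el: "\<phi> x \<in> carrier K" if "\<phi> \<in> carrier ?F" for \<phi> x using that by (auto simp: free_module_carrier)
  show ?thesis
  proof (intro bilinear_mapI linear_mapI free_algebra_mult_closed is_cring; assumption?)
    fix \<phi> \<psi> \<chi> assume c: "\<phi> \<in> carrier ?F" "\<psi> \<in> carrier ?F" "\<chi> \<in> carrier ?F"
    show "\<phi> \<otimes>\<^bsub>free_algebra K X\<^esub> (\<psi> \<oplus>\<^bsub>?F\<^esub> \<chi>) =
      \<phi> \<otimes>\<^bsub>free_algebra K X\<^esub> \<psi> \<oplus>\<^bsub>?F\<^esub> \<phi> \<otimes>\<^bsub>free_algebra K X\<^esub> \<chi>"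
      by (rule ext) (simp add: free_algebra_mult c el r_distr finsum_addf)
    show "(\<phi> \<oplus>\<^bsub>?F\<^esub> \<psi>) \<otimes>\<^bsub>free_algebra K X\<^esub> \<chi> =
      \<phi> \<otimes>\<^bsub>free_algebra K X\<^esub> \<chi> \<oplus>\<^bsub>?F\<^esub> \<psi> \<otimes>\<^bsub>free_algebra K X\<^esub> \<chi>"
      by (rule ext) (simp add: free_algebra_mult c el l_distr finsum_addf)
  next
    fix \<phi> \<psi> k assume c: "\<phi> \<in> carrier ?F" "k \<in> carrier K" "\<psi> \<in> carrier ?F"
    show "\<phi> \<otimes>\<^bsub>free_algebra K X\<^esub> (k \<odot>\<^bsub>?F\<^esub> \<psi>) = k \<odot>\<^bsub>?F\<^esub> (\<phi> \<otimes>\<^bsub>free_algebra K X\<^esub> \<psi>)"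
      by (rule ext) (simp add: free_algebra_mult c el finsum_rdistr m_lcomm)
    show "(k \<odot>\<^bsub>?F\<^esub> \<phi>) \<otimes>\<^bsub>free_algebra K X\<^esub> \<psi> = k \<odot>\<^bsub>?F\<^esub> (\<phi> \<otimes>\<^bsub>free_algebra K X\<^esub> \<psi>)"
      by (rule ext) (simp add: free_algebra_mult c el finsum_rdistr m_assoc)
  qed
qed

text \<open>
  Of all ways to split a word, only the one after the first \<open>length u\<close> letters can contribute.
\<close>

lemma free_algebra_mult_gen:
  assumes "cring K"
  shows "free_gen K u \<otimes>\<^bsub>free_algebra K X\<^esub> free_gen K v = free_gen K (u @ v)"
proof
  interpret cring K by fact
  fix w
  show "(free_gen K u \<otimes>\<^bsub>free_algebra K X\<^esub> free_gen K v) w = free_gen K (u @ v) w"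
  proof (cases "w = u @ v")
    case True
    have *: "take i w = u \<and> drop i w = v \<longleftrightarrow> length u = i" if "i \<le> length w" for i
      using that True by (metis append_eq_conv_conj length_take min.absorb2)
    have "(free_gen K u \<otimes>\<^bsub>free_algebra K X\<^esub> free_gen K v) w =
        (\<Oplus>\<^bsub>K\<^esub>i\<in>{..length w}. if length u = i then \<one>\<^bsub>K\<^esub> else \<zero>\<^bsub>K\<^esub>)"
      unfolding free_algebra_mult
    proof (intro finsum_cong')
      fix i assume "i \<in> {..length w}"
      then show "free_gen K u (take i w) \<otimes>\<^bsub>K\<^esub> free_gen K v (drop i w) = (if length u = i then \<one>\<^bsub>K\<^esub> else \<zero>\<^bsub>K\<^esub>)"
        using * [of i] by (auto simp: free_gen_def)
    qed auto
    also have "\<dots> = \<one>\<^bsub>K\<^esub>" using True by (subst add.finprod_singleton) auto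
    finally show ?thesis using True by (simp add: free_gen_def)
  next
    case False
    then have "free_gen K u (take i w) \<otimes>\<^bsub>K\<^esub> free_gen K v (drop i w) = \<zero>\<^bsub>K\<^esub>" for i
      using append_take_drop_id[of i w] by (auto simp: free_gen_def)
    then show ?thesis using False by (simp add: free_algebra_mult free_gen_def)
  qed
qed

lemma free_algebra_assoc_algebra:
  assumes K: "cring K"
  shows "assoc_algebra K (free_algebra K X)"
proof -
  let ?F = "free_module K (lists X)" and ?A = "free_algebra K X"
  note m = free_module_module[OF K, of "lists X"]
  note bil = free_algebra_mult_bilinear[OF K, of X]
  note l = bilinear_mapD(2)[OF bil] and r = bilinear_mapD(1)[OF bil]
  note gen = free_gen_closed[OF K, of _ "lists X"] and mt = free_algebra_mult_gen[OF K]
  note closed = free_algebra_mult_closed[OF K]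
  have assoc: "(s \<otimes>\<^bsub>?A\<^esub> t) \<otimes>\<^bsub>?A\<^esub> u = s \<otimes>\<^bsub>?A\<^esub> (t \<otimes>\<^bsub>?A\<^esub> u)"
    if "s \<in> carrier ?F" "t \<in> carrier ?F" "u \<in> carrier ?F" for s t u
  proof (rule free_module_linear_eq[OF m _ _ _ that(1)])
    fix a assume a: "a \<in> lists X"
    show "(free_gen K a \<otimes>\<^bsub>?A\<^esub> t) \<otimes>\<^bsub>?A\<^esub> u = free_gen K a \<otimes>\<^bsub>?A\<^esub> (t \<otimes>\<^bsub>?A\<^esub> u)"
    proof (rule free_module_linear_eq[OF m _ _ _ that(2)])
      fix b assume b: "b \<in> lists X"
      show "(free_gen K a \<otimes>\<^bsub>?A\<^esub> free_gen K b) \<otimes>\<^bsub>?A\<^esub> u = free_gen K a \<otimes>\<^bsub>?A\<^esub> (free_gen K b \<otimes>\<^bsub>?A\<^esub> u)"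
        by (rule free_module_linear_eq[OF m _ _ _ that(3)])
          (use a b in \<open>simp_all add: mt\<close>, (intro linear_comp[OF l] linear_comp[OF r] gen closed linear_ident that; simp)+)
    qed (intro linear_comp[OF l] linear_comp[OF r] gen a closed linear_ident that)+
  qed (intro linear_comp[OF l] linear_comp[OF r] closed linear_ident that)+
  have one: "\<one>\<^bsub>?A\<^esub> \<otimes>\<^bsub>?A\<^esub> t = t" "t \<otimes>\<^bsub>?A\<^esub> \<one>\<^bsub>?A\<^esub> = t" if t: "t \<in> carrier ?F" for t
    by (rule free_module_linear_eq[OF m _ _ _ t];
        (simp add: mt)?; (intro linear_comp[OF l] linear_comp[OF r] gen linear_ident; simp)?)+
  show ?thesis
  proof (intro assoc_algebra.intro assoc_algebra_axioms.intro ringI monoidI)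
    show "module K ?A" by (rule module_transfer[OF m]) simp_all
    then show "abelian_group ?A" by (rule module.axioms)
  qed (simp_all only: free_algebra_simps(1-4) assoc one closed linear_map_add[OF l] linear_map_add[OF r]
        linear_map_smult[OF l] linear_map_smult[OF r], simp add: gen)
qed

section \<open>Quotients of algebras\<close>

lemma assoc_algebra_transfer:
  assumes "assoc_algebra K A"
    and "carrier B = carrier A" "zero B = zero A" "add B = add A" "smult B = smult A" "mult B = mult A" "one B = one A"
  shows "assoc_algebra K B"
proof -
  interpret A: assoc_algebra K A by fact
  have m: "module K B" by (rule module_transfer[OF A.module_axioms]) (simp_all add: assms)
  show ?thesis
    by (intro assoc_algebra.intro assoc_algebra_axioms.intro ringI monoidI m module.axioms(2)[OF m])
      (simp_all add: assms A.m_assoc A.l_distr A.r_distr A.smult_mult_left A.smult_mult_right)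
qed

context
  fixes K :: "('k, 'c) ring_scheme" and A :: "('k, 'a, 'm) module_scheme" and I
  assumes A: "assoc_algebra K A" and I: "ideal I A"
begin

interpretation A: assoc_algebra K A by (rule A)
interpretation I: ideal I A by (rule I)

lemma ideal_submodule_quotient: "submodule_quotient K A I"
proof (intro submodule_quotient.intro A.module_axioms submodule_quotient_axioms.intro A.submoduleI)
  fix c x assume c: "c \<in> carrier K" "x \<in> I"
  then have "(c \<odot>\<^bsub>A\<^esub> \<one>\<^bsub>A\<^esub>) \<otimes>\<^bsub>A\<^esub> x \<in> I" by (intro I.I_l_closed) auto
  then show "c \<odot>\<^bsub>A\<^esub> x \<in> I" using c by (simp add: A.smult_mult_left I.Icarr)
qed (auto simp: I.Icarr)

interpretation Q: submodule_quotient K A I by (rule ideal_submodule_quotient)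

lemma coset_mult: "x \<in> carrier A \<Longrightarrow> y \<in> carrier A \<Longrightarrow>
    (I +>\<^bsub>A\<^esub> x) \<otimes>\<^bsub>quot_module A I\<^esub> (I +>\<^bsub>A\<^esub> y) = I +>\<^bsub>A\<^esub> (x \<otimes>\<^bsub>A\<^esub> y)"
  using I.rcoset_mult_add[of x y] by (simp add: quot_module_def FactRing_def)

lemma coset_one: "\<one>\<^bsub>quot_module A I\<^esub> = I +>\<^bsub>A\<^esub> \<one>\<^bsub>A\<^esub>"
  by (simp add: quot_module_def FactRing_def)

lemma quot_module_assoc_algebra: "assoc_algebra K (quot_module A I)"
proof (intro assoc_algebra.intro assoc_algebra_axioms.intro ringI monoidI
    Q.quot_module_module module.axioms(2)[OF Q.quot_module_module])
qed (auto elim!: Q.quot_cases simp: coset_mult coset_one Q.coset_add Q.coset_smult Q.coset_closed A.m_assoc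
    A.l_distr A.r_distr A.smult_mult_left A.smult_mult_right)

end

section \<open>The universal enveloping algebra as an algebra\<close>

lemma uea_simps [simp]:
  "carrier (uea K G) = carrier (uea_algebra K G)" "mult (uea K G) = mult (uea_algebra K G)"
  "one (uea K G) = one (uea_algebra K G)" "zero (uea K G) = zero (uea_algebra K G)"
  "add (uea K G) = add (uea_algebra K G)" "smult (uea K G) = smult (uea_algebra K G)"
  by (simp_all add: uea_def Let_def)

context
  fixes K :: "('k, 'c) ring_scheme" and G :: "('k, 'g, 'e) lie_scheme"
  assumes G: "lie_algebra K G"
begin

interpretation G: lie_algebra K G by (rule G)

abbreviation (input) "\<F> \<equiv> free_algebra K (carrier G)"

interpretation F: assoc_algebra K \<F> by (rule free_algebra_assoc_algebra[OF G.R.is_cring])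

lemma free_gen_word_closed: "w \<in> lists (carrier G) \<Longrightarrow> free_gen K w \<in> carrier \<F>"
  using free_gen_closed[OF G.R.is_cring] by simp

lemma uea_rels_closed: "uea_rels K G \<subseteq> carrier \<F>"
proof -
  note br = linear_map_closed[OF bilinear_mapD(1)[OF G.bracket_bilinear]]
  show ?thesis unfolding uea_rels_def Let_def
    by (intro Un_least subsetI; elim CollectE exE conjE; hypsubst;
        intro F.M.minus_closed F.M.a_closed F.m_closed F.smult_closed free_gen_word_closed; simp add: br)
qed

lemma uea_ideal_ideal: "ideal (uea_ideal K G) \<F>"
  unfolding uea_ideal_def by (rule F.genideal_ideal[OF uea_rels_closed])

interpretation Q: submodule_quotient K \<F> "uea_ideal K G"
  by (rule ideal_submodule_quotient[OF F.assoc_algebra_axioms uea_ideal_ideal])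

lemma uea_algebra_assoc_algebra: "assoc_algebra K (uea_algebra K G)"
  unfolding uea_algebra_def by (rule quot_module_assoc_algebra[OF F.assoc_algebra_axioms uea_ideal_ideal])

lemma uea_assoc_algebra: "assoc_algebra K (uea K G)"
  by (rule assoc_algebra_transfer[OF uea_algebra_assoc_algebra]) simp_all

lemma uea_incl_closed: "x \<in> carrier G \<Longrightarrow> uea_incl K G x \<in> carrier (uea K G)"
  unfolding uea_incl_def uea_simps uea_algebra_def by (intro Q.coset_closed free_gen_word_closed) simp

text \<open>
  Monomials in elements of the Lie algebra span the enveloping algebra, and they arise from the unit by
  multiplying with one element of the Lie algebra at a time. For equalities of linear maps the
  steps for sums and multiples are automatic, see \<open>uea_linear_eq\<close>.
\<close>

lemma uea_induct [consumes 1, case_names one mult add smult]: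
  assumes u: "u \<in> carrier (uea K G)"
    and one: "Q \<one>\<^bsub>uea K G\<^esub>"
    and mult: "\<And>x u. x \<in> carrier G \<Longrightarrow> u \<in> carrier (uea K G) \<Longrightarrow> Q u \<Longrightarrow> Q (uea_incl K G x \<otimes>\<^bsub>uea K G\<^esub> u)"
    and add: "\<And>u v. u \<in> carrier (uea K G) \<Longrightarrow> v \<in> carrier (uea K G) \<Longrightarrow> Q u \<Longrightarrow> Q v \<Longrightarrow> Q (u \<oplus>\<^bsub>uea K G\<^esub> v)"
    and smult: "\<And>c u. c \<in> carrier K \<Longrightarrow> u \<in> carrier (uea K G) \<Longrightarrow> Q u \<Longrightarrow> Q (c \<odot>\<^bsub>uea K G\<^esub> u)"
  shows "Q u"
proof -
  interpret U: assoc_algebra K "uea K G" by (rule uea_assoc_algebra)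
  let ?c = "\<lambda>\<phi>. uea_ideal K G +>\<^bsub>\<F>\<^esub> \<phi>"
  have cc: "?c \<phi> \<in> carrier (uea K G)" if "\<phi> \<in> carrier \<F>" for \<phi>
    using Q.coset_closed[OF that] by (simp add: uea_algebra_def)
  have word: "Q (?c (free_gen K w))" if "w \<in> lists (carrier G)" for w
    using that
  proof (induction w)
    case Nil
    then show ?case using one by (simp add: uea_algebra_def coset_one[OF F.assoc_algebra_axioms uea_ideal_ideal])
  next
    case (Cons x w)
    then have "Q (uea_incl K G x \<otimes>\<^bsub>uea K G\<^esub> ?c (free_gen K w))"
      by (intro mult cc free_gen_word_closed) auto
    moreover have "uea_incl K G x \<otimes>\<^bsub>uea K G\<^esub> ?c (free_gen K w) = ?c (free_gen K [x] \<otimes>\<^bsub>\<F>\<^esub> free_gen K w)"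
      unfolding uea_incl_def uea_simps uea_algebra_def
      using Cons by (intro coset_mult[OF F.assoc_algebra_axioms uea_ideal_ideal] free_gen_word_closed) auto
    ultimately show ?case by (simp add: free_algebra_mult_gen[OF G.R.is_cring])
  qed
  obtain \<phi> where \<phi>: "\<phi> \<in> carrier \<F>" "u = ?c \<phi>"
    using u unfolding uea_simps uea_algebra_def by (rule Q.quot_cases)
  have "\<phi> \<in> carrier (free_module K (lists (carrier G)))" using \<phi> by simp
  with G.R.is_cring have "Q (?c \<phi>)"
  proof (induction rule: free_module_induct)
    case zero
    have "Q (\<zero>\<^bsub>K\<^esub> \<odot>\<^bsub>uea K G\<^esub> \<one>\<^bsub>uea K G\<^esub>)" by (intro smult one U.one_closed) auto
    moreover have "?c (\<lambda>x. \<zero>\<^bsub>K\<^esub>) = \<zero>\<^bsub>uea K G\<^esub>"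
      using linear_map_zero[OF F.module_axioms Q.quot_module_module Q.coset_linear] by (simp add: uea_algebra_def)
    ultimately show ?case by (simp only: U.smult_l_null U.one_closed)
  next
    case (step c w \<psi>)
    have 1: "free_gen K w \<in> carrier \<F>" "\<psi> \<in> carrier \<F>" using step free_gen_word_closed by auto
    have "Q (c \<odot>\<^bsub>uea K G\<^esub> ?c (free_gen K w) \<oplus>\<^bsub>uea K G\<^esub> ?c \<psi>)"
      by (intro add smult cc step word 1 U.smult_closed)
    moreover have "c \<odot>\<^bsub>uea K G\<^esub> ?c (free_gen K w) \<oplus>\<^bsub>uea K G\<^esub> ?c \<psi> = ?c (c \<odot>\<^bsub>\<F>\<^esub> free_gen K w \<oplus>\<^bsub>\<F>\<^esub> \<psi>)"
      unfolding uea_simps uea_algebra_def Q.coset_smult[OF step(1) 1(1)]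
      by (intro Q.coset_add F.smult_closed 1 step)
    ultimately show ?case by (simp only: free_algebra_simps)
  qed
  then show ?thesis by (simp add: \<phi>)
qed

lemma uea_incl_linear: "linear_map K G (uea K G) (uea_incl K G)"
  and uea_incl_bracket: "x \<in> carrier G \<Longrightarrow> y \<in> carrier G \<Longrightarrow> uea_incl K G (bracket G x y) =
    uea_incl K G x \<otimes>\<^bsub>uea K G\<^esub> uea_incl K G y \<ominus>\<^bsub>uea K G\<^esub> uea_incl K G y \<otimes>\<^bsub>uea K G\<^esub> uea_incl K G x"
proof -
  interpret U: assoc_algebra K "uea K G" by (rule uea_assoc_algebra)
  let ?c = "\<lambda>\<phi>. uea_ideal K G +>\<^bsub>\<F>\<^esub> \<phi>" and ?e = "\<lambda>x. free_gen K [x]"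
  have e: "?e x \<in> carrier \<F>" if "x \<in> carrier G" for x using that by (intro free_gen_word_closed) simp
  have eq: "?c r = ?c s" if "r \<ominus>\<^bsub>\<F>\<^esub> s \<in> uea_rels K G" "r \<in> carrier \<F>" "s \<in> carrier \<F>" for r s
    using Q.coset_eq_iff[OF that(2,3)] F.genideal_self[OF uea_rels_closed] that(1) unfolding uea_ideal_def by blast
  note R = uea_rels_def[of K G, unfolded Let_def]
  note br = linear_map_closed[OF bilinear_mapD(1)[OF G.bracket_bilinear]]
  note um = linear_map_minus[OF F.module_axioms Q.quot_module_module Q.coset_linear]
  show "linear_map K G (uea K G) (uea_incl K G)"
  proof (intro linear_mapI uea_incl_closed)
    fix x y assume c: "x \<in> carrier G" "y \<in> carrier G"
    have "?c (?e (x \<oplus>\<^bsub>G\<^esub> y)) = ?c (?e x \<oplus>\<^bsub>\<F>\<^esub> ?e y)"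
      by (rule eq) (use c in \<open>unfold R, blast\<close>, (intro F.M.a_closed e G.M.a_closed c)+)
    then show "uea_incl K G (x \<oplus>\<^bsub>G\<^esub> y) = uea_incl K G x \<oplus>\<^bsub>uea K G\<^esub> uea_incl K G y"
      unfolding uea_incl_def uea_simps uea_algebra_def using c by (simp only: Q.coset_add e)
  next
    fix k x assume c: "k \<in> carrier K" "x \<in> carrier G"
    have "?c (?e (k \<odot>\<^bsub>G\<^esub> x)) = ?c (k \<odot>\<^bsub>\<F>\<^esub> ?e x)"
      by (rule eq) (use c in \<open>unfold R, blast\<close>, (intro F.smult_closed e G.smult_closed c)+)
    then show "uea_incl K G (k \<odot>\<^bsub>G\<^esub> x) = k \<odot>\<^bsub>uea K G\<^esub> uea_incl K G x"
      unfolding uea_incl_def uea_simps uea_algebra_def using c by (simp only: Q.coset_smult e)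
  qed
  assume c: "x \<in> carrier G" "y \<in> carrier G"
  have "?c (?e x \<otimes>\<^bsub>\<F>\<^esub> ?e y \<ominus>\<^bsub>\<F>\<^esub> ?e y \<otimes>\<^bsub>\<F>\<^esub> ?e x) = ?c (?e (bracket G x y))"
    by (rule eq) (use c in \<open>unfold R, blast\<close>, (intro F.M.minus_closed F.m_closed e br c)+)
  then have "?c (?e (bracket G x y)) = ?c (?e x \<otimes>\<^bsub>\<F>\<^esub> ?e y) \<ominus>\<^bsub>quot_module \<F> (uea_ideal K G)\<^esub> ?c (?e y \<otimes>\<^bsub>\<F>\<^esub> ?e x)"
    using c by (simp only: um F.m_closed e)
  also have "\<dots> = ?c (?e x \<otimes>\<^bsub>\<F>\<^esub> ?e y) \<ominus>\<^bsub>uea K G\<^esub> ?c (?e y \<otimes>\<^bsub>\<F>\<^esub> ?e x)"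
    by (simp add: a_minus_def a_inv_def m_inv_def uea_algebra_def)
  finally show "uea_incl K G (bracket G x y) =
    uea_incl K G x \<otimes>\<^bsub>uea K G\<^esub> uea_incl K G y \<ominus>\<^bsub>uea K G\<^esub> uea_incl K G y \<otimes>\<^bsub>uea K G\<^esub> uea_incl K G x"
    using c by (simp only: uea_incl_def uea_simps(1-3,5-) uea_algebra_def
        coset_mult[OF F.assoc_algebra_axioms uea_ideal_ideal] e)
qed

section \<open>Representations of the enveloping algebra\<close>

context
  fixes M :: "('k, 'a, 'm) module_scheme" and act :: "'g \<Rightarrow> 'a \<Rightarrow> 'a"
  assumes M: "module K M" and act: "lie_module_action K G M act"
begin

interpretation M: module K M by (rule M)

text \<open>The action of the free algebra, of which the action of the enveloping algebra is the quotient.\<close>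

abbreviation (input) "word_act \<phi> a \<equiv> free_lift K M (\<lambda>w. foldr act w a) \<phi>"

lemma act_linear: "x \<in> carrier G \<Longrightarrow> linear_map K M M (act x)"
  and act_linear_left: "a \<in> carrier M \<Longrightarrow> linear_map K G M (\<lambda>x. act x a)"
  using act by (auto simp: lie_module_action_def bilinear_map_def)

lemma foldr_act_linear: "w \<in> lists (carrier G) \<Longrightarrow> linear_map K M M (foldr act w)"
proof (induction w)
  case Nil
  then show ?case by (simp add: linear_map_def)
next
  case (Cons x w)
  then have "linear_map K M M (\<lambda>a. act x (foldr act w a))" by (intro linear_comp[OF act_linear]) auto
  then show ?case by (simp add: comp_def)
qed

lemma foldr_act_closed: "a \<in> carrier M \<Longrightarrow> (\<lambda>w. foldr act w a) \<in> lists (carrier G) \<rightarrow> carrier M"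
  using linear_map_closed[OF foldr_act_linear] by blast

lemma word_act_linear_left: "a \<in> carrier M \<Longrightarrow> linear_map K \<F> M (\<lambda>\<phi>. word_act \<phi> a)"
  using free_lift_linear[OF M foldr_act_closed] by simp

lemma word_act_gen: "a \<in> carrier M \<Longrightarrow> w \<in> lists (carrier G) \<Longrightarrow> word_act (free_gen K w) a = foldr act w a"
  using free_lift_gen[OF M foldr_act_closed] by simp

lemma word_act_closed: "a \<in> carrier M \<Longrightarrow> \<phi> \<in> carrier \<F> \<Longrightarrow> word_act \<phi> a \<in> carrier M"
  by (rule linear_map_closed[OF word_act_linear_left])

lemma word_act_linear: "\<phi> \<in> carrier \<F> \<Longrightarrow> linear_map K M M (word_act \<phi>)"
proof (intro linear_mapI word_act_closed)
  assume \<phi>: "\<phi> \<in> carrier \<F>"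
  note \<phi>' = \<phi>[unfolded free_algebra_simps]
  note l = word_act_linear_left[unfolded linear_map_free_algebra]
  note ad = linear_map_add[OF foldr_act_linear] and sm = linear_map_smult[OF foldr_act_linear]
  fix a assume a: "a \<in> carrier M"
  show "word_act \<phi> (a \<oplus>\<^bsub>M\<^esub> b) = word_act \<phi> a \<oplus>\<^bsub>M\<^esub> word_act \<phi> b" if b: "b \<in> carrier M" for b
    by (rule free_module_linear_eq[OF M _ _ _ \<phi>'])
      ((intro linear_add l M.a_closed a b M; fail) | simp add: word_act_gen a b ad)+
  show "word_act \<phi> (c \<odot>\<^bsub>M\<^esub> a) = c \<odot>\<^bsub>M\<^esub> word_act \<phi> a" if c: "c \<in> carrier K" for c
    by (rule free_module_linear_eq[OF M _ _ _ \<phi>'])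
      ((intro linear_smult_right l M.smult_closed a c M; fail) | simp add: word_act_gen a c sm)+
qed

lemma word_act_mult:
  assumes a: "a \<in> carrier M" and \<phi>: "\<phi> \<in> carrier \<F>" and \<psi>: "\<psi> \<in> carrier \<F>"
  shows "word_act (\<phi> \<otimes>\<^bsub>\<F>\<^esub> \<psi>) a = word_act \<phi> (word_act \<psi> a)"
proof -
  note l = word_act_linear_left[unfolded linear_map_free_algebra]
  note bil = free_algebra_mult_bilinear[OF G.R.is_cring, of "carrier G"]
  note gc = free_gen_closed[OF G.R.is_cring, of _ "lists (carrier G)"]
  note c = \<phi>[unfolded free_algebra_simps] \<psi>[unfolded free_algebra_simps]
  show ?thesis
  proof (rule free_module_linear_eq[OF M _ _ _ c(1)])
    show "linear_map K (free_module K (lists (carrier G))) M (\<lambda>\<phi>. word_act (\<phi> \<otimes>\<^bsub>\<F>\<^esub> \<psi>) a)"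
      by (rule linear_comp[OF l[OF a] bilinear_mapD(2)[OF bil c(2)]])
    show "linear_map K (free_module K (lists (carrier G))) M (\<lambda>\<phi>. word_act \<phi> (word_act \<psi> a))"
      by (rule l[OF word_act_closed[OF a \<psi>]])
    fix u assume u: "u \<in> lists (carrier G)"
    show "word_act (free_gen K u \<otimes>\<^bsub>\<F>\<^esub> \<psi>) a = word_act (free_gen K u) (word_act \<psi> a)"
    proof (rule free_module_linear_eq[OF M _ _ _ c(2)])
      show "linear_map K (free_module K (lists (carrier G))) M (\<lambda>\<psi>. word_act (free_gen K u \<otimes>\<^bsub>\<F>\<^esub> \<psi>) a)"
        by (rule linear_comp[OF l[OF a] bilinear_mapD(1)[OF bil gc[OF u]]])
      show "linear_map K (free_module K (lists (carrier G))) M (\<lambda>\<psi>. word_act (free_gen K u) (word_act \<psi> a))"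
        by (rule linear_comp[OF word_act_linear[OF free_gen_word_closed[OF u]] l[OF a]])
      fix v assume v: "v \<in> lists (carrier G)"
      show "word_act (free_gen K u \<otimes>\<^bsub>\<F>\<^esub> free_gen K v) a = word_act (free_gen K u) (word_act (free_gen K v) a)"
        using u v a linear_map_closed[OF foldr_act_linear[OF v] a]
        by (simp add: free_algebra_mult_gen[OF G.R.is_cring] word_act_gen)
    qed
  qed
qed

text \<open>
  The elements of the free algebra that annihilate the module form a two-sided ideal, since words act by
  composition. It contains the relations because a Lie module structure is linear in the Lie
  algebra and takes brackets to commutators.
\<close>

lemma word_act_ideal:
  assumes \<phi>: "\<phi> \<in> uea_ideal K G" and a: "a \<in> carrier M"
  shows "word_act \<phi> a = \<zero>\<^bsub>M\<^esub>"
proof -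
  let ?I = "{\<phi> \<in> carrier \<F>. \<forall>a\<in>carrier M. word_act \<phi> a = \<zero>\<^bsub>M\<^esub>}"
  note l = word_act_linear_left
  note lz = linear_map_zero[OF F.module_axioms M l] and ln = linear_map_neg[OF F.module_axioms M l]
    and lm = linear_map_minus[OF F.module_axioms M l]
  have I: "ideal ?I \<F>"
  proof (intro idealI F.ring_axioms)
    have "submodule ?I K \<F>"
      by (rule F.submoduleI)
        (auto simp: lz ln linear_map_add[OF l] linear_map_smult[OF l]
          simp del: free_algebra_simps intro!: F.M.a_closed F.smult_closed F.M.a_inv_closed F.M.zero_closed)
    then show "subgroup ?I (add_monoid \<F>)" by (simp add: submodule_def)
  next
    fix \<phi> \<psi> assume "\<phi> \<in> ?I" "\<psi> \<in> carrier \<F>"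
    then show "\<psi> \<otimes>\<^bsub>\<F>\<^esub> \<phi> \<in> ?I" "\<phi> \<otimes>\<^bsub>\<F>\<^esub> \<psi> \<in> ?I"
      using linear_map_zero[OF M M word_act_linear]
      by (auto simp: word_act_mult word_act_closed simp del: free_algebra_simps intro!: F.m_closed)
  qed
  have e: "free_gen K [x] \<in> carrier \<F>" if "x \<in> carrier G" for x using that by (intro free_gen_word_closed) simp
  note br = linear_map_closed[OF bilinear_mapD(1)[OF G.bracket_bilinear]]
  note cl = linear_map_closed[OF act_linear]
  have gen: "word_act (free_gen K [x]) a = act x a" if "x \<in> carrier G" "a \<in> carrier M" for x a
    using word_act_gen[of a "[x]"] that by simp
  have rel: "r \<ominus>\<^bsub>\<F>\<^esub> s \<in> ?I" if "r \<in> carrier \<F>" "s \<in> carrier \<F>"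
    "\<And>a. a \<in> carrier M \<Longrightarrow> word_act r a = word_act s a" for r s
    using that by (auto simp: lm word_act_closed M.r_neg a_minus_def[of M] simp del: free_algebra_simps
        intro!: F.M.minus_closed)
  have "act (bracket G x y) a = act x (act y a) \<ominus>\<^bsub>M\<^esub> act y (act x a)"
    if "x \<in> carrier G" "y \<in> carrier G" "a \<in> carrier M" for x y a
    using act that by (simp add: lie_module_action_def)
  then have "uea_rels K G \<subseteq> ?I"
    unfolding uea_rels_def Let_def
    by (intro Un_least subsetI; elim CollectE exE conjE; hypsubst; intro rel F.M.minus_closed F.M.a_closed
        F.m_closed F.smult_closed e G.M.a_closed G.smult_closed br; (assumption |
         simp add: gen cl br e word_act_mult lm linear_map_add[OF l] linear_map_smult[OF l]
          linear_map_add[OF act_linear_left] linear_map_smult[OF act_linear_left] F.m_closed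
          del: free_algebra_simps))
  then have "uea_ideal K G \<subseteq> ?I" unfolding uea_ideal_def by (rule F.genideal_minimal[OF I])
  then show ?thesis using \<phi> a by blast
qed

lemma uea_action_coset:
  assumes a: "a \<in> carrier M" and \<phi>: "\<phi> \<in> carrier \<F>"
  shows "uea_action K M act (uea_ideal K G +>\<^bsub>\<F>\<^esub> \<phi>) a = word_act \<phi> a"
  unfolding uea_action_def
  by (rule quot_lift_coset[OF Q.submodule_quotient_axioms M word_act_linear_left[OF a] word_act_ideal[OF _ a] \<phi>])

lemma uea_action_linear_left: "a \<in> carrier M \<Longrightarrow> linear_map K (uea K G) M (\<lambda>u. uea_action K M act u a)"
  using quot_lift_linear[OF Q.submodule_quotient_axioms M word_act_linear_left word_act_ideal]
  by (simp add: uea_action_def uea_algebra_def linear_map_def)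

lemma uea_action_closed: "u \<in> carrier (uea K G) \<Longrightarrow> a \<in> carrier M \<Longrightarrow> uea_action K M act u a \<in> carrier M"
  by (rule linear_map_closed[OF uea_action_linear_left])

lemma uea_action_one: "a \<in> carrier M \<Longrightarrow> uea_action K M act \<one>\<^bsub>uea K G\<^esub> a = a"
  using uea_action_coset[of a "\<one>\<^bsub>\<F>\<^esub>"] word_act_gen[of a "[]"]
  by (simp add: uea_algebra_def coset_one[OF F.assoc_algebra_axioms uea_ideal_ideal] free_gen_closed[OF G.R.is_cring])

lemma uea_action_incl: "x \<in> carrier G \<Longrightarrow> a \<in> carrier M \<Longrightarrow> uea_action K M act (uea_incl K G x) a = act x a"
  unfolding uea_incl_def using word_act_gen[of a "[x]"] by (subst uea_action_coset) (auto intro: free_gen_closed[OF G.R.is_cring])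

lemma uea_action_module: "left_module_action K (uea K G) M (uea_action K M act)"
  unfolding left_module_action_def
proof (intro conjI ballI)
  show "bilinear_map K (uea K G) M M (uea_action K M act)"
  proof (intro bilinear_mapI uea_action_linear_left)
    fix u assume "u \<in> carrier (uea K G)"
    then obtain \<phi> where \<phi>: "\<phi> \<in> carrier \<F>" "u = uea_ideal K G +>\<^bsub>\<F>\<^esub> \<phi>"
      unfolding uea_simps uea_algebra_def by (rule Q.quot_cases)
    show "linear_map K M M (\<lambda>a. uea_action K M act u a)"
      by (rule linear_map_cong[OF _ word_act_linear[OF \<phi>(1)] M]) (simp only: \<phi> uea_action_coset)
  qed
  fix u v a assume u: "u \<in> carrier (uea K G)" and v: "v \<in> carrier (uea K G)" and a: "a \<in> carrier M"
  obtain \<phi> where \<phi>: "\<phi> \<in> carrier \<F>" "u = uea_ideal K G +>\<^bsub>\<F>\<^esub> \<phi>"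
    using u unfolding uea_simps uea_algebra_def by (rule Q.quot_cases)
  obtain \<psi> where \<psi>: "\<psi> \<in> carrier \<F>" "v = uea_ideal K G +>\<^bsub>\<F>\<^esub> \<psi>"
    using v unfolding uea_simps uea_algebra_def by (rule Q.quot_cases)
  have "u \<otimes>\<^bsub>uea K G\<^esub> v = uea_ideal K G +>\<^bsub>\<F>\<^esub> (\<phi> \<otimes>\<^bsub>\<F>\<^esub> \<psi>)"
    unfolding uea_simps uea_algebra_def \<phi> \<psi> by (rule coset_mult[OF F.assoc_algebra_axioms uea_ideal_ideal \<phi>(1) \<psi>(1)])
  then show "uea_action K M act (u \<otimes>\<^bsub>uea K G\<^esub> v) a = uea_action K M act u (uea_action K M act v a)"
    by (simp only: \<phi> \<psi> uea_action_coset a word_act_mult word_act_closed F.m_closed)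
qed (rule uea_action_one)

lemma uea_action_mult: "\<lbrakk>u \<in> carrier (uea K G); v \<in> carrier (uea K G); a \<in> carrier M\<rbrakk> \<Longrightarrow>
    uea_action K M act (u \<otimes>\<^bsub>uea K G\<^esub> v) a = uea_action K M act u (uea_action K M act v a)"
  using uea_action_module by (simp add: left_module_action_def)

lemma uea_action_incl_mult: "\<lbrakk>x \<in> carrier G; v \<in> carrier (uea K G); a \<in> carrier M\<rbrakk> \<Longrightarrow>
    uea_action K M act (uea_incl K G x \<otimes>\<^bsub>uea K G\<^esub> v) a = act x (uea_action K M act v a)"
  using uea_action_mult uea_action_incl uea_incl_closed uea_action_closed by metis

end

lemma uea_linear_eq:
  assumes M: "module K M" and f: "linear_map K (uea K G) M f" and g: "linear_map K (uea K G) M g"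
    and one: "f \<one>\<^bsub>uea K G\<^esub> = g \<one>\<^bsub>uea K G\<^esub>"
    and step: "\<And>x u. x \<in> carrier G \<Longrightarrow> u \<in> carrier (uea K G) \<Longrightarrow> f u = g u \<Longrightarrow>
      f (uea_incl K G x \<otimes>\<^bsub>uea K G\<^esub> u) = g (uea_incl K G x \<otimes>\<^bsub>uea K G\<^esub> u)"
    and u: "u \<in> carrier (uea K G)"
  shows "f u = g u"
  using u
proof (induction rule: uea_induct)
  case (mult x u)
  then show ?case by (rule step)
qed (simp_all only: one linear_map_add[OF f] linear_map_add[OF g] linear_map_smult[OF f] linear_map_smult[OF g])

text \<open>
  A homomorphism of Lie algebras \<open>f\<close> into an associative algebra makes the latter a Lie module by left
  multiplication, and the homomorphism induced by \<open>f\<close> is the resulting action on the unit.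
\<close>

context
  fixes A :: "('k, 'a, 'm) module_scheme" and f :: "'g \<Rightarrow> 'a"
  assumes A: "assoc_algebra K A" and f: "linear_map K G A f"
    and br: "\<And>x y. x \<in> carrier G \<Longrightarrow> y \<in> carrier G \<Longrightarrow>
      f (bracket G x y) = f x \<otimes>\<^bsub>A\<^esub> f y \<ominus>\<^bsub>A\<^esub> f y \<otimes>\<^bsub>A\<^esub> f x"
begin

interpretation A: assoc_algebra K A by (rule A)

lemma left_mult_lie_action: "lie_module_action K G A (\<lambda>x a. f x \<otimes>\<^bsub>A\<^esub> a)"
proof -
  note c = linear_map_closed[OF f]
  have "bilinear_map K G A A (\<lambda>x a. f x \<otimes>\<^bsub>A\<^esub> a)"
    by (rule A f c multilin | assumption)+
  then show ?thesis
    by (auto simp: lie_module_action_def br c A.m_assoc A.l_distr A.l_minus a_minus_def)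
qed

lemma uea_lift_eq_action: "uea_lift K A f u = uea_action K A (\<lambda>x a. f x \<otimes>\<^bsub>A\<^esub> a) u \<one>\<^bsub>A\<^esub>"
  by (simp add: uea_lift_def uea_action_def)

lemma uea_lift_linear: "linear_map K (uea K G) A (uea_lift K A f)"
  unfolding uea_lift_eq_action by (rule uea_action_linear_left[OF A.module_axioms left_mult_lie_action A.one_closed])

lemma uea_lift_closed: "u \<in> carrier (uea K G) \<Longrightarrow> uea_lift K A f u \<in> carrier A"
  by (rule linear_map_closed[OF uea_lift_linear])

lemma uea_lift_one: "uea_lift K A f \<one>\<^bsub>uea K G\<^esub> = \<one>\<^bsub>A\<^esub>"
  unfolding uea_lift_eq_action by (rule uea_action_one[OF A.module_axioms left_mult_lie_action A.one_closed])

lemma uea_lift_incl_mult: "x \<in> carrier G \<Longrightarrow> u \<in> carrier (uea K G) \<Longrightarrow>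
    uea_lift K A f (uea_incl K G x \<otimes>\<^bsub>uea K G\<^esub> u) = f x \<otimes>\<^bsub>A\<^esub> uea_lift K A f u"
  unfolding uea_lift_eq_action
  by (rule uea_action_incl_mult[OF A.module_axioms left_mult_lie_action _ _ A.one_closed])

lemma uea_lift_mult:
  assumes u: "u \<in> carrier (uea K G)" and v: "v \<in> carrier (uea K G)"
  shows "uea_lift K A f (u \<otimes>\<^bsub>uea K G\<^esub> v) = uea_lift K A f u \<otimes>\<^bsub>A\<^esub> uea_lift K A f v"
proof -
  interpret U: assoc_algebra K "uea K G" by (rule uea_assoc_algebra)
  show ?thesis
  proof (rule uea_linear_eq[OF A.module_axioms _ _ _ _ u])
    show "linear_map K (uea K G) A (\<lambda>u. uea_lift K A f (u \<otimes>\<^bsub>uea K G\<^esub> v))"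
      by (intro linear_comp[OF uea_lift_linear] linear_mult_left uea_assoc_algebra linear_ident v)
    show "linear_map K (uea K G) A (\<lambda>u. uea_lift K A f u \<otimes>\<^bsub>A\<^esub> uea_lift K A f v)"
      by (intro linear_mult_left A uea_lift_linear uea_lift_closed v)
    show "uea_lift K A f (\<one>\<^bsub>uea K G\<^esub> \<otimes>\<^bsub>uea K G\<^esub> v) = uea_lift K A f \<one>\<^bsub>uea K G\<^esub> \<otimes>\<^bsub>A\<^esub> uea_lift K A f v"
      by (simp only: U.l_one A.l_one uea_lift_one uea_lift_closed v)
    fix x u assume c: "x \<in> carrier G" "u \<in> carrier (uea K G)"
      and IH: "uea_lift K A f (u \<otimes>\<^bsub>uea K G\<^esub> v) = uea_lift K A f u \<otimes>\<^bsub>A\<^esub> uea_lift K A f v"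
    show "uea_lift K A f ((uea_incl K G x \<otimes>\<^bsub>uea K G\<^esub> u) \<otimes>\<^bsub>uea K G\<^esub> v) =
      uea_lift K A f (uea_incl K G x \<otimes>\<^bsub>uea K G\<^esub> u) \<otimes>\<^bsub>A\<^esub> uea_lift K A f v"
      by (simp only: U.m_assoc uea_incl_closed c v uea_lift_incl_mult U.m_closed IH A.m_assoc
          linear_map_closed[OF f] uea_lift_closed)
  qed
qed

end

end

section \<open>The Hopf algebra structure of the enveloping algebra\<close>

lemma (in abelian_group) minus_cancel_middle:
  assumes c: "p \<in> carrier G" "p' \<in> carrier G" "q \<in> carrier G" "r \<in> carrier G" "s \<in> carrier G" "s' \<in> carrier G"
  shows "(p \<ominus> p') \<oplus> (s \<ominus> s') = (p \<oplus> q) \<oplus> (r \<oplus> s) \<ominus> ((p' \<oplus> r) \<oplus> (q \<oplus> s'))"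
proof -
  have "(p \<oplus> q) \<oplus> (r \<oplus> s) \<ominus> ((p' \<oplus> r) \<oplus> (q \<oplus> s')) =
      (p \<oplus> s) \<oplus> ((q \<oplus> r) \<oplus> (\<ominus> (q \<oplus> r) \<oplus> \<ominus> (p' \<oplus> s')))"
    using c by (simp add: a_minus_def minus_add a_ac)
  also have "\<dots> = (p \<oplus> s) \<oplus> \<ominus> (p' \<oplus> s')" using c by (simp only: r_neg2 a_closed a_inv_closed)
  also have "\<dots> = (p \<ominus> p') \<oplus> (s \<ominus> s')" using c by (simp add: a_minus_def minus_add a_ac)
  finally show ?thesis by simp
qed

lemma tensor_transfer:
  assumes "carrier M = carrier M'" "add M = add M'" "smult M = smult M'"
    and "carrier N = carrier N'" "add N = add N'" "smult N = smult N'"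
  shows "tensor K M N = tensor K M' N'" "tens K M N = tens K M' N'"
proof -
  have n: "tensor_null K M N = tensor_null K M' N'"
    by (simp only: tensor_null_def tensor_rels_def assms)
  show "tensor K M N = tensor K M' N'" by (simp only: tensor_def n assms)
  show "tens K M N = tens K M' N'" by (intro ext) (simp only: tens_def n assms)
qed

lemma tensor_uea:
  "tensor K (uea_algebra K G) (uea_algebra K G) = tensor K (uea K G) (uea K G)"
  "tens K (uea_algebra K G) (uea_algebra K G) = tens K (uea K G) (uea K G)"
  "tensor_algebra_prod K (uea_algebra K G) (uea_algebra K G) = tensor_algebra_prod K (uea K G) (uea K G)"
proof -
  show t: "tensor K (uea_algebra K G) (uea_algebra K G) = tensor K (uea K G) (uea K G)"
      "tens K (uea_algebra K G) (uea_algebra K G) = tens K (uea K G) (uea K G)"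
    by (rule tensor_transfer; simp only: uea_simps)+
  show "tensor_algebra_prod K (uea_algebra K G) (uea_algebra K G) = tensor_algebra_prod K (uea K G) (uea K G)"
    by (simp only: tensor_algebra_prod_def t uea_simps)
qed

text \<open>The coproduct prescribed for an element of the Lie algebra.\<close>

definition uea_prim :: "('k, 'c) ring_scheme \<Rightarrow> ('k, 'g, 'e) lie_scheme \<Rightarrow> 'g \<Rightarrow> _"
  where "uea_prim K G x = tens K (uea K G) (uea K G) (uea_incl K G x) \<one>\<^bsub>uea K G\<^esub>
    \<oplus>\<^bsub>tensor K (uea K G) (uea K G)\<^esub> tens K (uea K G) (uea K G) \<one>\<^bsub>uea K G\<^esub> (uea_incl K G x)"

lemma uea_comul: "comul (uea K G) = uea_lift K (tensor_algebra_prod K (uea K G) (uea K G)) (uea_prim K G)"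
proof -
  let ?A = "uea_algebra K G"
  have "comul (uea K G) = uea_lift K (tensor_algebra_prod K ?A ?A) (\<lambda>x. tens K ?A ?A (uea_incl K G x) \<one>\<^bsub>?A\<^esub>
      \<oplus>\<^bsub>tensor K ?A ?A\<^esub> tens K ?A ?A \<one>\<^bsub>?A\<^esub> (uea_incl K G x))"
    by (simp add: uea_def Let_def)
  also have "\<dots> = uea_lift K (tensor_algebra_prod K (uea K G) (uea K G)) (\<lambda>x. uea_prim K G x)"
    by (simp only: tensor_uea uea_prim_def uea_simps)
  finally show ?thesis .
qed

lemma uea_counit: "counit (uea K G) = uea_lift K (self_module K) (\<lambda>x. \<zero>\<^bsub>K\<^esub>)"
  by (simp add: uea_def Let_def)

context
  fixes K :: "('k, 'c) ring_scheme" and G :: "('k, 'g, 'e) lie_scheme"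
  assumes G: "lie_algebra K G"
begin

interpretation G: lie_algebra K G by (rule G)

abbreviation (input) "\<U> \<equiv> uea K G"
abbreviation (input) "\<iota> \<equiv> uea_incl K G"
abbreviation (input) "\<T> \<equiv> tensor K \<U> \<U>"
abbreviation (input) uea_times (infixl "\<bullet>" 70) where "u \<bullet> v \<equiv> u \<otimes>\<^bsub>uea K G\<^esub> v"

interpretation U: assoc_algebra K \<U> by (rule uea_assoc_algebra[OF G])

lemmas U_induct = uea_induct[OF G, consumes 1, case_names one mult add smult]
lemmas U_alg = uea_assoc_algebra[OF G]
lemmas U_mod = assoc_algebra_module[OF U_alg]
lemmas T_mod = tensor_module[OF U_mod U_mod]
lemmas T_alg = tensor_algebra_prod_assoc_algebra[OF U_alg U_alg]
lemmas U_incl = uea_incl_closed[OF G]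
lemmas U_rules = U_alg U_mod T_mod G.R.is_cring U_incl

interpretation T: assoc_algebra K "tensor_algebra_prod K \<U> \<U>" by (rule T_alg)

lemma uea_prim_linear: "linear_map K G (tensor_algebra_prod K \<U> \<U>) (uea_prim K G)"
  unfolding uea_prim_def linear_map_tensor_algebra_prod
  by (rule U_rules uea_incl_linear[OF G] multilin | assumption)+

text \<open>
  In the commutator of \<open>x \<otimes> 1 + 1 \<otimes> x\<close> and \<open>y \<otimes> 1 + 1 \<otimes> y\<close> the mixed terms cancel, so the coproduct extends from
  the Lie algebra to its enveloping algebra.
\<close>

lemma uea_prim_bracket:
  assumes x: "x \<in> carrier G" and y: "y \<in> carrier G"
  shows "uea_prim K G (bracket G x y) = uea_prim K G x \<otimes>\<^bsub>tensor_algebra_prod K \<U> \<U>\<^esub> uea_prim K G y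
    \<ominus>\<^bsub>tensor_algebra_prod K \<U> \<U>\<^esub> uea_prim K G y \<otimes>\<^bsub>tensor_algebra_prod K \<U> \<U>\<^esub> uea_prim K G x"
proof -
  let ?P = "tensor_algebra_prod K \<U> \<U>"
  let ?t = "tens K \<U> \<U>"
  note c = U_incl[OF x] U_incl[OF y]
  have tc: "?t u v \<in> carrier ?P" if "u \<in> carrier \<U>" "v \<in> carrier \<U>" for u v
    using tens_closed[OF U_mod U_mod that] by simp
  have mt: "?t u v \<otimes>\<^bsub>?P\<^esub> ?t u' v' = ?t (u \<bullet> u') (v \<bullet> v')"
    if "u \<in> carrier \<U>" "v \<in> carrier \<U>" "u' \<in> carrier \<U>" "v' \<in> carrier \<U>" for u v u' v'
    using tensor_algebra_mult_bilinear(2)[OF U_alg U_alg] that by blast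
  have mi: "?t (u \<ominus>\<^bsub>\<U>\<^esub> v) \<one>\<^bsub>\<U>\<^esub> = ?t u \<one>\<^bsub>\<U>\<^esub> \<ominus>\<^bsub>?P\<^esub> ?t v \<one>\<^bsub>\<U>\<^esub>" "?t \<one>\<^bsub>\<U>\<^esub> (u \<ominus>\<^bsub>\<U>\<^esub> v) = ?t \<one>\<^bsub>\<U>\<^esub> u \<ominus>\<^bsub>?P\<^esub> ?t \<one>\<^bsub>\<U>\<^esub> v"
    if "u \<in> carrier \<U>" "v \<in> carrier \<U>" for u v
  proof -
    have l: "linear_map K \<U> ?P (\<lambda>u. ?t u \<one>\<^bsub>\<U>\<^esub>)" "linear_map K \<U> ?P (\<lambda>u. ?t \<one>\<^bsub>\<U>\<^esub> u)"
      unfolding linear_map_tensor_algebra_prod by (rule U_rules multilin | assumption)+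
    show "?t (u \<ominus>\<^bsub>\<U>\<^esub> v) \<one>\<^bsub>\<U>\<^esub> = ?t u \<one>\<^bsub>\<U>\<^esub> \<ominus>\<^bsub>?P\<^esub> ?t v \<one>\<^bsub>\<U>\<^esub>" "?t \<one>\<^bsub>\<U>\<^esub> (u \<ominus>\<^bsub>\<U>\<^esub> v) = ?t \<one>\<^bsub>\<U>\<^esub> u \<ominus>\<^bsub>?P\<^esub> ?t \<one>\<^bsub>\<U>\<^esub> v"
      by (rule linear_map_minus[OF U_mod T.module_axioms l(1) that] linear_map_minus[OF U_mod T.module_axioms l(2) that])+
  qed
  have prim: "uea_prim K G z = ?t (\<iota> z) \<one>\<^bsub>\<U>\<^esub> \<oplus>\<^bsub>?P\<^esub> ?t \<one>\<^bsub>\<U>\<^esub> (\<iota> z)" for z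
    by (simp only: uea_prim_def tensor_algebra_prod_simps)
  show ?thesis
    unfolding prim uea_incl_bracket[OF G x y] mi[OF U.m_closed[OF c] U.m_closed[OF c(2,1)]]
    by (simp only: T.l_distr T.r_distr T.M.a_closed tc mt c U.one_closed U.l_one U.r_one U.m_closed)
      (rule T.minus_cancel_middle; intro tc c U.one_closed U.m_closed)
qed

lemma uea_linear_comul: "linear_comul K \<U>"
  using uea_lift_linear[OF G T_alg uea_prim_linear uea_prim_bracket] U_mod
  by (simp add: linear_comul_def uea_comul)

lemma uea_counit_linear: "linear_map K \<U> (self_module K) (counit \<U>)"
  and uea_counit_mult: "u \<in> carrier \<U> \<Longrightarrow> v \<in> carrier \<U> \<Longrightarrow> counit \<U> (u \<bullet> v) = counit \<U> u \<otimes>\<^bsub>K\<^esub> counit \<U> v"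
  and uea_counit_one: "counit \<U> \<one>\<^bsub>\<U>\<^esub> = \<one>\<^bsub>K\<^esub>"
  and uea_counit_incl_mult: "x \<in> carrier G \<Longrightarrow> u \<in> carrier \<U> \<Longrightarrow> counit \<U> (\<iota> x \<bullet> u) = \<zero>\<^bsub>K\<^esub>"
proof -
  have S: "assoc_algebra K (self_module K)" by (rule self_module_assoc_algebra[OF G.R.is_cring])
  have l: "linear_map K G (self_module K) (\<lambda>x. \<zero>\<^bsub>K\<^esub>)" by (rule linear_mapI) auto
  have b: "(\<zero>\<^bsub>K\<^esub>) = \<zero>\<^bsub>K\<^esub> \<otimes>\<^bsub>self_module K\<^esub> \<zero>\<^bsub>K\<^esub> \<ominus>\<^bsub>self_module K\<^esub> \<zero>\<^bsub>K\<^esub> \<otimes>\<^bsub>self_module K\<^esub> \<zero>\<^bsub>K\<^esub>"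
    using abelian_group.r_neg[OF module.axioms(2)[OF assoc_algebra_module[OF S]], of "\<zero>\<^bsub>K\<^esub>"]
    by (simp add: a_minus_def)
  note lift = uea_lift_linear[OF G S l b] uea_lift_mult[OF G S l b] uea_lift_one[OF G S l b] uea_lift_incl_mult[OF G S l b]
  show lin: "linear_map K \<U> (self_module K) (counit \<U>)" unfolding uea_counit by (rule lift)
  show "counit \<U> (u \<bullet> v) = counit \<U> u \<otimes>\<^bsub>K\<^esub> counit \<U> v" if "u \<in> carrier \<U>" "v \<in> carrier \<U>"
    using lift(2)[OF that] by (simp add: uea_counit)
  show "counit \<U> \<one>\<^bsub>\<U>\<^esub> = \<one>\<^bsub>K\<^esub>" using lift(3) by (simp add: uea_counit)
  show "counit \<U> (\<iota> x \<bullet> u) = \<zero>\<^bsub>K\<^esub>" if "x \<in> carrier G" "u \<in> carrier \<U>"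
    using lift(4)[OF that] linear_map_closed[OF lin that(2)] by (simp add: uea_counit)
qed

lemma uea_comul_mult: "u \<in> carrier \<U> \<Longrightarrow> v \<in> carrier \<U> \<Longrightarrow>
    comul \<U> (u \<bullet> v) = comul \<U> u \<otimes>\<^bsub>tensor_algebra_prod K \<U> \<U>\<^esub> comul \<U> v"
  unfolding uea_comul by (rule uea_lift_mult[OF G T_alg uea_prim_linear uea_prim_bracket])

lemma uea_comul_one: "comul \<U> \<one>\<^bsub>\<U>\<^esub> = \<one>\<^bsub>tensor_algebra_prod K \<U> \<U>\<^esub>"
  unfolding uea_comul by (rule uea_lift_one[OF G T_alg uea_prim_linear uea_prim_bracket])

lemma uea_comul_incl_mult: "x \<in> carrier G \<Longrightarrow> u \<in> carrier \<U> \<Longrightarrow>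
    comul \<U> (\<iota> x \<bullet> u) = uea_prim K G x \<otimes>\<^bsub>tensor_algebra_prod K \<U> \<U>\<^esub> comul \<U> u"
  unfolding uea_comul by (rule uea_lift_incl_mult[OF G T_alg uea_prim_linear uea_prim_bracket])

lemma uea_sweedler_one:
  assumes P: "module K P" and f: "bilinear_map K \<U> \<U> P f"
  shows "sweedler K \<U> P f \<one>\<^bsub>\<U>\<^esub> = f \<one>\<^bsub>\<U>\<^esub> \<one>\<^bsub>\<U>\<^esub>"
  unfolding sweedler_def uea_comul_one tensor_algebra_prod_simps
  by (rule tensor_lift_tens[OF U_mod U_mod P f U.one_closed U.one_closed])

text \<open>
  Since elements of the Lie algebra are primitive, a Sweedler sum over \<open>x u\<close> obeys the product rule.
  Induction over monomials then reduces identities between Sweedler sums to identities for a single \<open>x\<close>.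
\<close>

lemma uea_sweedler_incl_mult:
  assumes P: "module K P" and f: "bilinear_map K \<U> \<U> P f" and x: "x \<in> carrier G" and u: "u \<in> carrier \<U>"
  shows "sweedler K \<U> P f (\<iota> x \<bullet> u) =
    sweedler K \<U> P (\<lambda>p q. f (\<iota> x \<bullet> p) q \<oplus>\<^bsub>P\<^esub> f p (\<iota> x \<bullet> q)) u"
proof -
  note L = uea_linear_comul
  note ix = U_incl[OF x]
  note cu = comul_closed[OF L u]
  note f1 = linear_comp[OF bilinear_mapD(1)[OF f]] and f2 = linear_comp[OF bilinear_mapD(2)[OF f]]
  note lf = tensor_lift_linear[OF U_mod U_mod P]
  have b: "bilinear_map K \<U> \<U> P (\<lambda>p q. f (a \<bullet> p) (b \<bullet> q))" if "a \<in> carrier \<U>" "b \<in> carrier \<U>" for a b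
    by (rule that U_rules P f1 f2 multilin | assumption)+
  have bo: "bilinear_map K \<U> \<U> P (\<lambda>a b. tensor_lift K P (\<lambda>p q. f (a \<bullet> p) (b \<bullet> q)) (comul \<U> u))"
    by (rule bilinear_mapI; rule linear_tensor_lift_fun[OF U_mod U_mod P cu];
        (rule U_rules b f1 f2 multilin | assumption)+)
  have b1: "bilinear_map K \<U> \<U> P (\<lambda>p q. f (\<iota> x \<bullet> p) q)" "bilinear_map K \<U> \<U> P (\<lambda>p q. f p (\<iota> x \<bullet> q))"
    by (rule ix U_rules P f1 f2 multilin | assumption)+
  let ?s = "\<lambda>a b. tensor_lift K P (\<lambda>p q. f (a \<bullet> p) (b \<bullet> q)) (comul \<U> u)"
  have pc: "uea_prim K G x \<in> carrier \<T>" using linear_map_closed[OF uea_prim_linear x] by simp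
  have "sweedler K \<U> P f (\<iota> x \<bullet> u) = tensor_lift K P ?s (uea_prim K G x)"
    unfolding sweedler_def uea_comul_incl_mult[OF x u] by (rule tensor_lift_mult[OF U_alg U_alg P f pc cu])
  also have "\<dots> = ?s (\<iota> x) \<one>\<^bsub>\<U>\<^esub> \<oplus>\<^bsub>P\<^esub> ?s \<one>\<^bsub>\<U>\<^esub> (\<iota> x)"
    unfolding uea_prim_def
    by (simp only: linear_map_add[OF lf[OF bo]] tens_closed U_mod ix U.one_closed tensor_lift_tens[OF U_mod U_mod P bo])
  also have "?s (\<iota> x) \<one>\<^bsub>\<U>\<^esub> = tensor_lift K P (\<lambda>p q. f (\<iota> x \<bullet> p) q) (comul \<U> u)"
    by (rule tensor_lift_cong[OF U_mod U_mod P cu b[OF ix U.one_closed] b1(1)]) (simp only: U.l_one)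
  also have "?s \<one>\<^bsub>\<U>\<^esub> (\<iota> x) = tensor_lift K P (\<lambda>p q. f p (\<iota> x \<bullet> q)) (comul \<U> u)"
    by (rule tensor_lift_cong[OF U_mod U_mod P cu b[OF U.one_closed ix] b1(2)]) (simp only: U.l_one)
  finally show ?thesis
    using sweedler_add[OF L P u b1] by (simp add: sweedler_def)
qed

text \<open>
  For \<open>x u\<close> in place of \<open>u\<close>, the product rule turns either side into the same side for \<open>u\<close>, with \<open>F\<close> replaced by the sum
  of the three maps obtained from \<open>F\<close> by multiplying one argument with \<open>x\<close>. Hence the induction is
  over all trilinear maps at once.
\<close>

lemma uea_sweedler_coassoc:
  assumes P: "module K P" and u: "u \<in> carrier \<U>"
    and F: "\<And>v w. v \<in> carrier \<U> \<Longrightarrow> w \<in> carrier \<U> \<Longrightarrow> linear_map K \<U> P (\<lambda>u. F u v w)"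
      "\<And>u w. u \<in> carrier \<U> \<Longrightarrow> w \<in> carrier \<U> \<Longrightarrow> linear_map K \<U> P (\<lambda>v. F u v w)"
      "\<And>u v. u \<in> carrier \<U> \<Longrightarrow> v \<in> carrier \<U> \<Longrightarrow> linear_map K \<U> P (\<lambda>w. F u v w)"
  shows "sweedler K \<U> P (\<lambda>y z. sweedler K \<U> P (\<lambda>p q. F p q z) y) u =
    sweedler K \<U> P (\<lambda>y z. sweedler K \<U> P (\<lambda>p q. F y p q) z) u"
  using u F
proof (induction arbitrary: F rule: U_induct)
  case one
  note F = linear_comp[OF one(1)] linear_comp[OF one(2)] linear_comp[OF one(3)]
  note r = uea_linear_comul U_rules P U.one_closed F multilin
  show ?case
    by (subst uea_sweedler_one[OF P], (rule r | assumption)+)+ (rule refl)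
next
  case (mult x u)
  interpret P: module K P by (rule P)
  note F = linear_comp[OF mult(4)] linear_comp[OF mult(5)] linear_comp[OF mult(6)]
  note Fc = linear_map_closed[OF mult(4)]
  note r = uea_linear_comul U_incl[OF mult(1)] U_rules P mult(2) F Fc multilin
  note L = uea_linear_comul
  let ?F = "\<lambda>p q z. F (\<iota> x \<bullet> p) q z \<oplus>\<^bsub>P\<^esub> (F p (\<iota> x \<bullet> q) z \<oplus>\<^bsub>P\<^esub> F p q (\<iota> x \<bullet> z))"
  have 1: "sweedler K \<U> P (\<lambda>p q. F p q z) (\<iota> x \<bullet> y) \<oplus>\<^bsub>P\<^esub> sweedler K \<U> P (\<lambda>p q. F p q (\<iota> x \<bullet> z)) y
    = sweedler K \<U> P (\<lambda>p q. ?F p q z) y" if yz: "y \<in> carrier \<U>" "z \<in> carrier \<U>" for y z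
  proof -
    have "sweedler K \<U> P (\<lambda>p q. F p q z) (\<iota> x \<bullet> y) =
        sweedler K \<U> P (\<lambda>p q. F (\<iota> x \<bullet> p) q z \<oplus>\<^bsub>P\<^esub> F p (\<iota> x \<bullet> q) z) y"
      by (rule uea_sweedler_incl_mult[OF P _ mult(1) yz(1)]) (rule yz r | assumption)+
    moreover have "sweedler K \<U> P (\<lambda>p q. ?F p q z) y =
        sweedler K \<U> P (\<lambda>p q. (F (\<iota> x \<bullet> p) q z \<oplus>\<^bsub>P\<^esub> F p (\<iota> x \<bullet> q) z) \<oplus>\<^bsub>P\<^esub> F p q (\<iota> x \<bullet> z)) y"
      by (rule sweedler_cong[OF L P yz(1)]; (rule P.a_assoc[symmetric] yz r | assumption)+)
    moreover have "\<dots> = sweedler K \<U> P (\<lambda>p q. F (\<iota> x \<bullet> p) q z \<oplus>\<^bsub>P\<^esub> F p (\<iota> x \<bullet> q) z) y \<oplus>\<^bsub>P\<^esub>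
        sweedler K \<U> P (\<lambda>p q. F p q (\<iota> x \<bullet> z)) y"
      by (rule sweedler_add[OF L P yz(1)]; (rule yz r | assumption)+)
    ultimately show ?thesis by simp
  qed
  have 2: "sweedler K \<U> P (\<lambda>p q. F (\<iota> x \<bullet> y) p q) z \<oplus>\<^bsub>P\<^esub> sweedler K \<U> P (\<lambda>p q. F y p q) (\<iota> x \<bullet> z)
    = sweedler K \<U> P (\<lambda>p q. ?F y p q) z" if yz: "y \<in> carrier \<U>" "z \<in> carrier \<U>" for y z
  proof -
    have "sweedler K \<U> P (\<lambda>p q. F y p q) (\<iota> x \<bullet> z) =
        sweedler K \<U> P (\<lambda>p q. F y (\<iota> x \<bullet> p) q \<oplus>\<^bsub>P\<^esub> F y p (\<iota> x \<bullet> q)) z"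
      by (rule uea_sweedler_incl_mult[OF P _ mult(1) yz(2)]) (rule yz r | assumption)+
    moreover have "sweedler K \<U> P (\<lambda>p q. ?F y p q) z = sweedler K \<U> P (\<lambda>p q. F (\<iota> x \<bullet> y) p q) z \<oplus>\<^bsub>P\<^esub>
        sweedler K \<U> P (\<lambda>p q. F y (\<iota> x \<bullet> p) q \<oplus>\<^bsub>P\<^esub> F y p (\<iota> x \<bullet> q)) z"
      by (rule sweedler_add[OF L P yz(2)]; (rule yz r | assumption)+)
    ultimately show ?thesis by simp
  qed
  have "sweedler K \<U> P (\<lambda>y z. sweedler K \<U> P (\<lambda>p q. F p q z) y) (\<iota> x \<bullet> u) =
    sweedler K \<U> P (\<lambda>y z. sweedler K \<U> P (\<lambda>p q. F p q z) (\<iota> x \<bullet> y) \<oplus>\<^bsub>P\<^esub> sweedler K \<U> P (\<lambda>p q. F p q (\<iota> x \<bullet> z)) y) u"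
    by (rule uea_sweedler_incl_mult[OF P _ mult(1,2)]) (rule r | assumption)+
  also have "\<dots> = sweedler K \<U> P (\<lambda>y z. sweedler K \<U> P (\<lambda>p q. ?F p q z) y) u"
    by (rule sweedler_cong[OF L P mult(2)]; (rule 1 r | assumption)+)
  also have "\<dots> = sweedler K \<U> P (\<lambda>y z. sweedler K \<U> P (\<lambda>p q. ?F y p q) z) u"
    by (rule mult(3)) (rule r | assumption)+
  also have "\<dots> = sweedler K \<U> P (\<lambda>y z. sweedler K \<U> P (\<lambda>p q. F (\<iota> x \<bullet> y) p q) z \<oplus>\<^bsub>P\<^esub>
      sweedler K \<U> P (\<lambda>p q. F y p q) (\<iota> x \<bullet> z)) u"
    by (rule sweedler_cong[OF L P mult(2)]; (rule 2[symmetric] r | assumption)+)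
  also have "\<dots> = sweedler K \<U> P (\<lambda>y z. sweedler K \<U> P (\<lambda>p q. F y p q) z) (\<iota> x \<bullet> u)"
    by (rule uea_sweedler_incl_mult[OF P _ mult(1,2), symmetric]) (rule r | assumption)+
  finally show ?case .
next
  case (add u v)
  note F = linear_comp[OF add(5)] linear_comp[OF add(6)] linear_comp[OF add(7)]
  note r = uea_linear_comul U_rules P F multilin
  have l: "linear_map K \<U> P (\<lambda>u. sweedler K \<U> P (\<lambda>y z. sweedler K \<U> P (\<lambda>p q. F p q z) y) u)"
    "linear_map K \<U> P (\<lambda>u. sweedler K \<U> P (\<lambda>y z. sweedler K \<U> P (\<lambda>p q. F y p q) z) u)"
    by (rule r | assumption)+
  show ?case
    using linear_map_add[OF l(1) add(1,2)] linear_map_add[OF l(2) add(1,2)] add(3,4)[OF add(5-7)] by simp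
next
  case (smult c u)
  note F = linear_comp[OF smult(4)] linear_comp[OF smult(5)] linear_comp[OF smult(6)]
  note r = uea_linear_comul U_rules P F multilin
  have l: "linear_map K \<U> P (\<lambda>u. sweedler K \<U> P (\<lambda>y z. sweedler K \<U> P (\<lambda>p q. F p q z) y) u)"
    "linear_map K \<U> P (\<lambda>u. sweedler K \<U> P (\<lambda>y z. sweedler K \<U> P (\<lambda>p q. F y p q) z) u)"
    by (rule r | assumption)+
  show ?case
    using linear_map_smult[OF l(1) smult(1,2)] linear_map_smult[OF l(2) smult(1,2)] smult(3)[OF smult(4-6)] by simp
qed

lemma uea_sweedler_flip:
  assumes P: "module K P" and u: "u \<in> carrier \<U>" and f: "bilinear_map K \<U> \<U> P f"
  shows "sweedler K \<U> P f u = sweedler K \<U> P (\<lambda>p q. f q p) u"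
  using u f
proof (induction arbitrary: f rule: U_induct)
  case one
  have "bilinear_map K \<U> \<U> P (\<lambda>p q. f q p)" using one by (simp add: bilinear_map_def)
  with one show ?case by (simp only: uea_sweedler_one[OF P])
next
  case (mult x u)
  interpret P: module K P by (rule P)
  note L = uea_linear_comul
  note f = bilinear_mapD[OF mult(4)]
  note f' = linear_comp[OF f(1)] linear_comp[OF f(2)]
  note r = uea_linear_comul U_incl[OF mult(1)] U_rules P mult(2) f' linear_map_closed[OF f(1)] multilin
  have "sweedler K \<U> P f (\<iota> x \<bullet> u) =
      sweedler K \<U> P (\<lambda>p q. f (\<iota> x \<bullet> p) q \<oplus>\<^bsub>P\<^esub> f p (\<iota> x \<bullet> q)) u"
    by (rule uea_sweedler_incl_mult[OF P mult(4,1,2)])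
  also have "\<dots> = sweedler K \<U> P (\<lambda>p q. f (\<iota> x \<bullet> q) p \<oplus>\<^bsub>P\<^esub> f q (\<iota> x \<bullet> p)) u"
    by (rule mult(3)) (rule r | assumption)+
  also have "\<dots> = sweedler K \<U> P (\<lambda>p q. f q (\<iota> x \<bullet> p) \<oplus>\<^bsub>P\<^esub> f (\<iota> x \<bullet> q) p) u"
    by (rule sweedler_cong[OF L P mult(2)]; (rule P.a_comm r | assumption)+)
  also have "\<dots> = sweedler K \<U> P (\<lambda>p q. f q p) (\<iota> x \<bullet> u)"
    by (rule uea_sweedler_incl_mult[OF P _ mult(1,2), symmetric]) (rule r | assumption)+
  finally show ?case .
next
  case (add u v)
  have "bilinear_map K \<U> \<U> P (\<lambda>p q. f q p)" using add(5) by (simp add: bilinear_map_def)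
  note l = linear_sweedler[OF uea_linear_comul P add(5) linear_ident] linear_sweedler[OF uea_linear_comul P this linear_ident]
  show ?case
    using linear_map_add[OF l(1) add(1,2)] linear_map_add[OF l(2) add(1,2)] add(3,4)[OF add(5)] by simp
next
  case (smult c u)
  have "bilinear_map K \<U> \<U> P (\<lambda>p q. f q p)" using smult(4) by (simp add: bilinear_map_def)
  note l = linear_sweedler[OF uea_linear_comul P smult(4) linear_ident] linear_sweedler[OF uea_linear_comul P this linear_ident]
  show ?case
    using linear_map_smult[OF l(1) smult(1,2)] linear_map_smult[OF l(2) smult(1,2)] smult(3)[OF smult(4)] by simp
qed

lemma uea_counit_closed: "u \<in> carrier \<U> \<Longrightarrow> counit \<U> u \<in> carrier K"
  using linear_map_closed[OF uea_counit_linear] by simp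

lemma uea_sweedler_counit:
  assumes u: "u \<in> carrier \<U>"
  shows "sweedler K \<U> \<U> (\<lambda>y z. counit \<U> y \<odot>\<^bsub>\<U>\<^esub> z) u = u" "sweedler K \<U> \<U> (\<lambda>y z. counit \<U> z \<odot>\<^bsub>\<U>\<^esub> y) u = u"
proof -
  note L = uea_linear_comul
  note r = uea_linear_comul uea_counit_linear linear_comp[OF uea_counit_linear] uea_counit_closed U_rules multilin
  have b: "bilinear_map K \<U> \<U> \<U> (\<lambda>y z. counit \<U> y \<odot>\<^bsub>\<U>\<^esub> z)"
    by (rule r | assumption)+
  show left: "sweedler K \<U> \<U> (\<lambda>y z. counit \<U> y \<odot>\<^bsub>\<U>\<^esub> z) u = u"
  proof (rule uea_linear_eq[OF G U_mod _ linear_ident _ _ u])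
    show "linear_map K \<U> \<U> (sweedler K \<U> \<U> (\<lambda>y z. counit \<U> y \<odot>\<^bsub>\<U>\<^esub> z))"
      by (rule linear_sweedler[OF L U_mod b linear_ident])
    show "sweedler K \<U> \<U> (\<lambda>y z. counit \<U> y \<odot>\<^bsub>\<U>\<^esub> z) \<one>\<^bsub>\<U>\<^esub> = \<one>\<^bsub>\<U>\<^esub>"
      unfolding uea_sweedler_one[OF U_mod b] uea_counit_one by (rule U.smult_one[OF U.one_closed])
    fix x u assume x: "x \<in> carrier G" and u: "u \<in> carrier \<U>" and IH: "sweedler K \<U> \<U> (\<lambda>y z. counit \<U> y \<odot>\<^bsub>\<U>\<^esub> z) u = u"
    have eq: "counit \<U> (\<iota> x \<bullet> p) \<odot>\<^bsub>\<U>\<^esub> q \<oplus>\<^bsub>\<U>\<^esub> counit \<U> p \<odot>\<^bsub>\<U>\<^esub> (\<iota> x \<bullet> q) = \<iota> x \<bullet> (counit \<U> p \<odot>\<^bsub>\<U>\<^esub> q)"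
      if "p \<in> carrier \<U>" "q \<in> carrier \<U>" for p q
      by (simp only: uea_counit_incl_mult x that U.smult_l_null U.smult_closed U.smult_mult_right U_incl uea_counit_closed
          U.m_closed U.M.l_zero)
    have "sweedler K \<U> \<U> (\<lambda>y z. counit \<U> y \<odot>\<^bsub>\<U>\<^esub> z) (\<iota> x \<bullet> u) =
      sweedler K \<U> \<U> (\<lambda>p q. counit \<U> (\<iota> x \<bullet> p) \<odot>\<^bsub>\<U>\<^esub> q \<oplus>\<^bsub>\<U>\<^esub> counit \<U> p \<odot>\<^bsub>\<U>\<^esub> (\<iota> x \<bullet> q)) u"
      by (rule uea_sweedler_incl_mult[OF U_mod b x u])
    also have "\<dots> = sweedler K \<U> \<U> (\<lambda>p q. \<iota> x \<bullet> (counit \<U> p \<odot>\<^bsub>\<U>\<^esub> q)) u"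
      by (rule sweedler_cong[OF L U_mod u]; (rule eq x r | assumption)+)
    also have "\<dots> = \<iota> x \<bullet> sweedler K \<U> \<U> (\<lambda>p q. counit \<U> p \<odot>\<^bsub>\<U>\<^esub> q) u"
      by (rule linear_sweedler_commute[OF L U_mod U_mod _ b u, symmetric]) (rule x r | assumption)+
    finally show "sweedler K \<U> \<U> (\<lambda>y z. counit \<U> y \<odot>\<^bsub>\<U>\<^esub> z) (\<iota> x \<bullet> u) = \<iota> x \<bullet> u" by (simp only: IH)
  qed
  show "sweedler K \<U> \<U> (\<lambda>y z. counit \<U> z \<odot>\<^bsub>\<U>\<^esub> y) u = u"
    using uea_sweedler_flip[OF U_mod u b] left by simp
qed

lemma uea_bialgebra: "bialgebra K \<U>"
proof (intro bialgebra.intro U_alg coalgebra.intro U_mod coalgebra_axioms.intro bialgebra_axioms.intro)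
  note TT = tensor_module[OF T_mod U_mod]
  note r = uea_linear_comul U_rules TT multilin
  show "linear_map K \<U> \<T> (comul \<U>)" by (rule linear_comulD[OF uea_linear_comul])
  fix u assume u: "u \<in> carrier \<U>"
  show "sweedler K \<U> (tensor K \<T> \<U>) (\<lambda>y z. sweedler K \<U> (tensor K \<T> \<U>) (\<lambda>u v. tens K \<T> \<U> (tens K \<U> \<U> u v) z) y) u =
    sweedler K \<U> (tensor K \<T> \<U>) (\<lambda>y z. sweedler K \<U> (tensor K \<T> \<U>) (\<lambda>u v. tens K \<T> \<U> (tens K \<U> \<U> y u) v) z) u"
    by (rule uea_sweedler_coassoc[OF TT u]) (rule r | assumption)+
qed (assumption | rule uea_counit_linear uea_sweedler_counit uea_comul_mult uea_comul_one uea_counit_mult uea_counit_one)+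

text \<open>
  The antipode is the anti-homomorphism with \<open>x \<mapsto> -x\<close>. The negative of right multiplication is an action of
  the Lie algebra, and the antipode is the induced action on the unit.
\<close>

definition uea_antipode_act :: "'g \<Rightarrow> ('g list \<Rightarrow> 'k) set \<Rightarrow> ('g list \<Rightarrow> 'k) set"
  where "uea_antipode_act x a = \<ominus>\<^bsub>\<U>\<^esub> (a \<bullet> \<iota> x)"

definition uea_antipode :: "('g list \<Rightarrow> 'k) set \<Rightarrow> ('g list \<Rightarrow> 'k) set"
  where "uea_antipode u = uea_action K \<U> uea_antipode_act u \<one>\<^bsub>\<U>\<^esub>"

lemma uea_antipode_act_lie: "lie_module_action K G \<U> uea_antipode_act"
proof -
  have "bilinear_map K G \<U> \<U> uea_antipode_act"
    unfolding uea_antipode_act_def by (rule U_rules uea_incl_linear[OF G] multilin | assumption)+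
  moreover have "uea_antipode_act (bracket G x y) a =
      uea_antipode_act x (uea_antipode_act y a) \<ominus>\<^bsub>\<U>\<^esub> uea_antipode_act y (uea_antipode_act x a)"
    if "x \<in> carrier G" "y \<in> carrier G" "a \<in> carrier \<U>" for x y a
    using that U_incl
    by (simp only: uea_antipode_act_def uea_incl_bracket[OF G] a_minus_def U.r_distr U.r_minus U.l_minus U.m_closed
        U.M.a_inv_closed U.M.minus_minus U.m_assoc U.M.minus_add U.M.a_comm)
  ultimately show ?thesis by (simp add: lie_module_action_def)
qed

lemma uea_antipode_linear: "linear_map K \<U> \<U> uea_antipode"
  unfolding uea_antipode_def by (rule uea_action_linear_left[OF G U_mod uea_antipode_act_lie U.one_closed])

lemma uea_antipode_closed: "u \<in> carrier \<U> \<Longrightarrow> uea_antipode u \<in> carrier \<U>"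
  by (rule linear_map_closed[OF uea_antipode_linear])

lemma uea_antipode_one: "uea_antipode \<one>\<^bsub>\<U>\<^esub> = \<one>\<^bsub>\<U>\<^esub>"
  unfolding uea_antipode_def by (rule uea_action_one[OF G U_mod uea_antipode_act_lie U.one_closed])

lemma uea_antipode_incl_mult: "x \<in> carrier G \<Longrightarrow> u \<in> carrier \<U> \<Longrightarrow>
    uea_antipode (\<iota> x \<bullet> u) = \<ominus>\<^bsub>\<U>\<^esub> (uea_antipode u \<bullet> \<iota> x)"
  using uea_action_incl_mult[OF G U_mod uea_antipode_act_lie _ _ U.one_closed]
  by (simp only: uea_antipode_def uea_antipode_act_def)

lemma uea_antipode_incl: "x \<in> carrier G \<Longrightarrow> uea_antipode (\<iota> x) = \<ominus>\<^bsub>\<U>\<^esub> \<iota> x"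
  using uea_antipode_incl_mult[OF _ U.one_closed] by (simp only: uea_antipode_one U.r_one U.l_one U_incl)

lemma uea_antipode_mult:
  assumes u: "u \<in> carrier \<U>" and v: "v \<in> carrier \<U>"
  shows "uea_antipode (u \<bullet> v) = uea_antipode v \<bullet> uea_antipode u"
proof (rule uea_linear_eq[OF G U_mod _ _ _ _ u])
  show "linear_map K \<U> \<U> (\<lambda>u. uea_antipode (u \<bullet> v))"
    by (rule v U_rules linear_comp[OF uea_antipode_linear] multilin | assumption)+
  show "linear_map K \<U> \<U> (\<lambda>u. uea_antipode v \<bullet> uea_antipode u)"
    by (rule v U_rules uea_antipode_linear uea_antipode_closed multilin | assumption)+
  show "uea_antipode (\<one>\<^bsub>\<U>\<^esub> \<bullet> v) = uea_antipode v \<bullet> uea_antipode \<one>\<^bsub>\<U>\<^esub>"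
    by (simp only: uea_antipode_one U.l_one U.r_one v uea_antipode_closed)
qed (simp only: U.m_assoc v U_incl uea_antipode_incl_mult U.m_closed uea_antipode_closed U.r_minus)

lemma uea_antipode_antipode: "u \<in> carrier \<U> \<Longrightarrow> uea_antipode (uea_antipode u) = u"
proof (rule uea_linear_eq[OF G U_mod _ _ _ _ , where f = "\<lambda>u. uea_antipode (uea_antipode u)" and g = "\<lambda>u. u"])
  show "linear_map K \<U> \<U> (\<lambda>u. uea_antipode (uea_antipode u))"
    by (rule linear_comp[OF uea_antipode_linear uea_antipode_linear])
  fix x u assume c: "x \<in> carrier G" "u \<in> carrier \<U>" and IH: "uea_antipode (uea_antipode u) = u"
  show "uea_antipode (uea_antipode (\<iota> x \<bullet> u)) = \<iota> x \<bullet> u"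
    by (simp only: uea_antipode_incl_mult c linear_map_neg[OF U_mod U_mod uea_antipode_linear] U.m_closed U_incl
        uea_antipode_closed uea_antipode_mult IH uea_antipode_incl U.l_minus U.r_minus U.M.minus_minus U.M.a_inv_closed)
qed (simp_all only: uea_antipode_one linear_ident)

text \<open>
  In the induction step, the two terms of the product rule cancel for the left antipode law. For the
  right one they form the commutator of \<open>x\<close> with the value for \<open>u\<close>, which is a multiple of the unit.
\<close>

lemma uea_is_antipode: "is_antipode K \<U> uea_antipode"
proof -
  note L = uea_linear_comul and C = uea_bialgebra[THEN bialgebraD(1)]
  note S = uea_antipode_linear
  note r = L C uea_counit_linear uea_antipode_closed linear_comp[OF S] S uea_counit_closed U_rules U.one_closed multilin
  let ?e = "\<lambda>u. counit \<U> u \<odot>\<^bsub>\<U>\<^esub> \<one>\<^bsub>\<U>\<^esub>"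
  have e: "linear_map K \<U> \<U> ?e" by (rule r | assumption)+
  have b: "bilinear_map K \<U> \<U> \<U> (\<lambda>y z. uea_antipode y \<bullet> z)" "bilinear_map K \<U> \<U> \<U> (\<lambda>y z. y \<bullet> uea_antipode z)"
    by (rule r | assumption)+
  have ee: "?e (\<iota> x \<bullet> u) = \<zero>\<^bsub>\<U>\<^esub>" if "x \<in> carrier G" "u \<in> carrier \<U>" for x u
    by (simp only: uea_counit_incl_mult that U.smult_l_null U.one_closed)
  have e1: "?e \<one>\<^bsub>\<U>\<^esub> = \<one>\<^bsub>\<U>\<^esub>" by (simp only: uea_counit_one U.smult_one U.one_closed)
  have left: "sweedler K \<U> \<U> (\<lambda>y z. uea_antipode y \<bullet> z) u = ?e u" if u: "u \<in> carrier \<U>" for u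
  proof (rule uea_linear_eq[OF G U_mod linear_sweedler[OF L U_mod b(1) linear_ident] e _ _ u])
    show "sweedler K \<U> \<U> (\<lambda>y z. uea_antipode y \<bullet> z) \<one>\<^bsub>\<U>\<^esub> = ?e \<one>\<^bsub>\<U>\<^esub>"
      by (simp only: uea_sweedler_one[OF U_mod b(1)] uea_antipode_one U.l_one U.one_closed e1)
    fix x u assume x: "x \<in> carrier G" and u: "u \<in> carrier \<U>"
    have eq: "uea_antipode (\<iota> x \<bullet> p) \<bullet> q \<oplus>\<^bsub>\<U>\<^esub> uea_antipode p \<bullet> (\<iota> x \<bullet> q) = \<zero>\<^bsub>\<U>\<^esub>"
      if "p \<in> carrier \<U>" "q \<in> carrier \<U>" for p q
      by (simp only: uea_antipode_incl_mult x that U.l_minus U.m_closed U_incl uea_antipode_closed U.m_assoc U.M.l_neg)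
    have "sweedler K \<U> \<U> (\<lambda>y z. uea_antipode y \<bullet> z) (\<iota> x \<bullet> u) =
      sweedler K \<U> \<U> (\<lambda>p q. uea_antipode (\<iota> x \<bullet> p) \<bullet> q \<oplus>\<^bsub>\<U>\<^esub> uea_antipode p \<bullet> (\<iota> x \<bullet> q)) u"
      by (rule uea_sweedler_incl_mult[OF U_mod b(1) x u])
    also have "\<dots> = sweedler K \<U> \<U> (\<lambda>p q. \<zero>\<^bsub>\<U>\<^esub>) u"
      by (rule sweedler_cong[OF L U_mod u]; (rule eq x r | assumption)+)
    also have "\<dots> = \<zero>\<^bsub>\<U>\<^esub>"
      using linear_sweedler_commute[OF L U_mod U_mod linear_zero[OF U_mod] b(1) u] by simp
    finally show "sweedler K \<U> \<U> (\<lambda>y z. uea_antipode y \<bullet> z) (\<iota> x \<bullet> u) = ?e (\<iota> x \<bullet> u)"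
      by (simp only: ee x u)
  qed
  have right: "sweedler K \<U> \<U> (\<lambda>y z. y \<bullet> uea_antipode z) u = ?e u" if u: "u \<in> carrier \<U>" for u
  proof (rule uea_linear_eq[OF G U_mod linear_sweedler[OF L U_mod b(2) linear_ident] e _ _ u])
    show "sweedler K \<U> \<U> (\<lambda>y z. y \<bullet> uea_antipode z) \<one>\<^bsub>\<U>\<^esub> = ?e \<one>\<^bsub>\<U>\<^esub>"
      by (simp only: uea_sweedler_one[OF U_mod b(2)] uea_antipode_one U.l_one U.one_closed e1)
    fix x u assume x: "x \<in> carrier G" and u: "u \<in> carrier \<U>"
      and IH: "sweedler K \<U> \<U> (\<lambda>y z. y \<bullet> uea_antipode z) u = ?e u"
    note ix = U_incl[OF x]
    let ?g = "\<lambda>w. \<iota> x \<bullet> w \<ominus>\<^bsub>\<U>\<^esub> w \<bullet> \<iota> x"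
    have g: "linear_map K \<U> \<U> ?g" by (rule ix r | assumption)+
    have eq: "(\<iota> x \<bullet> p) \<bullet> uea_antipode q \<oplus>\<^bsub>\<U>\<^esub> p \<bullet> uea_antipode (\<iota> x \<bullet> q) = ?g (p \<bullet> uea_antipode q)"
      if "p \<in> carrier \<U>" "q \<in> carrier \<U>" for p q
      by (simp only: uea_antipode_incl_mult x that U.r_minus U.m_closed ix uea_antipode_closed U.m_assoc a_minus_def)
    have "sweedler K \<U> \<U> (\<lambda>y z. y \<bullet> uea_antipode z) (\<iota> x \<bullet> u) =
      sweedler K \<U> \<U> (\<lambda>p q. (\<iota> x \<bullet> p) \<bullet> uea_antipode q \<oplus>\<^bsub>\<U>\<^esub> p \<bullet> uea_antipode (\<iota> x \<bullet> q)) u"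
      by (rule uea_sweedler_incl_mult[OF U_mod b(2) x u])
    also have "\<dots> = sweedler K \<U> \<U> (\<lambda>p q. ?g (p \<bullet> uea_antipode q)) u"
      by (rule sweedler_cong[OF L U_mod u]; (rule eq ix r | assumption)+)
    also have "\<dots> = ?g (?e u)"
      by (rule linear_sweedler_commute[OF L U_mod U_mod g b(2) u, symmetric, unfolded IH])
    also have "\<dots> = \<zero>\<^bsub>\<U>\<^esub>"
      by (simp only: U.smult_mult_left U.smult_mult_right ix U.one_closed uea_counit_closed u U.l_one U.r_one
          a_minus_def U.M.r_neg U.smult_closed)
    finally show "sweedler K \<U> \<U> (\<lambda>y z. y \<bullet> uea_antipode z) (\<iota> x \<bullet> u) = ?e (\<iota> x \<bullet> u)"
      by (simp only: ee x u)
  qed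
  show ?thesis unfolding is_antipode_def using left right S by blast
qed

lemma uea_hopf_algebra: "hopf_algebra K \<U>"
proof (intro hopf_algebra.intro uea_bialgebra hopf_algebra_axioms.intro exI[of _ uea_antipode] conjI uea_is_antipode)
  show "bij_betw uea_antipode (carrier \<U>) (carrier \<U>)"
    by (rule bij_betw_byWitness[where f' = uea_antipode]) (auto simp: uea_antipode_antipode[simplified] dest: uea_antipode_closed[simplified])
qed

end

section \<open>Biderivations and module Hopf algebras\<close>

lemma uea_cocommutative:
  assumes G: "lie_algebra K G"
  shows "cocommutative K (uea K G)"
proof -
  note U = assoc_algebra_module[OF uea_assoc_algebra[OF G]]
  have "comul (uea K G) u = sweedler K (uea K G) (tensor K (uea K G) (uea K G)) (\<lambda>p q. tens K (uea K G) (uea K G) q p) u"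
    if "u \<in> carrier (uea K G)" for u
    unfolding comul_eq_sweedler[OF uea_linear_comul[OF G] that]
    by (rule uea_sweedler_flip[OF G tensor_module[OF U U] that tens_bilinear[OF U U]])
  then show ?thesis unfolding cocommutative_def by blast
qed

text \<open>
  Induction over monomials. When \<open>u\<close> is replaced by \<open>x u\<close>, the result of acting on a product or taking a coproduct
  after acting changes by the operator \<open>act x\<close>, and the product rule for Sweedler sums over \<open>x u\<close> shows the same for
  the other side of the identity, because \<open>act x\<close> is a derivation and a coderivation. In the identities
  for the unit and the counit both sides vanish on \<open>x u\<close>. The last compatibility is an
  instance of cocommutativity.
\<close>

lemma uea_module_hopf_algebra:
  fixes H :: "('k, 'h, 'd) hopf_scheme"
  assumes H: "hopf_algebra K H" and G: "lie_algebra K G" and act: "acts_by_biderivations K G H act"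
  shows "module_hopf_algebra K (uea K G) H (uea_action K H act)"
proof -
  let ?U = "uea K G" and ?T = "tensor K H H" and ?\<iota> = "uea_incl K G"
  let ?a = "uea_action K H act"
  interpret H: hopf_algebra K H by (rule H)
  interpret U: hopf_algebra K ?U by (rule uea_hopf_algebra[OF G])
  note la = act[unfolded acts_by_biderivations_def, THEN conjunct1]
  have der: "act x (a \<otimes>\<^bsub>H\<^esub> b) = (act x a \<otimes>\<^bsub>H\<^esub> b) \<oplus>\<^bsub>H\<^esub> (a \<otimes>\<^bsub>H\<^esub> act x b)"
    and coder: "comul H (act x a) = sweedler K H ?T (\<lambda>a1 a2. tens K H H (act x a1) a2 \<oplus>\<^bsub>?T\<^esub> tens K H H a1 (act x a2)) a"
    and coun: "counit H (act x a) = \<zero>\<^bsub>K\<^esub>"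
    if "x \<in> carrier G" "a \<in> carrier H" "b \<in> carrier H" for x a b
    using act that unfolding acts_by_biderivations_def by blast+
  note Hm = H.module_axioms and T = tensor_module[OF H.module_axioms H.module_axioms]
  note Um = U.module_axioms
  note Hc = H.coalgebra_axioms and Uc = U.coalgebra_axioms
  note HL = coalgebra_linear_comul[OF Hc] and UL = coalgebra_linear_comul[OF Uc]
  note al = uea_action_linear_left[OF G Hm la] and ac = uea_action_closed[OF G Hm la]
  note xl = act_linear[OF G Hm la] and xc = linear_map_closed[OF act_linear[OF G Hm la]]
  note a1 = uea_action_one[OF G Hm la] and ax = uea_action_incl_mult[OF G Hm la]
  have mod: "left_module_action K ?U H ?a" by (rule uea_action_module[OF G Hm la])
  then have ar: "linear_map K H H (?a u)" if "u \<in> carrier ?U" for u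
    using that by (auto simp: left_module_action_def bilinear_map_def)
  note ix = uea_incl_closed[OF G]
  note step = uea_sweedler_incl_mult[OF G] and one = uea_sweedler_one[OF G]
  note cov = H.comul_linear linear_comp[OF H.comul_linear] comul_closed[OF HL]
  note r = Hm T Um Hc Uc H.R.is_cring H.assoc_algebra_axioms U.assoc_algebra_axioms linear_comp[OF al] linear_comp[OF ar]
    linear_comp[OF xl] al ar xl ac xc ix cov multilin
  show ?thesis
  proof (intro module_hopf_algebra.intro U.hopf_algebra_axioms H module_hopf_algebra_axioms.intro mod)
    fix l a b assume l: "l \<in> carrier ?U" and a: "a \<in> carrier H" and b: "b \<in> carrier H"
    have bil: "bilinear_map K ?U ?U H (\<lambda>l1 l2. ?a l1 a \<otimes>\<^bsub>H\<^esub> ?a l2 b)" by (rule a b r | assumption)+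
    show "?a l (a \<otimes>\<^bsub>H\<^esub> b) = sweedler K ?U H (\<lambda>l1 l2. ?a l1 a \<otimes>\<^bsub>H\<^esub> ?a l2 b) l"
    proof (rule uea_linear_eq[OF G Hm _ _ _ _ l])
      show "linear_map K ?U H (\<lambda>l. ?a l (a \<otimes>\<^bsub>H\<^esub> b))" by (rule a b r | assumption)+
      show "linear_map K ?U H (sweedler K ?U H (\<lambda>l1 l2. ?a l1 a \<otimes>\<^bsub>H\<^esub> ?a l2 b))"
        by (rule linear_sweedler[OF UL Hm bil linear_ident])
      show "?a \<one>\<^bsub>?U\<^esub> (a \<otimes>\<^bsub>H\<^esub> b) = sweedler K ?U H (\<lambda>l1 l2. ?a l1 a \<otimes>\<^bsub>H\<^esub> ?a l2 b) \<one>\<^bsub>?U\<^esub>"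
        by (simp only: one[OF Hm bil] a1 a b H.m_closed)
      fix x u assume x: "x \<in> carrier G" and u: "u \<in> carrier ?U"
        and IH: "?a u (a \<otimes>\<^bsub>H\<^esub> b) = sweedler K ?U H (\<lambda>l1 l2. ?a l1 a \<otimes>\<^bsub>H\<^esub> ?a l2 b) u"
      have eq: "?a (?\<iota> x \<otimes>\<^bsub>?U\<^esub> p) a \<otimes>\<^bsub>H\<^esub> ?a q b \<oplus>\<^bsub>H\<^esub> ?a p a \<otimes>\<^bsub>H\<^esub> ?a (?\<iota> x \<otimes>\<^bsub>?U\<^esub> q) b = act x (?a p a \<otimes>\<^bsub>H\<^esub> ?a q b)"
        if "p \<in> carrier ?U" "q \<in> carrier ?U" for p q
        by (simp only: ax der x a b that ac)
      have "sweedler K ?U H (\<lambda>l1 l2. ?a l1 a \<otimes>\<^bsub>H\<^esub> ?a l2 b) (?\<iota> x \<otimes>\<^bsub>?U\<^esub> u) =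
        sweedler K ?U H (\<lambda>p q. ?a (?\<iota> x \<otimes>\<^bsub>?U\<^esub> p) a \<otimes>\<^bsub>H\<^esub> ?a q b \<oplus>\<^bsub>H\<^esub> ?a p a \<otimes>\<^bsub>H\<^esub> ?a (?\<iota> x \<otimes>\<^bsub>?U\<^esub> q) b) u"
        by (rule step[OF Hm bil x u])
      also have "\<dots> = sweedler K ?U H (\<lambda>p q. act x (?a p a \<otimes>\<^bsub>H\<^esub> ?a q b)) u"
        by (rule sweedler_cong[OF UL Hm u]; (rule eq x a b r | assumption)+)
      also have "\<dots> = act x (sweedler K ?U H (\<lambda>p q. ?a p a \<otimes>\<^bsub>H\<^esub> ?a q b) u)"
        by (rule linear_sweedler_commute[OF UL Hm Hm xl[OF x] bil u, symmetric])
      finally show "?a (?\<iota> x \<otimes>\<^bsub>?U\<^esub> u) (a \<otimes>\<^bsub>H\<^esub> b) =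
        sweedler K ?U H (\<lambda>l1 l2. ?a l1 a \<otimes>\<^bsub>H\<^esub> ?a l2 b) (?\<iota> x \<otimes>\<^bsub>?U\<^esub> u)"
        by (simp only: ax x u a b H.m_closed IH)
    qed
  next
    fix l assume l: "l \<in> carrier ?U"
    have x1: "act x \<one>\<^bsub>H\<^esub> = \<zero>\<^bsub>H\<^esub>" if x: "x \<in> carrier G" for x
      using der[OF x H.one_closed H.one_closed] xc[OF x H.one_closed] by simp
    show "?a l \<one>\<^bsub>H\<^esub> = counit ?U l \<odot>\<^bsub>H\<^esub> \<one>\<^bsub>H\<^esub>"
    proof (rule uea_linear_eq[OF G Hm _ _ _ _ l])
      show "linear_map K ?U H (\<lambda>l. ?a l \<one>\<^bsub>H\<^esub>)" by (rule r | assumption)+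
      show "linear_map K ?U H (\<lambda>l. counit ?U l \<odot>\<^bsub>H\<^esub> \<one>\<^bsub>H\<^esub>)" by (rule r | assumption)+
      show "?a \<one>\<^bsub>?U\<^esub> \<one>\<^bsub>H\<^esub> = counit ?U \<one>\<^bsub>?U\<^esub> \<odot>\<^bsub>H\<^esub> \<one>\<^bsub>H\<^esub>"
        by (simp only: a1 H.one_closed U.counit_one H.smult_one)
    qed (simp only: ax H.one_closed uea_counit_incl_mult[OF G] counit_closed[OF Uc] linear_map_smult[OF xl] x1
        H.smult_r_null H.smult_l_null)
  next
    fix l a assume l: "l \<in> carrier ?U" and a: "a \<in> carrier H"
    let ?g = "\<lambda>l1 l2. sweedler K H ?T (\<lambda>a1 a2. tens K H H (?a l1 a1) (?a l2 a2)) a"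
    have bil: "bilinear_map K ?U ?U ?T ?g" by (rule a r | assumption)+
    show "comul H (?a l a) = sweedler K ?U ?T ?g l"
    proof (rule uea_linear_eq[OF G T _ _ _ _ l])
      show "linear_map K ?U ?T (\<lambda>l. comul H (?a l a))" by (rule a r | assumption)+
      show "linear_map K ?U ?T (sweedler K ?U ?T ?g)"
        by (rule linear_sweedler[OF UL T bil linear_ident])
      have "sweedler K ?U ?T ?g \<one>\<^bsub>?U\<^esub> = sweedler K H ?T (\<lambda>a1 a2. tens K H H (?a \<one>\<^bsub>?U\<^esub> a1) (?a \<one>\<^bsub>?U\<^esub> a2)) a"
        by (rule one[OF T bil])
      also have "\<dots> = sweedler K H ?T (tens K H H) a"
        by (rule sweedler_cong[OF HL T a]; (rule tens_bilinear r | simp only: a1 | assumption)+)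
      also have "\<dots> = comul H a" by (rule comul_eq_sweedler[OF HL a, symmetric])
      finally show "comul H (?a \<one>\<^bsub>?U\<^esub> a) = sweedler K ?U ?T ?g \<one>\<^bsub>?U\<^esub>" by (simp only: a1 a)
      fix x u assume x: "x \<in> carrier G" and u: "u \<in> carrier ?U"
        and IH: "comul H (?a u a) = sweedler K ?U ?T ?g u"
      let ?D = "\<lambda>a1 a2. tens K H H (act x a1) a2 \<oplus>\<^bsub>?T\<^esub> tens K H H a1 (act x a2)"
      have D: "bilinear_map K H H ?T ?D" by (rule x r | assumption)+
      note Dl = tensor_lift_linear[OF Hm Hm T D] and Dt = tensor_lift_tens[OF Hm Hm T D]
      note rD = x u a linear_comp[OF Dl] r
      have eq: "?g (?\<iota> x \<otimes>\<^bsub>?U\<^esub> p) q \<oplus>\<^bsub>?T\<^esub> ?g p (?\<iota> x \<otimes>\<^bsub>?U\<^esub> q) = tensor_lift K ?T ?D (?g p q)"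
        if pq: "p \<in> carrier ?U" "q \<in> carrier ?U" for p q
      proof -
        have "tensor_lift K ?T ?D (?g p q) = sweedler K H ?T (\<lambda>a1 a2. tensor_lift K ?T ?D (tens K H H (?a p a1) (?a q a2))) a"
          by (rule linear_sweedler_commute[OF HL T T Dl _ a]) (rule pq r | assumption)+
        also have "\<dots> = sweedler K H ?T (\<lambda>a1 a2. tens K H H (?a (?\<iota> x \<otimes>\<^bsub>?U\<^esub> p) a1) (?a q a2)
            \<oplus>\<^bsub>?T\<^esub> tens K H H (?a p a1) (?a (?\<iota> x \<otimes>\<^bsub>?U\<^esub> q) a2)) a"
          by (rule sweedler_cong[OF HL T a]; (rule pq rD | simp only: Dt ac ax x pq | assumption)+)
        also have "\<dots> = ?g (?\<iota> x \<otimes>\<^bsub>?U\<^esub> p) q \<oplus>\<^bsub>?T\<^esub> ?g p (?\<iota> x \<otimes>\<^bsub>?U\<^esub> q)"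
          by (rule sweedler_add[OF HL T a]; (rule pq rD | assumption)+)
        finally show ?thesis by simp
      qed
      have "sweedler K ?U ?T ?g (?\<iota> x \<otimes>\<^bsub>?U\<^esub> u) =
        sweedler K ?U ?T (\<lambda>p q. ?g (?\<iota> x \<otimes>\<^bsub>?U\<^esub> p) q \<oplus>\<^bsub>?T\<^esub> ?g p (?\<iota> x \<otimes>\<^bsub>?U\<^esub> q)) u"
        by (rule step[OF T bil x u])
      also have "\<dots> = sweedler K ?U ?T (\<lambda>p q. tensor_lift K ?T ?D (?g p q)) u"
        by (rule sweedler_cong[OF UL T u]; (rule eq rD | assumption)+)
      also have "\<dots> = tensor_lift K ?T ?D (sweedler K ?U ?T ?g u)"
        by (rule linear_sweedler_commute[OF UL T T Dl bil u, symmetric])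
      also have "\<dots> = comul H (act x (?a u a))"
        unfolding coder[OF x ac[OF u a] a] sweedler_def[of K H ?T ?D] IH by (rule refl)
      finally show "comul H (?a (?\<iota> x \<otimes>\<^bsub>?U\<^esub> u) a) = sweedler K ?U ?T ?g (?\<iota> x \<otimes>\<^bsub>?U\<^esub> u)"
        by (simp only: ax x u a)
    qed
    show "counit H (?a l a) = counit ?U l \<otimes>\<^bsub>K\<^esub> counit H a"
    proof (rule uea_linear_eq[OF G self_module_module[OF H.R.is_cring] _ _ _ _ l])
      show "linear_map K ?U (self_module K) (\<lambda>l. counit H (?a l a))" by (rule a r | assumption)+
      show "linear_map K ?U (self_module K) (\<lambda>l. counit ?U l \<otimes>\<^bsub>K\<^esub> counit H a)" by (rule a r | assumption)+
      show "counit H (?a \<one>\<^bsub>?U\<^esub> a) = counit ?U \<one>\<^bsub>?U\<^esub> \<otimes>\<^bsub>K\<^esub> counit H a"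
        by (simp only: a1 a U.counit_one H.R.l_one counit_closed[OF Hc])
    qed (simp only: ax a uea_counit_incl_mult[OF G] counit_closed[OF Hc] coun[OF _ _ a] ac H.R.l_null)
    have Tl: "module K (tensor K ?U H)" by (rule tensor_module[OF Um Hm])
    show "sweedler K ?U (tensor K ?U H) (\<lambda>l1 l2. tens K ?U H l1 (?a l2 a)) l =
      sweedler K ?U (tensor K ?U H) (\<lambda>l1 l2. tens K ?U H l2 (?a l1 a)) l"
      by (rule uea_sweedler_flip[OF G Tl l]) (rule a Tl r | assumption)+
  qed
qed

section \<open>The smash product as an algebra\<close>

lemma smash_simps [simp]:
  "carrier (smash K H L act) = carrier (tensor K H L)" "zero (smash K H L act) = zero (tensor K H L)"
  "add (smash K H L act) = add (tensor K H L)" "smult (smash K H L act) = smult (tensor K H L)"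
  "one (smash K H L act) = tens K H L \<one>\<^bsub>H\<^esub> \<one>\<^bsub>L\<^esub>"
  by (simp_all add: smash_def Let_def)

lemma smash_mult:
  "mult (smash K H L act) = (\<lambda>s t. tensor_lift K (tensor K H L) (\<lambda>a l. tensor_lift K (tensor K H L) (\<lambda>b m.
     sweedler K L (tensor K H L) (\<lambda>l1 l2. tens K H L (a \<otimes>\<^bsub>H\<^esub> act l1 b) (l2 \<otimes>\<^bsub>L\<^esub> m)) l) t) s)"
  by (simp add: smash_def Let_def)

lemma linear_map_smash [simp]:
  "linear_map K M (smash K H L act) f = linear_map K M (tensor K H L) f"
  "linear_map K (smash K H L act) M g = linear_map K (tensor K H L) M g"
  by (simp_all add: linear_map_def)

context
  fixes K :: "('k, 'c) ring_scheme" and L :: "('k, 'l, 'e) hopf_scheme" and H :: "('k, 'h, 'd) hopf_scheme"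
    and act :: "'l \<Rightarrow> 'h \<Rightarrow> 'h"
  assumes mh: "module_hopf_algebra K L H act"
begin

interpretation mh: module_hopf_algebra K L H act by (rule mh)

abbreviation (input) "\<W> \<equiv> tensor K H L"
abbreviation (input) "\<S> \<equiv> smash K H L act"
abbreviation (input) smash_times (infixl "\<star>" 70) where "s \<star> t \<equiv> s \<otimes>\<^bsub>smash K H L act\<^esub> t"
abbreviation (input) "pure \<equiv> tens K H L"

lemmas KK = module.axioms(1)[OF mh.H.module_axioms]
lemmas Hm = mh.H.module_axioms
lemmas Lm = mh.L.module_axioms
lemmas Ha = mh.H.assoc_algebra_axioms
lemmas La = mh.L.assoc_algebra_axioms
lemmas Hc = mh.H.coalgebra_axioms
lemmas Lc = mh.L.coalgebra_axioms
lemmas Hb = mh.H.bialgebra_axioms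
lemmas Lb = mh.L.bialgebra_axioms
lemmas HL = coalgebra_linear_comul[OF Hc]
lemmas LL = coalgebra_linear_comul[OF Lc]
lemmas Tm = tensor_module[OF Hm Lm]

lemma act_bilinear: "bilinear_map K L H H act"
  and act_one_left: "a \<in> carrier H \<Longrightarrow> act \<one>\<^bsub>L\<^esub> a = a"
  and act_mult_left: "l \<in> carrier L \<Longrightarrow> m \<in> carrier L \<Longrightarrow> a \<in> carrier H \<Longrightarrow> act (l \<otimes>\<^bsub>L\<^esub> m) a = act l (act m a)"
  using mh.action by (simp_all add: left_module_action_def)

lemmas act_linear1 = linear_comp[OF bilinear_mapD(2)[OF act_bilinear]]
lemmas act_linear2 = linear_comp[OF bilinear_mapD(1)[OF act_bilinear]]
lemmas act_closed = linear_map_closed[OF bilinear_mapD(1)[OF act_bilinear]]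

lemmas basic_rules = KK Hm Lm Ha La Hc Lc HL LL Tm act_linear1 act_linear2 act_closed multilin

abbreviation (input) "pure_mult a l b m \<equiv> sweedler K L \<W> (\<lambda>l1 l2. pure (a \<otimes>\<^bsub>H\<^esub> act l1 b) (l2 \<otimes>\<^bsub>L\<^esub> m)) l"

lemma smash_mult_bilinear: "bilinear_map K \<W> \<W> \<W> (mult \<S>)"
  and smash_mult_pure: "\<lbrakk>a \<in> carrier H; l \<in> carrier L; b \<in> carrier H; m \<in> carrier L\<rbrakk> \<Longrightarrow>
    pure a l \<star> pure b m = pure_mult a l b m"
proof -
  have 1: "bilinear_map K H L \<W> (\<lambda>b m. pure_mult a l b m)" if "a \<in> carrier H" "l \<in> carrier L" for a l
    by (rule that basic_rules | assumption)+
  have 2: "bilinear_map K H L \<W> (\<lambda>a l. tensor_lift K \<W> (\<lambda>b m. pure_mult a l b m) t)"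
    if t: "t \<in> carrier \<W>" for t
    by (rule bilinear_mapI; rule linear_tensor_lift_fun[OF Hm Lm Tm t]; (rule 1 basic_rules | assumption)+)
  show "bilinear_map K \<W> \<W> \<W> (mult \<S>)"
    unfolding smash_mult
  proof (rule bilinear_mapI)
    fix s assume s: "s \<in> carrier \<W>"
    show "linear_map K \<W> \<W> (\<lambda>t. tensor_lift K \<W> (\<lambda>a l. tensor_lift K \<W> (\<lambda>b m. pure_mult a l b m) t) s)"
      by (rule linear_tensor_lift_fun[OF Hm Lm Tm s 2 _ Tm], assumption)
        (intro tensor_lift_linear Hm Lm Tm 1; assumption)
    show "linear_map K \<W> \<W> (\<lambda>t. tensor_lift K \<W> (\<lambda>a l. tensor_lift K \<W> (\<lambda>b m. pure_mult a l b m) s) t)"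
      by (intro tensor_lift_linear Hm Lm Tm 2 s)
  qed
  assume c: "a \<in> carrier H" "l \<in> carrier L" "b \<in> carrier H" "m \<in> carrier L"
  show "pure a l \<star> pure b m = pure_mult a l b m"
    unfolding smash_mult
    using c by (simp add: tensor_lift_tens[OF Hm Lm Tm 2] tensor_lift_tens[OF Hm Lm Tm 1] tens_closed[OF Hm Lm])
qed

lemmas smash_mult_linear1 = linear_comp[OF bilinear_mapD(2)[OF smash_mult_bilinear]]
lemmas smash_mult_linear2 = linear_comp[OF bilinear_mapD(1)[OF smash_mult_bilinear]]
lemmas smash_mult_closed = linear_map_closed[OF bilinear_mapD(1)[OF smash_mult_bilinear]]

lemma smash_one_left: "b \<in> carrier H \<Longrightarrow> m \<in> carrier L \<Longrightarrow> a \<in> carrier H \<Longrightarrow>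
    pure a \<one>\<^bsub>L\<^esub> \<star> pure b m = pure (a \<otimes>\<^bsub>H\<^esub> b) m"
proof -
  assume c: "b \<in> carrier H" "m \<in> carrier L" "a \<in> carrier H"
  have "bilinear_map K L L \<W> (\<lambda>l1 l2. pure (a \<otimes>\<^bsub>H\<^esub> act l1 b) (l2 \<otimes>\<^bsub>L\<^esub> m))"
    by (rule c basic_rules | assumption)+
  note 1 = sweedler_one[OF Lb Tm this]
  show ?thesis
    by (simp only: smash_mult_pure c mh.L.one_closed 1 act_one_left mh.L.l_one)
qed

lemma smash_one_right: "a \<in> carrier H \<Longrightarrow> l \<in> carrier L \<Longrightarrow> m \<in> carrier L \<Longrightarrow>
    pure a l \<star> pure \<one>\<^bsub>H\<^esub> m = pure a (l \<otimes>\<^bsub>L\<^esub> m)"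
proof -
  assume c: "a \<in> carrier H" "l \<in> carrier L" "m \<in> carrier L"
  have f: "linear_map K L \<W> (\<lambda>l. pure a (l \<otimes>\<^bsub>L\<^esub> m))" by (rule c basic_rules | assumption)+
  have eq: "pure (a \<otimes>\<^bsub>H\<^esub> act l1 \<one>\<^bsub>H\<^esub>) (l2 \<otimes>\<^bsub>L\<^esub> m) = counit L l1 \<odot>\<^bsub>\<W>\<^esub> pure a (l2 \<otimes>\<^bsub>L\<^esub> m)"
    if "l1 \<in> carrier L" "l2 \<in> carrier L" for l1 l2
    using that c linear_map_smult[OF bilinear_mapD(2)[OF tens_bilinear[OF Hm Lm]]]
    by (simp only: mh.act_one mh.H.smult_mult_right counit_closed[OF Lc] mh.H.one_closed mh.H.r_one mh.L.m_closed)
  have "pure_mult a l \<one>\<^bsub>H\<^esub> m = sweedler K L \<W> (\<lambda>l1 l2. counit L l1 \<odot>\<^bsub>\<W>\<^esub> pure a (l2 \<otimes>\<^bsub>L\<^esub> m)) l"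
    by (rule sweedler_cong[OF LL Tm c(2)]; (rule eq c basic_rules | assumption)+)
  also have "\<dots> = pure a (l \<otimes>\<^bsub>L\<^esub> m)" by (rule sweedler_counit_left[OF Lc Tm c(2) f])
  finally show ?thesis using c by (simp only: smash_mult_pure mh.H.one_closed)
qed

text \<open>
  Both products equal the triple Sweedler sum of
  \<open>a (l\<^sub>1 \<cdot> b) (l\<^sub>2 \<cdot> (m\<^sub>1 \<cdot> c)) \<otimes> l\<^sub>3 m\<^sub>2 n\<close>: on the left because the coproduct of \<open>L\<close> is multiplicative, on the right
  because \<open>L\<close> acts compatibly with the product of \<open>H\<close>.
\<close>

lemma smash_mult_assoc_pure:
  assumes c: "a \<in> carrier H" "l \<in> carrier L" "b \<in> carrier H" "m \<in> carrier L" "c \<in> carrier H" "n \<in> carrier L"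
  shows "(pure a l \<star> pure b m) \<star> pure c n = pure a l \<star> (pure b m \<star> pure c n)"
proof -
  let ?s = "\<lambda>f l. sweedler K L \<W> f l"
  let ?E = "\<lambda>u v w p q. pure (a \<otimes>\<^bsub>H\<^esub> (act u b \<otimes>\<^bsub>H\<^esub> act v (act p c))) (w \<otimes>\<^bsub>L\<^esub> (q \<otimes>\<^bsub>L\<^esub> n))"
  note r = c smash_mult_linear1 smash_mult_linear2 basic_rules
  have "(pure a l \<star> pure b m) \<star> pure c n =
      ?s (\<lambda>x y. pure (a \<otimes>\<^bsub>H\<^esub> act x b) (y \<otimes>\<^bsub>L\<^esub> m) \<star> pure c n) l"
    unfolding smash_mult_pure[OF c(1-4)]
    by (rule linear_sweedler_commute[OF LL Tm Tm, where g = "\<lambda>z. z \<star> pure c n"]) (rule r | assumption)+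
  also have "\<dots> = ?s (\<lambda>x y. ?s (\<lambda>v w. ?s (\<lambda>p q. ?E x v w p q) m) y) l"
  proof (rule sweedler_cong[OF LL Tm c(2)])
    fix x y assume xy: "x \<in> carrier L" "y \<in> carrier L"
    have "pure (a \<otimes>\<^bsub>H\<^esub> act x b) (y \<otimes>\<^bsub>L\<^esub> m) \<star> pure c n =
        pure_mult (a \<otimes>\<^bsub>H\<^esub> act x b) (y \<otimes>\<^bsub>L\<^esub> m) c n"
      by (rule smash_mult_pure) (rule xy r | assumption)+
    also have "\<dots> = ?s (\<lambda>v w. ?s (\<lambda>p q. pure ((a \<otimes>\<^bsub>H\<^esub> act x b) \<otimes>\<^bsub>H\<^esub> act (v \<otimes>\<^bsub>L\<^esub> p) c) ((w \<otimes>\<^bsub>L\<^esub> q) \<otimes>\<^bsub>L\<^esub> n)) m) y"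
      by (rule sweedler_mult[OF Lb Tm]) (rule xy r | assumption)+
    also have "\<dots> = ?s (\<lambda>v w. ?s (\<lambda>p q. ?E x v w p q) m) y"
      by (rule sweedler_cong[OF LL Tm] xy r | assumption
          | (simp only: act_mult_left mh.H.m_assoc mh.L.m_assoc c xy act_closed; fail))+
    finally show "pure (a \<otimes>\<^bsub>H\<^esub> act x b) (y \<otimes>\<^bsub>L\<^esub> m) \<star> pure c n = ?s (\<lambda>v w. ?s (\<lambda>p q. ?E x v w p q) m) y" .
  qed (rule r | assumption)+
  finally have 1: "(pure a l \<star> pure b m) \<star> pure c n =
      ?s (\<lambda>x y. ?s (\<lambda>v w. ?s (\<lambda>p q. ?E x v w p q) m) y) l" .
  have "pure a l \<star> (pure b m \<star> pure c n) =
      ?s (\<lambda>p q. pure a l \<star> pure (b \<otimes>\<^bsub>H\<^esub> act p c) (q \<otimes>\<^bsub>L\<^esub> n)) m"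
    unfolding smash_mult_pure[OF c(3-6)]
    by (rule linear_sweedler_commute[OF LL Tm Tm]) (rule r | assumption)+
  also have "\<dots> = ?s (\<lambda>p q. ?s (\<lambda>x w. ?s (\<lambda>u v. ?E u v w p q) x) l) m"
  proof (rule sweedler_cong[OF LL Tm c(4)])
    fix p q assume pq: "p \<in> carrier L" "q \<in> carrier L"
    have eq: "pure (a \<otimes>\<^bsub>H\<^esub> act x (b \<otimes>\<^bsub>H\<^esub> act p c)) (w \<otimes>\<^bsub>L\<^esub> (q \<otimes>\<^bsub>L\<^esub> n)) = ?s (\<lambda>u v. ?E u v w p q) x"
      if xw: "x \<in> carrier L" "w \<in> carrier L" for x w
      unfolding mh.act_mult[OF xw(1) c(3) act_closed[OF pq(1) c(5)]]
      by (rule linear_sweedler_commute[OF LL Hm Tm]) (rule xw pq r | assumption)+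
    have "pure a l \<star> pure (b \<otimes>\<^bsub>H\<^esub> act p c) (q \<otimes>\<^bsub>L\<^esub> n) = pure_mult a l (b \<otimes>\<^bsub>H\<^esub> act p c) (q \<otimes>\<^bsub>L\<^esub> n)"
      by (rule smash_mult_pure) (rule pq r | assumption)+
    also have "\<dots> = ?s (\<lambda>x w. ?s (\<lambda>u v. ?E u v w p q) x) l"
      by (rule sweedler_cong[OF LL Tm c(2)]; (rule eq pq r | assumption)+)
    finally show "pure a l \<star> pure (b \<otimes>\<^bsub>H\<^esub> act p c) (q \<otimes>\<^bsub>L\<^esub> n) = ?s (\<lambda>x w. ?s (\<lambda>u v. ?E u v w p q) x) l" .
  qed (rule r | assumption)+
  also have "\<dots> = ?s (\<lambda>x w. ?s (\<lambda>p q. ?s (\<lambda>u v. ?E u v w p q) x) m) l"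
    by (rule sweedler_swap[OF LL LL Tm c(4,2)]) (rule r | assumption)+
  also have "\<dots> = ?s (\<lambda>x w. ?s (\<lambda>u v. ?s (\<lambda>p q. ?E u v w p q) m) x) l"
    by (rule sweedler_cong[OF LL Tm c(2)]; (rule sweedler_swap[OF LL LL Tm c(4)] r | assumption)+)
  also have "\<dots> = ?s (\<lambda>x y. ?s (\<lambda>v w. ?s (\<lambda>p q. ?E x v w p q) m) y) l"
    by (rule sweedler_coassoc[OF Lc Tm c(2)]) (rule r | assumption)+
  finally show ?thesis using 1 by simp
qed

lemma smash_assoc_algebra: "assoc_algebra K \<S>"
proof -
  note r = smash_mult_linear1 smash_mult_linear2 smash_mult_closed basic_rules
  note ext = tensor_linear_eq[OF Hm Lm Tm]
  have assoc: "(s \<star> t) \<star> u = s \<star> (t \<star> u)"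
    if "s \<in> carrier \<W>" "t \<in> carrier \<W>" "u \<in> carrier \<W>" for s t u
  proof (rule ext[OF _ _ _ that(1)])
    fix a l assume al: "a \<in> carrier H" "l \<in> carrier L"
    show "(pure a l \<star> t) \<star> u = pure a l \<star> (t \<star> u)"
    proof (rule ext[OF _ _ _ that(2)])
      fix b m assume bm: "b \<in> carrier H" "m \<in> carrier L"
      show "(pure a l \<star> pure b m) \<star> u = pure a l \<star> (pure b m \<star> u)"
        by (rule ext[OF _ _ _ that(3)]) (rule smash_mult_assoc_pure al bm r | assumption)+
    qed (rule al that r | assumption)+
  qed (rule that r | assumption)+
  have one: "\<one>\<^bsub>\<S>\<^esub> \<star> t = t" "t \<star> \<one>\<^bsub>\<S>\<^esub> = t" if t: "t \<in> carrier \<W>" for t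
    unfolding smash_simps
    by (rule ext[OF _ _ _ t]; (rule r | assumption | (simp only: smash_one_left smash_one_right mh.H.one_closed
      mh.L.one_closed mh.H.l_one mh.L.r_one; fail))+)+
  show ?thesis
  proof (intro assoc_algebra.intro assoc_algebra_axioms.intro ringI monoidI)
    show "module K \<S>" by (rule module_transfer[OF Tm]) (simp_all only: smash_simps)
    then show "abelian_group \<S>" by (rule module.axioms)
    show "\<one>\<^bsub>\<S>\<^esub> \<in> carrier \<S>" unfolding smash_simps by (rule r | assumption)+
  qed (simp_all only: smash_simps(1-4) assoc one smash_mult_closed
      linear_map_add[OF bilinear_mapD(2)[OF smash_mult_bilinear]] linear_map_add[OF bilinear_mapD(1)[OF smash_mult_bilinear]]
      linear_map_smult[OF bilinear_mapD(2)[OF smash_mult_bilinear]] linear_map_smult[OF bilinear_mapD(1)[OF smash_mult_bilinear]])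
qed

lemma smash_module: "module K \<S>"
  by (rule assoc_algebra_module[OF smash_assoc_algebra])

section \<open>The smash product as a coalgebra\<close>

lemma smash_tensor:
  "tensor K \<W> \<W> = tensor K \<S> \<S>" "tens K \<W> \<W> = tens K \<S> \<S>"
  by (rule tensor_transfer; simp only: smash_simps)+

lemma smash_comul: "comul \<S> = tensor_lift K (tensor K \<S> \<S>) (\<lambda>a l. sweedler K H (tensor K \<S> \<S>) (\<lambda>a1 a2.
    sweedler K L (tensor K \<S> \<S>) (\<lambda>l1 l2. tens K \<S> \<S> (pure a1 l1) (pure a2 l2)) l) a)"
  unfolding smash_tensor[symmetric] by (simp add: smash_def Let_def)

lemma smash_counit: "counit \<S> = tensor_lift K (self_module K) (\<lambda>a l. counit H a \<otimes>\<^bsub>K\<^esub> counit L l)"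
  by (simp add: smash_def Let_def)

lemma smash_ext:
  assumes "module K P" "linear_map K \<S> P f" "linear_map K \<S> P g" "s \<in> carrier \<S>"
    and "\<And>a l. a \<in> carrier H \<Longrightarrow> l \<in> carrier L \<Longrightarrow> f (pure a l) = g (pure a l)"
  shows "f s = g s"
  by (rule tensor_linear_eq[OF Hm Lm assms(1) assms(2,3)[unfolded linear_map_smash] assms(5)
        assms(4)[unfolded smash_simps]])

lemma pure_closed: "a \<in> carrier H \<Longrightarrow> l \<in> carrier L \<Longrightarrow> pure a l \<in> carrier \<S>"
  unfolding smash_simps by (rule tens_closed[OF Hm Lm])

lemma pure_linear1: "linear_map K Q H f \<Longrightarrow> l \<in> carrier L \<Longrightarrow> linear_map K Q \<S> (\<lambda>x. pure (f x) l)"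
  and pure_linear2: "linear_map K Q L g \<Longrightarrow> a \<in> carrier H \<Longrightarrow> linear_map K Q \<S> (\<lambda>x. pure a (g x))"
  unfolding linear_map_smash by (rule linear_tens_left[OF Hm Lm] linear_tens_right[OF Hm Lm]; assumption)+

lemmas S_rules = KK Hm Lm Ha La Hc Lc HL LL smash_module smash_assoc_algebra pure_linear1 pure_linear2 pure_closed
  act_linear1 act_linear2 act_closed multilin

lemma smash_lift:
  assumes P: "module K P" and f: "bilinear_map K H L P f"
  shows smash_lift_linear: "linear_map K \<S> P (tensor_lift K P f)"
    and smash_lift_pure: "a \<in> carrier H \<Longrightarrow> l \<in> carrier L \<Longrightarrow> tensor_lift K P f (pure a l) = f a l"
  using tensor_lift_linear[OF Hm Lm P f] tensor_lift_tens[OF Hm Lm P f] by simp_all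

abbreviation (input) "\<D> \<equiv> tensor K \<S> \<S>"
abbreviation (input) "ttens \<equiv> tens K \<S> \<S>"

lemma smash_comul_linear: "linear_map K \<S> \<D> (comul \<S>)"
  and smash_comul_pure: "a \<in> carrier H \<Longrightarrow> l \<in> carrier L \<Longrightarrow> comul \<S> (pure a l) =
    sweedler K H \<D> (\<lambda>a1 a2. sweedler K L \<D> (\<lambda>l1 l2. ttens (pure a1 l1) (pure a2 l2)) l) a"
proof -
  note D = tensor_module[OF smash_module smash_module]
  have b: "bilinear_map K H L \<D> (\<lambda>a l. sweedler K H \<D> (\<lambda>a1 a2. sweedler K L \<D> (\<lambda>l1 l2. ttens (pure a1 l1) (pure a2 l2)) l) a)"
    by (rule D S_rules | assumption)+
  show "linear_map K \<S> \<D> (comul \<S>)" unfolding smash_comul by (rule smash_lift_linear[OF D b])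
  show "a \<in> carrier H \<Longrightarrow> l \<in> carrier L \<Longrightarrow> comul \<S> (pure a l) =
    sweedler K H \<D> (\<lambda>a1 a2. sweedler K L \<D> (\<lambda>l1 l2. ttens (pure a1 l1) (pure a2 l2)) l) a"
    unfolding smash_comul by (rule smash_lift_pure[OF D b])
qed

lemma smash_linear_comul: "linear_comul K \<S>"
  using smash_module smash_comul_linear unfolding linear_comul_def by blast

lemma smash_counit_linear: "linear_map K \<S> (self_module K) (counit \<S>)"
  and smash_counit_pure: "a \<in> carrier H \<Longrightarrow> l \<in> carrier L \<Longrightarrow> counit \<S> (pure a l) = counit H a \<otimes>\<^bsub>K\<^esub> counit L l"
proof -
  have b: "bilinear_map K H L (self_module K) (\<lambda>a l. counit H a \<otimes>\<^bsub>K\<^esub> counit L l)"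
    by (rule S_rules | assumption)+
  note lift = smash_lift[OF self_module_module[OF KK] b]
  show "linear_map K \<S> (self_module K) (counit \<S>)" unfolding smash_counit by (rule lift)
  show "a \<in> carrier H \<Longrightarrow> l \<in> carrier L \<Longrightarrow> counit \<S> (pure a l) = counit H a \<otimes>\<^bsub>K\<^esub> counit L l"
    unfolding smash_counit by (rule lift)
qed

lemma smash_counit_closed: "s \<in> carrier \<S> \<Longrightarrow> counit \<S> s \<in> carrier K"
  using linear_map_closed[OF smash_counit_linear] by simp

lemma sweedler_pure:
  assumes P: "module K P" and f: "bilinear_map K \<S> \<S> P f" and a: "a \<in> carrier H" and l: "l \<in> carrier L"
  shows "sweedler K \<S> P f (pure a l) =
    sweedler K H P (\<lambda>a1 a2. sweedler K L P (\<lambda>l1 l2. f (pure a1 l1) (pure a2 l2)) l) a"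
proof -
  note D = tensor_module[OF smash_module smash_module]
  note g = tensor_lift_linear[OF smash_module smash_module P f]
  note gt = tensor_lift_tens[OF smash_module smash_module P f]
  note r = a l P D linear_comp[OF g] linear_comp[OF bilinear_mapD(1)[OF f]] linear_comp[OF bilinear_mapD(2)[OF f]] S_rules
  have "sweedler K \<S> P f (pure a l) = tensor_lift K P f
      (sweedler K H \<D> (\<lambda>a1 a2. sweedler K L \<D> (\<lambda>l1 l2. ttens (pure a1 l1) (pure a2 l2)) l) a)"
    by (simp only: sweedler_def[of K \<S>] smash_comul_pure a l)
  also have "\<dots> = sweedler K H P (\<lambda>a1 a2. tensor_lift K P f (sweedler K L \<D> (\<lambda>l1 l2. ttens (pure a1 l1) (pure a2 l2)) l)) a"
    by (rule linear_sweedler_commute[OF HL D P g _ a]) (rule r | assumption)+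
  also have "\<dots> = sweedler K H P (\<lambda>a1 a2. sweedler K L P (\<lambda>l1 l2. tensor_lift K P f (ttens (pure a1 l1) (pure a2 l2))) l) a"
    by (rule sweedler_cong[OF HL P a]; (rule linear_sweedler_commute[OF LL D P g] r | assumption)+)
  also have "\<dots> = sweedler K H P (\<lambda>a1 a2. sweedler K L P (\<lambda>l1 l2. f (pure a1 l1) (pure a2 l2)) l) a"
    by (rule sweedler_cong[OF HL P a] sweedler_cong[OF LL P l] gt r | assumption)+
  finally show ?thesis .
qed

text \<open>
  A Sweedler sum over \<open>a \<otimes> l\<close> is an iterated Sweedler sum over \<open>a\<close> and \<open>l\<close>. After reordering the sums,
  the coassociativity of both factors applies.
\<close>

lemma smash_sweedler_coassoc:
  assumes P: "module K P" and s: "s \<in> carrier \<S>"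
    and F: "\<And>v w. v \<in> carrier \<S> \<Longrightarrow> w \<in> carrier \<S> \<Longrightarrow> linear_map K \<S> P (\<lambda>u. F u v w)"
      "\<And>u w. u \<in> carrier \<S> \<Longrightarrow> w \<in> carrier \<S> \<Longrightarrow> linear_map K \<S> P (\<lambda>v. F u v w)"
      "\<And>u v. u \<in> carrier \<S> \<Longrightarrow> v \<in> carrier \<S> \<Longrightarrow> linear_map K \<S> P (\<lambda>w. F u v w)"
  shows "sweedler K \<S> P (\<lambda>y z. sweedler K \<S> P (\<lambda>u v. F u v z) y) s =
    sweedler K \<S> P (\<lambda>y z. sweedler K \<S> P (\<lambda>u v. F y u v) z) s"
proof (rule smash_ext[OF P _ _ s])
  let ?h = "sweedler K H P" and ?l = "sweedler K L P"
  note r = P linear_comp[OF F(1)] linear_comp[OF F(2)] linear_comp[OF F(3)] smash_linear_comul S_rules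
  show "linear_map K \<S> P (sweedler K \<S> P (\<lambda>y z. sweedler K \<S> P (\<lambda>u v. F u v z) y))"
    by (rule linear_sweedler[OF smash_linear_comul P _ linear_ident]) (rule r | assumption)+
  show "linear_map K \<S> P (sweedler K \<S> P (\<lambda>y z. sweedler K \<S> P (\<lambda>u v. F y u v) z))"
    by (rule linear_sweedler[OF smash_linear_comul P _ linear_ident]) (rule r | assumption)+
  fix a l assume a: "a \<in> carrier H" and l: "l \<in> carrier L"
  note r = a l r
  let ?E = "\<lambda>b c d m n k. F (pure b m) (pure c n) (pure d k)"
  have "sweedler K \<S> P (\<lambda>y z. sweedler K \<S> P (\<lambda>u v. F u v z) y) (pure a l) =
      ?h (\<lambda>x d. ?l (\<lambda>y k. sweedler K \<S> P (\<lambda>u v. F u v (pure d k)) (pure x y)) l) a"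
    by (rule sweedler_pure[OF P _ a l]) (rule r | assumption)+
  also have "\<dots> = ?h (\<lambda>x d. ?l (\<lambda>y k. ?h (\<lambda>b c. ?l (\<lambda>m n. ?E b c d m n k) y) x) l) a"
    by (rule sweedler_cong[OF HL P a] sweedler_cong[OF LL P l] sweedler_pure[OF P] r | assumption)+
  also have "\<dots> = ?h (\<lambda>x d. ?h (\<lambda>b c. ?l (\<lambda>y k. ?l (\<lambda>m n. ?E b c d m n k) y) l) x) a"
    by (rule sweedler_cong[OF HL P a]; (rule sweedler_swap[OF LL HL P l] r l | assumption)+)
  also have "\<dots> = ?h (\<lambda>b x. ?h (\<lambda>c d. ?l (\<lambda>y k. ?l (\<lambda>m n. ?E b c d m n k) y) l) x) a"
    by (rule sweedler_coassoc[OF Hc P a]) (rule r l | assumption)+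
  also have "\<dots> = ?h (\<lambda>b x. ?h (\<lambda>c d. ?l (\<lambda>m y. ?l (\<lambda>n k. ?E b c d m n k) y) l) x) a"
    by (rule sweedler_coassoc[OF Lc P l] sweedler_cong[OF HL P] r a l | assumption)+
  also have "\<dots> = ?h (\<lambda>b x. ?l (\<lambda>m y. ?h (\<lambda>c d. ?l (\<lambda>n k. ?E b c d m n k) y) x) l) a"
    by (rule sweedler_cong[OF HL P a]; (rule sweedler_swap[OF HL LL P _ l] r l | assumption)+)
  also have "\<dots> = ?h (\<lambda>b x. ?l (\<lambda>m y. sweedler K \<S> P (\<lambda>u v. F (pure b m) u v) (pure x y)) l) a"
    by (rule sweedler_cong[OF HL P a] sweedler_cong[OF LL P l] sweedler_pure[OF P, symmetric] r | assumption)+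
  also have "\<dots> = sweedler K \<S> P (\<lambda>y z. sweedler K \<S> P (\<lambda>u v. F y u v) z) (pure a l)"
    by (rule sweedler_pure[OF P _ a l, symmetric]) (rule r | assumption)+
  finally show "sweedler K \<S> P (\<lambda>y z. sweedler K \<S> P (\<lambda>u v. F u v z) y) (pure a l) =
    sweedler K \<S> P (\<lambda>y z. sweedler K \<S> P (\<lambda>u v. F y u v) z) (pure a l)" .
qed

lemma smash_sweedler_counit:
  assumes s: "s \<in> carrier \<S>"
  shows "sweedler K \<S> \<S> (\<lambda>y z. counit \<S> y \<odot>\<^bsub>\<S>\<^esub> z) s = s" "sweedler K \<S> \<S> (\<lambda>y z. counit \<S> z \<odot>\<^bsub>\<S>\<^esub> y) s = s"
proof -
  interpret S: module K \<S> by (rule smash_module)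
  note Sm = smash_module
  note r = linear_comp[OF smash_counit_linear] smash_counit_closed smash_linear_comul S_rules
  have b: "bilinear_map K \<S> \<S> \<S> (\<lambda>y z. counit \<S> y \<odot>\<^bsub>\<S>\<^esub> z)" "bilinear_map K \<S> \<S> \<S> (\<lambda>y z. counit \<S> z \<odot>\<^bsub>\<S>\<^esub> y)"
    by (rule r | assumption)+
  note l = linear_sweedler[OF smash_linear_comul Sm b(1) linear_ident] linear_sweedler[OF smash_linear_comul Sm b(2) linear_ident]
  note cl = counit_closed[OF Hc] counit_closed[OF Lc]
  show "sweedler K \<S> \<S> (\<lambda>y z. counit \<S> y \<odot>\<^bsub>\<S>\<^esub> z) s = s"
  proof (rule smash_ext[OF Sm l(1) linear_ident s])
    fix a l assume a: "a \<in> carrier H" and l: "l \<in> carrier L"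
    have "sweedler K \<S> \<S> (\<lambda>y z. counit \<S> y \<odot>\<^bsub>\<S>\<^esub> z) (pure a l) =
        sweedler K H \<S> (\<lambda>a1 a2. sweedler K L \<S> (\<lambda>l1 l2. counit \<S> (pure a1 l1) \<odot>\<^bsub>\<S>\<^esub> pure a2 l2) l) a"
      by (rule sweedler_pure[OF Sm b(1) a l])
    also have "\<dots> = sweedler K H \<S> (\<lambda>a1 a2. sweedler K L \<S> (\<lambda>l1 l2. counit L l1 \<odot>\<^bsub>\<S>\<^esub> (counit H a1 \<odot>\<^bsub>\<S>\<^esub> pure a2 l2)) l) a"
      by (rule sweedler_cong[OF HL Sm a] sweedler_cong[OF LL Sm l] a l r | assumption
        | (simp only: smash_counit_pure cl pure_closed mh.L.R.m_comm S.smult_assoc1[symmetric]; fail))+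
    also have "\<dots> = sweedler K H \<S> (\<lambda>a1 a2. counit H a1 \<odot>\<^bsub>\<S>\<^esub> pure a2 l) a"
      by (rule sweedler_cong[OF HL Sm a]; (rule sweedler_counit_left[OF Lc Sm l] a l r | assumption)+)
    also have "\<dots> = pure a l" by (rule sweedler_counit_left[OF Hc Sm a]) (rule l r | assumption)+
    finally show "sweedler K \<S> \<S> (\<lambda>y z. counit \<S> y \<odot>\<^bsub>\<S>\<^esub> z) (pure a l) = pure a l" .
  qed
  show "sweedler K \<S> \<S> (\<lambda>y z. counit \<S> z \<odot>\<^bsub>\<S>\<^esub> y) s = s"
  proof (rule smash_ext[OF Sm l(2) linear_ident s])
    fix a l assume a: "a \<in> carrier H" and l: "l \<in> carrier L"
    have "sweedler K \<S> \<S> (\<lambda>y z. counit \<S> z \<odot>\<^bsub>\<S>\<^esub> y) (pure a l) =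
        sweedler K H \<S> (\<lambda>a1 a2. sweedler K L \<S> (\<lambda>l1 l2. counit \<S> (pure a2 l2) \<odot>\<^bsub>\<S>\<^esub> pure a1 l1) l) a"
      by (rule sweedler_pure[OF Sm b(2) a l])
    also have "\<dots> = sweedler K H \<S> (\<lambda>a1 a2. sweedler K L \<S> (\<lambda>l1 l2. counit L l2 \<odot>\<^bsub>\<S>\<^esub> (counit H a2 \<odot>\<^bsub>\<S>\<^esub> pure a1 l1)) l) a"
      by (rule sweedler_cong[OF HL Sm a] sweedler_cong[OF LL Sm l] a l r | assumption
        | (simp only: smash_counit_pure cl pure_closed mh.L.R.m_comm S.smult_assoc1[symmetric]; fail))+
    also have "\<dots> = sweedler K H \<S> (\<lambda>a1 a2. counit H a2 \<odot>\<^bsub>\<S>\<^esub> pure a1 l) a"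
      by (rule sweedler_cong[OF HL Sm a]; (rule sweedler_counit_right[OF Lc Sm l] a l r | assumption)+)
    also have "\<dots> = pure a l" by (rule sweedler_counit_right[OF Hc Sm a]) (rule l r | assumption)+
    finally show "sweedler K \<S> \<S> (\<lambda>y z. counit \<S> z \<odot>\<^bsub>\<S>\<^esub> y) (pure a l) = pure a l" .
  qed
qed

lemma smash_coalgebra: "coalgebra K \<S>"
proof (intro coalgebra.intro smash_module coalgebra_axioms.intro)
  note DD = tensor_module[OF tensor_module[OF smash_module smash_module] smash_module]
  note r = DD smash_linear_comul S_rules
  fix s assume s: "s \<in> carrier \<S>"
  show "sweedler K \<S> (tensor K \<D> \<S>) (\<lambda>y z. sweedler K \<S> (tensor K \<D> \<S>) (\<lambda>u v. tens K \<D> \<S> (ttens u v) z) y) s =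
    sweedler K \<S> (tensor K \<D> \<S>) (\<lambda>y z. sweedler K \<S> (tensor K \<D> \<S>) (\<lambda>u v. tens K \<D> \<S> (ttens y u) v) z) s"
    by (rule smash_sweedler_coassoc[OF DD s]) (rule r | assumption)+
qed (assumption | rule smash_comul_linear smash_counit_linear smash_sweedler_counit)+

section \<open>Compatibility of the smash product with its coproduct\<close>

lemma sweedler_act:
  assumes P: "module K P" and f: "bilinear_map K H H P f" and l: "l \<in> carrier L" and a: "a \<in> carrier H"
  shows "sweedler K H P f (act l a) =
    sweedler K L P (\<lambda>p q. sweedler K H P (\<lambda>a1 a2. f (act p a1) (act q a2)) a) l"
proof -
  note D = tensor_module[OF Hm Hm]
  note g = tensor_lift_linear[OF Hm Hm P f] and gt = tensor_lift_tens[OF Hm Hm P f]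
  note r = a l P D linear_comp[OF g] linear_comp[OF bilinear_mapD(1)[OF f]] linear_comp[OF bilinear_mapD(2)[OF f]] S_rules
  have "sweedler K H P f (act l a) = tensor_lift K P f (sweedler K L (tensor K H H) (\<lambda>p q.
      sweedler K H (tensor K H H) (\<lambda>a1 a2. tens K H H (act p a1) (act q a2)) a) l)"
    unfolding sweedler_def[of K H P f] mh.act_comul[OF l a] by (rule refl)
  also have "\<dots> = sweedler K L P (\<lambda>p q. tensor_lift K P f
      (sweedler K H (tensor K H H) (\<lambda>a1 a2. tens K H H (act p a1) (act q a2)) a)) l"
    by (rule linear_sweedler_commute[OF LL D P g _ l]) (rule r | assumption)+
  also have "\<dots> = sweedler K L P (\<lambda>p q. sweedler K H P (\<lambda>a1 a2. tensor_lift K P f (tens K H H (act p a1) (act q a2))) a) l"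
    by (rule sweedler_cong[OF LL P l]; (rule linear_sweedler_commute[OF HL D P g] r | assumption)+)
  also have "\<dots> = sweedler K L P (\<lambda>p q. sweedler K H P (\<lambda>a1 a2. f (act p a1) (act q a2)) a) l"
    by (rule sweedler_cong[OF LL P l] sweedler_cong[OF HL P a] gt r | assumption)+
  finally show ?thesis .
qed

lemmas D_mod = tensor_module[OF smash_module smash_module]

abbreviation (input) "\<P> \<equiv> tensor_algebra_prod K \<S> \<S>"

lemma double_mult_linear1: "linear_map K Q \<D> f \<Longrightarrow> t \<in> carrier \<D> \<Longrightarrow> linear_map K Q \<D> (\<lambda>x. f x \<otimes>\<^bsub>\<P>\<^esub> t)"
  and double_mult_linear2: "linear_map K Q \<D> f \<Longrightarrow> t \<in> carrier \<D> \<Longrightarrow> linear_map K Q \<D> (\<lambda>x. t \<otimes>\<^bsub>\<P>\<^esub> f x)"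
  using linear_comp[OF bilinear_mapD(2)[OF tensor_algebra_mult_bilinear(1)[OF smash_assoc_algebra smash_assoc_algebra]]]
    linear_comp[OF bilinear_mapD(1)[OF tensor_algebra_mult_bilinear(1)[OF smash_assoc_algebra smash_assoc_algebra]]] by blast+

lemma ttens_mult: "\<lbrakk>s \<in> carrier \<S>; t \<in> carrier \<S>; s' \<in> carrier \<S>; t' \<in> carrier \<S>\<rbrakk> \<Longrightarrow>
    ttens s t \<otimes>\<^bsub>\<P>\<^esub> ttens s' t' = ttens (s \<star> s') (t \<star> t')"
  by (rule tensor_algebra_mult_bilinear(2)[OF smash_assoc_algebra smash_assoc_algebra])

lemmas double_rules = D_mod double_mult_linear1 double_mult_linear2 linear_comp[OF smash_comul_linear]
  linear_map_closed[OF smash_comul_linear] tensor_algebra_prod_mult_closed[OF smash_assoc_algebra smash_assoc_algebra] S_rules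

text \<open>
  Since \<open>a \<otimes> l\<close> is the product of \<open>a \<otimes> 1\<close> and \<open>1 \<otimes> l\<close>, multiplicativity of the coproduct only needs to be verified for
  left factors of these two kinds.
\<close>

lemma smash_comul_left:
  assumes a: "a \<in> carrier H" and t: "t \<in> carrier \<S>"
  shows "comul \<S> (pure a \<one>\<^bsub>L\<^esub> \<star> t) = comul \<S> (pure a \<one>\<^bsub>L\<^esub>) \<otimes>\<^bsub>\<P>\<^esub> comul \<S> t"
proof (rule smash_ext[OF D_mod _ _ t])
  note r = a mh.L.one_closed double_rules
  show "linear_map K \<S> \<D> (\<lambda>t. comul \<S> (pure a \<one>\<^bsub>L\<^esub> \<star> t))" by (rule r | assumption)+
  show "linear_map K \<S> \<D> (\<lambda>t. comul \<S> (pure a \<one>\<^bsub>L\<^esub>) \<otimes>\<^bsub>\<P>\<^esub> comul \<S> t)"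
    by (rule smash_comul_linear r | assumption)+
  fix b m assume b: "b \<in> carrier H" and m: "m \<in> carrier L"
  note r = b m r
  let ?h = "sweedler K H \<D>" and ?l = "sweedler K L \<D>"
  let ?E = "\<lambda>a1 a2 b1 b2 m1 m2. ttens (pure (a1 \<otimes>\<^bsub>H\<^esub> b1) m1) (pure (a2 \<otimes>\<^bsub>H\<^esub> b2) m2)"
  have "comul \<S> (pure a \<one>\<^bsub>L\<^esub> \<star> pure b m) = comul \<S> (pure (a \<otimes>\<^bsub>H\<^esub> b) m)"
    by (simp only: smash_one_left a b m)
  also have "\<dots> = ?h (\<lambda>x y. ?l (\<lambda>m1 m2. ttens (pure x m1) (pure y m2)) m) (a \<otimes>\<^bsub>H\<^esub> b)"
    by (rule smash_comul_pure) (rule r | assumption)+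
  also have "\<dots> = ?h (\<lambda>a1 a2. ?h (\<lambda>b1 b2. ?l (\<lambda>m1 m2. ?E a1 a2 b1 b2 m1 m2) m) b) a"
    by (rule sweedler_mult[OF Hb D_mod _ a b]) (rule r | assumption)+
  finally have 1: "comul \<S> (pure a \<one>\<^bsub>L\<^esub> \<star> pure b m) =
    ?h (\<lambda>a1 a2. ?h (\<lambda>b1 b2. ?l (\<lambda>m1 m2. ?E a1 a2 b1 b2 m1 m2) m) b) a" .
  let ?d = "?h (\<lambda>b1 b2. ?l (\<lambda>m1 m2. ttens (pure b1 m1) (pure b2 m2)) m) b"
  have dc: "?d \<in> carrier \<D>" by (rule r | assumption)+
  have eq: "ttens (pure a1 \<one>\<^bsub>L\<^esub>) (pure a2 \<one>\<^bsub>L\<^esub>) \<otimes>\<^bsub>\<P>\<^esub> ?d = ?h (\<lambda>b1 b2. ?l (\<lambda>m1 m2. ?E a1 a2 b1 b2 m1 m2) m) b"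
    if aa: "a1 \<in> carrier H" "a2 \<in> carrier H" for a1 a2
  proof -
    let ?X = "ttens (pure a1 \<one>\<^bsub>L\<^esub>) (pure a2 \<one>\<^bsub>L\<^esub>)"
    have "?X \<otimes>\<^bsub>\<P>\<^esub> ?d = ?h (\<lambda>b1 b2. ?X \<otimes>\<^bsub>\<P>\<^esub> ?l (\<lambda>m1 m2. ttens (pure b1 m1) (pure b2 m2)) m) b"
      by (rule linear_sweedler_commute[OF HL D_mod D_mod _ _ b]) (rule aa r | assumption)+
    also have "\<dots> = ?h (\<lambda>b1 b2. ?l (\<lambda>m1 m2. ?X \<otimes>\<^bsub>\<P>\<^esub> ttens (pure b1 m1) (pure b2 m2)) m) b"
      by (rule sweedler_cong[OF HL D_mod b]; (rule linear_sweedler_commute[OF LL D_mod D_mod] aa r | assumption)+)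
    also have "\<dots> = ?h (\<lambda>b1 b2. ?l (\<lambda>m1 m2. ?E a1 a2 b1 b2 m1 m2) m) b"
      by (rule sweedler_cong[OF HL D_mod b] sweedler_cong[OF LL D_mod m] aa r | assumption
        | (simp only: ttens_mult pure_closed smash_one_left aa mh.L.one_closed; fail))+
    finally show ?thesis .
  qed
  have "comul \<S> (pure a \<one>\<^bsub>L\<^esub>) = ?h (\<lambda>a1 a2. ?l (\<lambda>m1 m2. ttens (pure a1 m1) (pure a2 m2)) \<one>\<^bsub>L\<^esub>) a"
    by (rule smash_comul_pure[OF a mh.L.one_closed])
  also have "\<dots> = ?h (\<lambda>a1 a2. ttens (pure a1 \<one>\<^bsub>L\<^esub>) (pure a2 \<one>\<^bsub>L\<^esub>)) a"
    by (rule sweedler_cong[OF HL D_mod a]; (rule sweedler_one[OF Lb D_mod] r | assumption)+)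
  finally have "comul \<S> (pure a \<one>\<^bsub>L\<^esub>) \<otimes>\<^bsub>\<P>\<^esub> comul \<S> (pure b m) =
      ?h (\<lambda>a1 a2. ttens (pure a1 \<one>\<^bsub>L\<^esub>) (pure a2 \<one>\<^bsub>L\<^esub>)) a \<otimes>\<^bsub>\<P>\<^esub> ?d"
    by (simp only: smash_comul_pure[OF b m])
  also have "\<dots> = ?h (\<lambda>a1 a2. ttens (pure a1 \<one>\<^bsub>L\<^esub>) (pure a2 \<one>\<^bsub>L\<^esub>) \<otimes>\<^bsub>\<P>\<^esub> ?d) a"
    by (rule linear_sweedler_commute[OF HL D_mod D_mod, where g = "\<lambda>z. z \<otimes>\<^bsub>\<P>\<^esub> ?d"]) (rule dc r | assumption)+
  also have "\<dots> = ?h (\<lambda>a1 a2. ?h (\<lambda>b1 b2. ?l (\<lambda>m1 m2. ?E a1 a2 b1 b2 m1 m2) m) b) a"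
    by (rule sweedler_cong[OF HL D_mod a]; (rule eq dc r | assumption)+)
  finally show "comul \<S> (pure a \<one>\<^bsub>L\<^esub> \<star> pure b m) = comul \<S> (pure a \<one>\<^bsub>L\<^esub>) \<otimes>\<^bsub>\<P>\<^esub> comul \<S> (pure b m)"
    using 1 by simp
qed

text \<open>
  The coproduct of \<open>(1 \<otimes> l) (b \<otimes> m)\<close> involves the fourfold coproduct of \<open>l\<close> with its first two factors acting on
  \<open>b\<^sub>1\<close> and \<open>b\<^sub>2\<close>, while in the product of the coproducts the first and third factors do so. This is where
  cocommutativity enters.
\<close>

lemma smash_comul_right:
  assumes coc: "cocommutative K L" and l: "l \<in> carrier L" and t: "t \<in> carrier \<S>"
  shows "comul \<S> (pure \<one>\<^bsub>H\<^esub> l \<star> t) = comul \<S> (pure \<one>\<^bsub>H\<^esub> l) \<otimes>\<^bsub>\<P>\<^esub> comul \<S> t"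
proof (rule smash_ext[OF D_mod _ _ t])
  note r = l mh.H.one_closed double_rules
  show "linear_map K \<S> \<D> (\<lambda>t. comul \<S> (pure \<one>\<^bsub>H\<^esub> l \<star> t))" by (rule r | assumption)+
  show "linear_map K \<S> \<D> (\<lambda>t. comul \<S> (pure \<one>\<^bsub>H\<^esub> l) \<otimes>\<^bsub>\<P>\<^esub> comul \<S> t)"
    by (rule smash_comul_linear r | assumption)+
  fix b m assume b: "b \<in> carrier H" and m: "m \<in> carrier L"
  note r = b m r
  let ?h = "sweedler K H \<D>" and ?l = "sweedler K L \<D>"
  let ?E = "\<lambda>p q u v b1 b2 m1 m2. ttens (pure (act p b1) (u \<otimes>\<^bsub>L\<^esub> m1)) (pure (act q b2) (v \<otimes>\<^bsub>L\<^esub> m2))"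
  have pure1: "pure \<one>\<^bsub>H\<^esub> x \<star> pure c n = sweedler K L \<S> (\<lambda>p u. pure (act p c) (u \<otimes>\<^bsub>L\<^esub> n)) x"
    if c: "x \<in> carrier L" "c \<in> carrier H" "n \<in> carrier L" for x c n
  proof -
    have "pure \<one>\<^bsub>H\<^esub> x \<star> pure c n = sweedler K L \<W> (\<lambda>p u. pure (\<one>\<^bsub>H\<^esub> \<otimes>\<^bsub>H\<^esub> act p c) (u \<otimes>\<^bsub>L\<^esub> n)) x"
      by (rule smash_mult_pure[OF mh.H.one_closed c])
    also have "\<dots> = sweedler K L \<W> (\<lambda>p u. pure (act p c) (u \<otimes>\<^bsub>L\<^esub> n)) x"
      by (rule sweedler_cong[OF LL Tm c(1)] c mh.H.one_closed basic_rules | assumption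
        | (simp only: mh.H.l_one act_closed c; fail))+
    also have "\<dots> = sweedler K L \<S> (\<lambda>p u. pure (act p c) (u \<otimes>\<^bsub>L\<^esub> n)) x"
    \<comment> \<open>The two records have the same module structure, so the identity is linear between them.\<close>
    proof (rule linear_sweedler_commute[OF LL Tm smash_module, where g = "\<lambda>x. x"])
      show "linear_map K \<W> \<S> (\<lambda>x. x)" unfolding linear_map_smash by (rule linear_ident)
    qed (rule c basic_rules | assumption)+
    finally show ?thesis .
  qed
  have 1: "comul \<S> (pure (act x b) (y \<otimes>\<^bsub>L\<^esub> m)) =
      ?l (\<lambda>p q. ?l (\<lambda>u v. ?h (\<lambda>b1 b2. ?l (\<lambda>m1 m2. ?E p q u v b1 b2 m1 m2) m) b) y) x"
    if xy: "x \<in> carrier L" "y \<in> carrier L" for x y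
  proof -
    note r = xy r
    have "comul \<S> (pure (act x b) (y \<otimes>\<^bsub>L\<^esub> m)) =
        ?h (\<lambda>h k. ?l (\<lambda>u v. ttens (pure h u) (pure k v)) (y \<otimes>\<^bsub>L\<^esub> m)) (act x b)"
      by (rule smash_comul_pure) (rule r | assumption)+
    also have "\<dots> = ?l (\<lambda>p q. ?h (\<lambda>b1 b2. ?l (\<lambda>u v. ttens (pure (act p b1) u) (pure (act q b2) v)) (y \<otimes>\<^bsub>L\<^esub> m)) b) x"
      by (rule sweedler_act[OF D_mod _ xy(1) b]) (rule r | assumption)+
    also have "\<dots> = ?l (\<lambda>p q. ?h (\<lambda>b1 b2. ?l (\<lambda>u v. ?l (\<lambda>m1 m2. ?E p q u v b1 b2 m1 m2) m) y) b) x"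
      by (rule sweedler_cong[OF LL D_mod xy(1)] sweedler_cong[OF HL D_mod b] sweedler_mult[OF Lb D_mod] r | assumption)+
    also have "\<dots> = ?l (\<lambda>p q. ?l (\<lambda>u v. ?h (\<lambda>b1 b2. ?l (\<lambda>m1 m2. ?E p q u v b1 b2 m1 m2) m) b) y) x"
      by (rule sweedler_cong[OF LL D_mod xy(1)]; (rule sweedler_swap[OF HL LL D_mod b xy(2)] r | assumption)+)
    finally show ?thesis .
  qed
  have 2: "ttens (pure \<one>\<^bsub>H\<^esub> x) (pure \<one>\<^bsub>H\<^esub> y) \<otimes>\<^bsub>\<P>\<^esub> comul \<S> (pure b m) =
      ?l (\<lambda>p u. ?l (\<lambda>q v. ?h (\<lambda>b1 b2. ?l (\<lambda>m1 m2. ?E p q u v b1 b2 m1 m2) m) b) y) x"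
    if xy: "x \<in> carrier L" "y \<in> carrier L" for x y
  proof -
    note r = xy r
    let ?X = "ttens (pure \<one>\<^bsub>H\<^esub> x) (pure \<one>\<^bsub>H\<^esub> y)"
    have eq: "?X \<otimes>\<^bsub>\<P>\<^esub> ttens (pure b1 m1) (pure b2 m2) = ?l (\<lambda>p u. ?l (\<lambda>q v. ?E p q u v b1 b2 m1 m2) y) x"
      if c: "b1 \<in> carrier H" "b2 \<in> carrier H" "m1 \<in> carrier L" "m2 \<in> carrier L" for b1 b2 m1 m2
    proof -
      note r = c r
      let ?B = "sweedler K L \<S> (\<lambda>q v. pure (act q b2) (v \<otimes>\<^bsub>L\<^esub> m2)) y"
      have B: "?B \<in> carrier \<S>" by (rule r | assumption)+
      have "?X \<otimes>\<^bsub>\<P>\<^esub> ttens (pure b1 m1) (pure b2 m2) =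
          ttens (sweedler K L \<S> (\<lambda>p u. pure (act p b1) (u \<otimes>\<^bsub>L\<^esub> m1)) x) ?B"
        by (simp only: ttens_mult pure_closed mh.H.one_closed xy c pure1)
      also have "\<dots> = ?l (\<lambda>p u. ttens (pure (act p b1) (u \<otimes>\<^bsub>L\<^esub> m1)) ?B) x"
        by (rule linear_sweedler_commute[OF LL smash_module D_mod, where g = "\<lambda>z. ttens z ?B"]) (rule B r | assumption)+
      also have "\<dots> = ?l (\<lambda>p u. ?l (\<lambda>q v. ?E p q u v b1 b2 m1 m2) y) x"
        by (rule sweedler_cong[OF LL D_mod xy(1)];
            (rule linear_sweedler_commute[OF LL smash_module D_mod] B r | assumption)+)
      finally show ?thesis .
    qed
    have "?X \<otimes>\<^bsub>\<P>\<^esub> comul \<S> (pure b m) = ?h (\<lambda>b1 b2. ?X \<otimes>\<^bsub>\<P>\<^esub> ?l (\<lambda>m1 m2. ttens (pure b1 m1) (pure b2 m2)) m) b"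
      unfolding smash_comul_pure[OF b m]
      by (rule linear_sweedler_commute[OF HL D_mod D_mod]) (rule r | assumption)+
    also have "\<dots> = ?h (\<lambda>b1 b2. ?l (\<lambda>m1 m2. ?X \<otimes>\<^bsub>\<P>\<^esub> ttens (pure b1 m1) (pure b2 m2)) m) b"
      by (rule sweedler_cong[OF HL D_mod b]; (rule linear_sweedler_commute[OF LL D_mod D_mod] r | assumption)+)
    also have "\<dots> = ?h (\<lambda>b1 b2. ?l (\<lambda>m1 m2. ?l (\<lambda>p u. ?l (\<lambda>q v. ?E p q u v b1 b2 m1 m2) y) x) m) b"
      by (rule sweedler_cong[OF HL D_mod b] sweedler_cong[OF LL D_mod m] eq r | assumption)+
    also have "\<dots> = ?h (\<lambda>b1 b2. ?l (\<lambda>p u. ?l (\<lambda>m1 m2. ?l (\<lambda>q v. ?E p q u v b1 b2 m1 m2) y) m) x) b"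
      by (rule sweedler_cong[OF HL D_mod b]; (rule sweedler_swap[OF LL LL D_mod m xy(1)] r | assumption)+)
    also have "\<dots> = ?h (\<lambda>b1 b2. ?l (\<lambda>p u. ?l (\<lambda>q v. ?l (\<lambda>m1 m2. ?E p q u v b1 b2 m1 m2) m) y) x) b"
      by (rule sweedler_cong[OF HL D_mod b] sweedler_swap[OF LL LL D_mod m xy(2)] sweedler_cong[OF LL D_mod xy(1)] r | assumption)+
    also have "\<dots> = ?l (\<lambda>p u. ?h (\<lambda>b1 b2. ?l (\<lambda>q v. ?l (\<lambda>m1 m2. ?E p q u v b1 b2 m1 m2) m) y) b) x"
      by (rule sweedler_swap[OF HL LL D_mod b xy(1)]) (rule r | assumption)+
    also have "\<dots> = ?l (\<lambda>p u. ?l (\<lambda>q v. ?h (\<lambda>b1 b2. ?l (\<lambda>m1 m2. ?E p q u v b1 b2 m1 m2) m) b) y) x"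
      by (rule sweedler_cong[OF LL D_mod xy(1)]; (rule sweedler_swap[OF HL LL D_mod b xy(2)] r | assumption)+)
    finally show ?thesis .
  qed
  have "comul \<S> (pure \<one>\<^bsub>H\<^esub> l \<star> pure b m) = ?l (\<lambda>x y. comul \<S> (pure (act x b) (y \<otimes>\<^bsub>L\<^esub> m))) l"
    unfolding pure1[OF l b m]
    by (rule linear_sweedler_commute[OF LL smash_module D_mod smash_comul_linear _ l]) (rule r | assumption)+
  also have "\<dots> = ?l (\<lambda>x y. ?l (\<lambda>p q. ?l (\<lambda>u v. ?h (\<lambda>b1 b2. ?l (\<lambda>m1 m2. ?E p q u v b1 b2 m1 m2) m) b) y) x) l"
    by (rule sweedler_cong[OF LL D_mod l]; (rule 1 r | assumption)+)
  also have "\<dots> = ?l (\<lambda>x y. ?l (\<lambda>p u. ?l (\<lambda>q v. ?h (\<lambda>b1 b2. ?l (\<lambda>m1 m2. ?E p q u v b1 b2 m1 m2) m) b) y) x) l"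
    by (rule sweedler_middle_swap[OF Lc coc D_mod l]) (rule r | assumption)+
  also have "\<dots> = ?l (\<lambda>x y. ttens (pure \<one>\<^bsub>H\<^esub> x) (pure \<one>\<^bsub>H\<^esub> y) \<otimes>\<^bsub>\<P>\<^esub> comul \<S> (pure b m)) l"
    by (rule sweedler_cong[OF LL D_mod l]; (rule 2[symmetric] r | assumption)+)
  also have "\<dots> = ?l (\<lambda>x y. ttens (pure \<one>\<^bsub>H\<^esub> x) (pure \<one>\<^bsub>H\<^esub> y)) l \<otimes>\<^bsub>\<P>\<^esub> comul \<S> (pure b m)"
    by (rule linear_sweedler_commute[OF LL D_mod D_mod, where g = "\<lambda>z. z \<otimes>\<^bsub>\<P>\<^esub> comul \<S> (pure b m)", symmetric])
      (rule r | assumption)+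
  also have "?l (\<lambda>x y. ttens (pure \<one>\<^bsub>H\<^esub> x) (pure \<one>\<^bsub>H\<^esub> y)) l = comul \<S> (pure \<one>\<^bsub>H\<^esub> l)"
  proof -
    have "bilinear_map K H H \<D> (\<lambda>a1 a2. ?l (\<lambda>l1 l2. ttens (pure a1 l1) (pure a2 l2)) l)"
      by (rule r | assumption)+
    then show ?thesis
      unfolding smash_comul_pure[OF mh.H.one_closed l] by (rule sweedler_one[OF Hb D_mod, symmetric])
  qed
  finally show "comul \<S> (pure \<one>\<^bsub>H\<^esub> l \<star> pure b m) = comul \<S> (pure \<one>\<^bsub>H\<^esub> l) \<otimes>\<^bsub>\<P>\<^esub> comul \<S> (pure b m)" .
qed

lemma smash_bialgebra:
  assumes coc: "cocommutative K L"
  shows "bialgebra K \<S>"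
proof (intro bialgebra.intro smash_assoc_algebra smash_coalgebra bialgebra_axioms.intro)
  interpret S: assoc_algebra K \<S> by (rule smash_assoc_algebra)
  interpret P: assoc_algebra K \<P> by (rule tensor_algebra_prod_assoc_algebra[OF smash_assoc_algebra smash_assoc_algebra])
  note one = mh.H.one_closed mh.L.one_closed
  have Dc: "comul \<S> s \<in> carrier \<P>" if "s \<in> carrier \<S>" for s
    using linear_map_closed[OF smash_comul_linear that] by (simp only: tensor_algebra_prod_simps)
  fix s t assume s: "s \<in> carrier \<S>" and t: "t \<in> carrier \<S>"
  note mc = S.m_closed
  show "comul \<S> (s \<star> t) = comul \<S> s \<otimes>\<^bsub>\<P>\<^esub> comul \<S> t"
  proof (rule smash_ext[OF D_mod _ _ s])
    show "linear_map K \<S> \<D> (\<lambda>s. comul \<S> (s \<star> t))" by (rule t double_rules | assumption)+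
    show "linear_map K \<S> \<D> (\<lambda>s. comul \<S> s \<otimes>\<^bsub>\<P>\<^esub> comul \<S> t)" by (rule smash_comul_linear t double_rules | assumption)+
    fix a l assume a: "a \<in> carrier H" and l: "l \<in> carrier L"
    have al: "pure a l = pure a \<one>\<^bsub>L\<^esub> \<star> pure \<one>\<^bsub>H\<^esub> l"
      by (simp only: smash_one_left a l one mh.H.r_one)
    note c = pure_closed[OF a one(2)] pure_closed[OF one(1) l]
    have "comul \<S> (pure a l \<star> t) = comul \<S> (pure a \<one>\<^bsub>L\<^esub> \<star> (pure \<one>\<^bsub>H\<^esub> l \<star> t))"
      by (simp only: al S.m_assoc c t)
    also have "\<dots> = comul \<S> (pure a \<one>\<^bsub>L\<^esub>) \<otimes>\<^bsub>\<P>\<^esub> (comul \<S> (pure \<one>\<^bsub>H\<^esub> l) \<otimes>\<^bsub>\<P>\<^esub> comul \<S> t)"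
      by (simp only: smash_comul_left[OF a mc[OF c(2) t]] smash_comul_right[OF coc l t])
    also have "\<dots> = (comul \<S> (pure a \<one>\<^bsub>L\<^esub>) \<otimes>\<^bsub>\<P>\<^esub> comul \<S> (pure \<one>\<^bsub>H\<^esub> l)) \<otimes>\<^bsub>\<P>\<^esub> comul \<S> t"
      by (rule P.m_assoc[OF Dc[OF c(1)] Dc[OF c(2)] Dc[OF t], symmetric])
    also have "\<dots> = comul \<S> (pure a l) \<otimes>\<^bsub>\<P>\<^esub> comul \<S> t"
      by (simp only: al smash_comul_left[OF a c(2)])
    finally show "comul \<S> (pure a l \<star> t) = comul \<S> (pure a l) \<otimes>\<^bsub>\<P>\<^esub> comul \<S> t" .
  qed
  show "counit \<S> (s \<star> t) = counit \<S> s \<otimes>\<^bsub>K\<^esub> counit \<S> t"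
  proof (rule smash_ext[OF self_module_module[OF KK] _ _ s])
    note r = linear_comp[OF smash_counit_linear] smash_counit_linear smash_counit_closed S_rules
    show "linear_map K \<S> (self_module K) (\<lambda>s. counit \<S> (s \<star> t))" by (rule t r | assumption)+
    show "linear_map K \<S> (self_module K) (\<lambda>s. counit \<S> s \<otimes>\<^bsub>K\<^esub> counit \<S> t)" by (rule t r | assumption)+
    fix a l assume a: "a \<in> carrier H" and l: "l \<in> carrier L"
    show "counit \<S> (pure a l \<star> t) = counit \<S> (pure a l) \<otimes>\<^bsub>K\<^esub> counit \<S> t"
    proof (rule smash_ext[OF self_module_module[OF KK] _ _ t])
      note r = a l r
      show "linear_map K \<S> (self_module K) (\<lambda>t. counit \<S> (pure a l \<star> t))" by (rule r | assumption)+
      show "linear_map K \<S> (self_module K) (\<lambda>t. counit \<S> (pure a l) \<otimes>\<^bsub>K\<^esub> counit \<S> t)" by (rule r | assumption)+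
      fix b m assume b: "b \<in> carrier H" and m: "m \<in> carrier L"
      note r = b m self_module_module[OF KK] r
      note cl = counit_closed[OF Hc] counit_closed[OF Lc]
      let ?f = "\<lambda>l. (counit H a \<otimes>\<^bsub>K\<^esub> counit L l) \<otimes>\<^bsub>K\<^esub> (counit H b \<otimes>\<^bsub>K\<^esub> counit L m)"
      have "counit \<S> (pure a l \<star> pure b m) =
          sweedler K L (self_module K) (\<lambda>l1 l2. counit \<S> (pure (a \<otimes>\<^bsub>H\<^esub> act l1 b) (l2 \<otimes>\<^bsub>L\<^esub> m))) l"
        unfolding smash_mult_pure[OF a l b m]
        by (rule linear_sweedler_commute[OF LL Tm self_module_module[OF KK] smash_counit_linear[unfolded linear_map_smash] _ l])
          (rule a l b m basic_rules | assumption)+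
      also have "\<dots> = sweedler K L (self_module K) (\<lambda>l1 l2. counit L l1 \<odot>\<^bsub>self_module K\<^esub> ?f l2) l"
        by (rule sweedler_cong[OF LL self_module_module[OF KK] l] r | assumption
          | (simp only: smash_counit_pure a b m cl act_closed mh.H.m_closed mh.L.m_closed mh.H.counit_mult mh.L.counit_mult
              mh.act_counit self_module_simps mh.L.R.m_closed mh.L.R.m_ac; fail))+
      also have "\<dots> = ?f l"
        by (rule sweedler_counit_left[OF Lc self_module_module[OF KK] l])
          (rule r scalar_mult_closed[OF KK] cl a b m | assumption)+
      finally show "counit \<S> (pure a l \<star> pure b m) = counit \<S> (pure a l) \<otimes>\<^bsub>K\<^esub> counit \<S> (pure b m)"
        by (simp only: smash_counit_pure a l b m)
    qed
  qed
next
  note one = mh.H.one_closed mh.L.one_closed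
  have "bilinear_map K H H \<D> (\<lambda>a1 a2. sweedler K L \<D> (\<lambda>l1 l2. ttens (pure a1 l1) (pure a2 l2)) \<one>\<^bsub>L\<^esub>)"
    by (rule one double_rules | assumption)+
  note 1 = sweedler_one[OF Hb D_mod this]
  have "bilinear_map K L L \<D> (\<lambda>l1 l2. ttens (pure \<one>\<^bsub>H\<^esub> l1) (pure \<one>\<^bsub>H\<^esub> l2))"
    by (rule one double_rules | assumption)+
  note 2 = sweedler_one[OF Lb D_mod this]
  show "comul \<S> \<one>\<^bsub>\<S>\<^esub> = \<one>\<^bsub>\<P>\<^esub>"
    by (simp only: smash_simps tensor_algebra_prod_simps smash_comul_pure[OF one] 1 2)
  show "counit \<S> \<one>\<^bsub>\<S>\<^esub> = \<one>\<^bsub>K\<^esub>"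
    by (simp only: smash_simps smash_counit_pure[OF one] mh.H.counit_one mh.L.counit_one mh.L.R.l_one mh.L.R.one_closed)
qed

section \<open>The antipode of the smash product\<close>

text \<open>An inverse is the tensor product of the inverse maps, which are linear.\<close>

lemma smash_tensor_maps_bij:
  assumes f: "linear_map K H H f" "bij_betw f (carrier H) (carrier H)"
    and g: "linear_map K L L g" "bij_betw g (carrier L) (carrier L)"
  shows "bij_betw (tensor_lift K \<S> (\<lambda>a l. pure (f a) (g l))) (carrier \<S>) (carrier \<S>)"
proof -
  have b: "bilinear_map K H L \<S> (\<lambda>a l. pure (f a) (g l))" if "linear_map K H H f" "linear_map K L L g" for f g
    by (rule that linear_map_closed[OF that(1)] linear_map_closed[OF that(2)] S_rules | assumption)+
  let ?f = "inv_into (carrier H) f" and ?g = "inv_into (carrier L) g"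
  have f': "linear_map K H H ?f" by (rule linear_map_inv_into[OF Hm f])
  have g': "linear_map K L L ?g" by (rule linear_map_inv_into[OF Lm g])
  note lf = smash_lift[OF smash_module b[OF f(1) g(1)]] and lg = smash_lift[OF smash_module b[OF f' g']]
  note c = linear_map_closed[OF f(1)] linear_map_closed[OF g(1)] linear_map_closed[OF f'] linear_map_closed[OF g']
  note inv = bij_betw_inv_into_left[OF f(2)] bij_betw_inv_into_right[OF f(2)]
    bij_betw_inv_into_left[OF g(2)] bij_betw_inv_into_right[OF g(2)]
  show ?thesis
  proof (rule bij_betw_byWitness[where f' = "tensor_lift K \<S> (\<lambda>a l. pure (?f a) (?g l))"]; (intro ballI image_subsetI)?)
    fix s assume s: "s \<in> carrier \<S>"
    show "tensor_lift K \<S> (\<lambda>a l. pure (?f a) (?g l)) (tensor_lift K \<S> (\<lambda>a l. pure (f a) (g l)) s) = s"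
      by (rule smash_ext[OF smash_module linear_comp[OF lg(1) lf(1)] linear_ident s]) (simp only: lf lg c inv)
    show "tensor_lift K \<S> (\<lambda>a l. pure (f a) (g l)) (tensor_lift K \<S> (\<lambda>a l. pure (?f a) (?g l)) s) = s"
      by (rule smash_ext[OF smash_module linear_comp[OF lf(1) lg(1)] linear_ident s]) (simp only: lf lg c inv)
    show "tensor_lift K \<S> (\<lambda>a l. pure (f a) (g l)) s \<in> carrier \<S>" by (rule linear_map_closed[OF lf(1) s])
    show "tensor_lift K \<S> (\<lambda>a l. pure (?f a) (?g l)) s \<in> carrier \<S>" by (rule linear_map_closed[OF lg(1) s])
  qed
qed

lemma unit_closed: "\<one>\<^bsub>H\<^esub> \<in> carrier H" "\<one>\<^bsub>L\<^esub> \<in> carrier L"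
  by (rule mh.H.one_closed mh.L.one_closed)+

lemma pure_smult1: "pure (k \<odot>\<^bsub>H\<^esub> a) l = k \<odot>\<^bsub>\<S>\<^esub> pure a l"
  and pure_smult2: "pure a (k \<odot>\<^bsub>L\<^esub> l) = k \<odot>\<^bsub>\<S>\<^esub> pure a l"
  if "k \<in> carrier K" "a \<in> carrier H" "l \<in> carrier L"
  using linear_map_smult[OF bilinear_mapD(2)[OF tens_bilinear[OF Hm Lm]]]
    linear_map_smult[OF bilinear_mapD(1)[OF tens_bilinear[OF Hm Lm]]] that
  by (simp_all only: smash_simps)

lemma pure_scalars:
  assumes "k \<in> carrier K" "k' \<in> carrier K"
  shows "pure (k \<odot>\<^bsub>H\<^esub> \<one>\<^bsub>H\<^esub>) (k' \<odot>\<^bsub>L\<^esub> \<one>\<^bsub>L\<^esub>) = (k \<otimes>\<^bsub>K\<^esub> k') \<odot>\<^bsub>\<S>\<^esub> \<one>\<^bsub>\<S>\<^esub>"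
  using assms by (simp only: pure_smult1 pure_smult2 unit_closed mh.L.smult_closed pure_closed smash_simps(5)
      module.smult_assoc1[OF smash_module])

text \<open>
  The antipode of the smash product sends \<open>a \<otimes> l\<close> to \<open>(1 \<otimes> \<psi> l) (\<chi> a \<otimes> 1)\<close>, where \<open>\<chi>\<close> and \<open>\<psi>\<close> are the
  antipodes of the two factors. It is therefore the composition of the bijection \<open>\<chi> \<otimes> \<psi>\<close> with the
  following linear map, and bijective as soon as that map is.
\<close>

definition smash_twist :: "('h \<times> 'l \<Rightarrow> 'k) set \<Rightarrow> ('h \<times> 'l \<Rightarrow> 'k) set"
  where "smash_twist = tensor_lift K \<S> (\<lambda>a l. pure \<one>\<^bsub>H\<^esub> l \<star> pure a \<one>\<^bsub>L\<^esub>)"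

lemma smash_twist_linear: "linear_map K \<S> \<S> smash_twist"
  and smash_twist_pure': "a \<in> carrier H \<Longrightarrow> l \<in> carrier L \<Longrightarrow>
    smash_twist (pure a l) = pure \<one>\<^bsub>H\<^esub> l \<star> pure a \<one>\<^bsub>L\<^esub>"
proof -
  have "bilinear_map K H L \<S> (\<lambda>a l. pure \<one>\<^bsub>H\<^esub> l \<star> pure a \<one>\<^bsub>L\<^esub>)" by (rule unit_closed S_rules | assumption)+
  note lift = smash_lift[OF smash_module this]
  show "linear_map K \<S> \<S> smash_twist" unfolding smash_twist_def by (rule lift)
  show "a \<in> carrier H \<Longrightarrow> l \<in> carrier L \<Longrightarrow> smash_twist (pure a l) = pure \<one>\<^bsub>H\<^esub> l \<star> pure a \<one>\<^bsub>L\<^esub>"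
    unfolding smash_twist_def by (rule lift)
qed

lemma smash_twist_pure:
  assumes c: "a \<in> carrier H" "l \<in> carrier L"
  shows "smash_twist (pure a l) = sweedler K L \<S> (\<lambda>p q. pure (act p a) q) l"
proof -
  have "smash_twist (pure a l) = sweedler K L \<W> (\<lambda>p q. pure (\<one>\<^bsub>H\<^esub> \<otimes>\<^bsub>H\<^esub> act p a) (q \<otimes>\<^bsub>L\<^esub> \<one>\<^bsub>L\<^esub>)) l"
    unfolding smash_twist_pure'[OF c] by (rule smash_mult_pure[OF unit_closed(1) c(2,1) unit_closed(2)])
  also have "\<dots> = sweedler K L \<W> (\<lambda>p q. pure (act p a) q) l"
    by (rule sweedler_cong[OF LL Tm c(2)] c unit_closed basic_rules | assumption
      | (simp only: mh.H.l_one mh.L.r_one act_closed c; fail))+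
  also have "\<dots> = sweedler K L \<S> (\<lambda>p q. pure (act p a) q) l"
  \<comment> \<open>The two records have the same module structure, so the identity is linear between them.\<close>
  proof (rule linear_sweedler_commute[OF LL Tm smash_module, where g = "\<lambda>x. x"])
    show "linear_map K \<W> \<S> (\<lambda>x. x)" unfolding linear_map_smash by (rule linear_ident)
  qed (rule c basic_rules | assumption)+
  finally show ?thesis .
qed

context
  fixes \<chi> :: "'h \<Rightarrow> 'h" and \<psi> :: "'l \<Rightarrow> 'l"
  assumes chi: "is_antipode K H \<chi>" and psi: "is_antipode K L \<psi>"
begin

lemma chi_linear: "linear_map K H H \<chi>" and psi_linear: "linear_map K L L \<psi>"
  using chi psi by (auto simp: is_antipode_def)

lemma chi_antipode:
  assumes "a \<in> carrier H"
  shows "sweedler K H H (\<lambda>y z. \<chi> y \<otimes>\<^bsub>H\<^esub> z) a = counit H a \<odot>\<^bsub>H\<^esub> \<one>\<^bsub>H\<^esub>"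
    and "sweedler K H H (\<lambda>y z. y \<otimes>\<^bsub>H\<^esub> \<chi> z) a = counit H a \<odot>\<^bsub>H\<^esub> \<one>\<^bsub>H\<^esub>"
  using chi assms by (auto simp: is_antipode_def)

lemma psi_antipode:
  assumes "l \<in> carrier L"
  shows "sweedler K L L (\<lambda>y z. \<psi> y \<otimes>\<^bsub>L\<^esub> z) l = counit L l \<odot>\<^bsub>L\<^esub> \<one>\<^bsub>L\<^esub>"
    and "sweedler K L L (\<lambda>y z. y \<otimes>\<^bsub>L\<^esub> \<psi> z) l = counit L l \<odot>\<^bsub>L\<^esub> \<one>\<^bsub>L\<^esub>"
  using psi assms by (auto simp: is_antipode_def)

lemmas chi_closed = linear_map_closed[OF chi_linear]
lemmas psi_closed = linear_map_closed[OF psi_linear]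
lemmas antipode_rules = chi_linear psi_linear chi_closed psi_closed linear_comp[OF chi_linear] linear_comp[OF psi_linear]
  unit_closed smash_linear_comul S_rules

lemma psi_bilinear: "bilinear_map K L L L (\<lambda>y z. \<psi> y \<otimes>\<^bsub>L\<^esub> z)" "bilinear_map K L L L (\<lambda>y z. y \<otimes>\<^bsub>L\<^esub> \<psi> z)"
  and psi_bilinear': "bilinear_map K L L L (\<lambda>z y. \<psi> y \<otimes>\<^bsub>L\<^esub> z)" "bilinear_map K L L L (\<lambda>z y. y \<otimes>\<^bsub>L\<^esub> \<psi> z)"
  by (rule antipode_rules | assumption)+

definition smash_antipode :: "('h \<times> 'l \<Rightarrow> 'k) set \<Rightarrow> ('h \<times> 'l \<Rightarrow> 'k) set"
  where "smash_antipode s = smash_twist (tensor_lift K \<S> (\<lambda>a l. pure (\<chi> a) (\<psi> l)) s)"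

lemma smash_antipode_linear: "linear_map K \<S> \<S> smash_antipode"
  and smash_antipode_pure: "a \<in> carrier H \<Longrightarrow> l \<in> carrier L \<Longrightarrow>
    smash_antipode (pure a l) = pure \<one>\<^bsub>H\<^esub> (\<psi> l) \<star> pure (\<chi> a) \<one>\<^bsub>L\<^esub>"
proof -
  have "bilinear_map K H L \<S> (\<lambda>a l. pure (\<chi> a) (\<psi> l))" by (rule antipode_rules | assumption)+
  note lift = smash_lift[OF smash_module this]
  show "linear_map K \<S> \<S> smash_antipode"
    unfolding smash_antipode_def by (rule linear_comp[OF smash_twist_linear lift(1)])
  show "a \<in> carrier H \<Longrightarrow> l \<in> carrier L \<Longrightarrow>
    smash_antipode (pure a l) = pure \<one>\<^bsub>H\<^esub> (\<psi> l) \<star> pure (\<chi> a) \<one>\<^bsub>L\<^esub>"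
    by (simp only: smash_antipode_def lift(2) smash_twist_pure' chi_closed psi_closed)
qed

lemma smash_antipode_left:
  assumes s: "s \<in> carrier \<S>"
  shows "sweedler K \<S> \<S> (\<lambda>y z. smash_antipode y \<star> z) s = counit \<S> s \<odot>\<^bsub>\<S>\<^esub> \<one>\<^bsub>\<S>\<^esub>"
proof (rule smash_ext[OF smash_module _ _ s])
  interpret S: assoc_algebra K \<S> by (rule smash_assoc_algebra)
  note r = linear_comp[OF smash_antipode_linear] smash_antipode_linear linear_map_closed[OF smash_antipode_linear]
  linear_comp[OF smash_counit_linear] smash_counit_linear S.one_closed antipode_rules
  have b: "bilinear_map K \<S> \<S> \<S> (\<lambda>y z. smash_antipode y \<star> z)" by (rule r | assumption)+
  show "linear_map K \<S> \<S> (sweedler K \<S> \<S> (\<lambda>y z. smash_antipode y \<star> z))" by (rule linear_sweedler[OF smash_linear_comul smash_module b linear_ident])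
  show "linear_map K \<S> \<S> (\<lambda>s. counit \<S> s \<odot>\<^bsub>\<S>\<^esub> \<one>\<^bsub>\<S>\<^esub>)" by (rule r | assumption)+
  fix a l assume a: "a \<in> carrier H" and l: "l \<in> carrier L"
  note r = a l r
  let ?h = "sweedler K H \<S>" and ?l = "sweedler K L \<S>" and ?a = "counit H a \<odot>\<^bsub>H\<^esub> \<one>\<^bsub>H\<^esub>"
  have ac: "?a \<in> carrier H" by (rule r counit_closed[OF Hc] counit_closed[OF Lc] | assumption)+
  have eq1: "smash_antipode (pure a1 l1) \<star> pure a2 l2 = pure \<one>\<^bsub>H\<^esub> (\<psi> l1) \<star> pure (\<chi> a1 \<otimes>\<^bsub>H\<^esub> a2) l2"
    if "a1 \<in> carrier H" "a2 \<in> carrier H" "l1 \<in> carrier L" "l2 \<in> carrier L" for a1 a2 l1 l2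
    using that by (simp only: smash_antipode_pure S.m_assoc pure_closed unit_closed chi_closed psi_closed smash_one_left)
  have eq2: "?h (\<lambda>a1 a2. pure \<one>\<^bsub>H\<^esub> (\<psi> l1) \<star> pure (\<chi> a1 \<otimes>\<^bsub>H\<^esub> a2) l2) a = pure ?a (\<psi> l1 \<otimes>\<^bsub>L\<^esub> l2)"
    if ll: "l1 \<in> carrier L" "l2 \<in> carrier L" for l1 l2
  proof -
    have "pure \<one>\<^bsub>H\<^esub> (\<psi> l1) \<star> pure (sweedler K H H (\<lambda>y z. \<chi> y \<otimes>\<^bsub>H\<^esub> z) a) l2 =
        ?h (\<lambda>a1 a2. pure \<one>\<^bsub>H\<^esub> (\<psi> l1) \<star> pure (\<chi> a1 \<otimes>\<^bsub>H\<^esub> a2) l2) a"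
      by (rule linear_sweedler_commute[OF HL Hm smash_module, where g = "\<lambda>w. pure \<one>\<^bsub>H\<^esub> (\<psi> l1) \<star> pure w l2"])
        (rule ll r | assumption)+
    moreover have "pure \<one>\<^bsub>H\<^esub> (\<psi> l1) \<star> pure ?a l2 = pure ?a (\<psi> l1 \<otimes>\<^bsub>L\<^esub> l2)"
      using ll by (simp only: pure_smult1 counit_closed[OF Hc] counit_closed[OF Lc] a unit_closed S.smult_mult_right pure_closed psi_closed smash_one_right mh.L.m_closed)
    ultimately show ?thesis by (simp only: chi_antipode a)
  qed
  have "sweedler K \<S> \<S> (\<lambda>y z. smash_antipode y \<star> z) (pure a l) = ?h (\<lambda>a1 a2. ?l (\<lambda>l1 l2. smash_antipode (pure a1 l1) \<star> pure a2 l2) l) a"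
    by (rule sweedler_pure[OF smash_module b a l])
  also have "\<dots> = ?h (\<lambda>a1 a2. ?l (\<lambda>l1 l2. pure \<one>\<^bsub>H\<^esub> (\<psi> l1) \<star> pure (\<chi> a1 \<otimes>\<^bsub>H\<^esub> a2) l2) l) a"
    by (rule sweedler_cong[OF HL smash_module a] sweedler_cong[OF LL smash_module l] eq1 r | assumption)+
  also have "\<dots> = ?l (\<lambda>l1 l2. ?h (\<lambda>a1 a2. pure \<one>\<^bsub>H\<^esub> (\<psi> l1) \<star> pure (\<chi> a1 \<otimes>\<^bsub>H\<^esub> a2) l2) a) l"
    by (rule sweedler_swap[OF HL LL smash_module a l]) (rule r | assumption)+
  also have "\<dots> = ?l (\<lambda>l1 l2. pure ?a (\<psi> l1 \<otimes>\<^bsub>L\<^esub> l2)) l"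
    by (rule sweedler_cong[OF LL smash_module l]; (rule eq2 ac r | assumption)+)
  also have "\<dots> = pure ?a (sweedler K L L (\<lambda>y z. \<psi> y \<otimes>\<^bsub>L\<^esub> z) l)"
    by (rule linear_sweedler_commute[OF LL Lm smash_module _ psi_bilinear(1) l, symmetric]) (rule ac r | assumption)+
  finally show "sweedler K \<S> \<S> (\<lambda>y z. smash_antipode y \<star> z) (pure a l) = counit \<S> (pure a l) \<odot>\<^bsub>\<S>\<^esub> \<one>\<^bsub>\<S>\<^esub>"
    by (simp only: psi_antipode l pure_scalars counit_closed[OF Hc] counit_closed[OF Lc] a smash_counit_pure)
qed

lemma smash_antipode_right:
  assumes s: "s \<in> carrier \<S>"
  shows "sweedler K \<S> \<S> (\<lambda>y z. y \<star> smash_antipode z) s = counit \<S> s \<odot>\<^bsub>\<S>\<^esub> \<one>\<^bsub>\<S>\<^esub>"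
proof (rule smash_ext[OF smash_module _ _ s])
  interpret S: assoc_algebra K \<S> by (rule smash_assoc_algebra)
  note r = linear_comp[OF smash_antipode_linear] smash_antipode_linear linear_map_closed[OF smash_antipode_linear]
  linear_comp[OF smash_counit_linear] smash_counit_linear S.one_closed antipode_rules
  have b: "bilinear_map K \<S> \<S> \<S> (\<lambda>y z. y \<star> smash_antipode z)" by (rule r | assumption)+
  show "linear_map K \<S> \<S> (sweedler K \<S> \<S> (\<lambda>y z. y \<star> smash_antipode z))" by (rule linear_sweedler[OF smash_linear_comul smash_module b linear_ident])
  show "linear_map K \<S> \<S> (\<lambda>s. counit \<S> s \<odot>\<^bsub>\<S>\<^esub> \<one>\<^bsub>\<S>\<^esub>)" by (rule r | assumption)+
  fix a l assume a: "a \<in> carrier H" and l: "l \<in> carrier L"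
  note r = a l r
  let ?h = "sweedler K H \<S>" and ?l = "sweedler K L \<S>" and ?l' = "counit L l \<odot>\<^bsub>L\<^esub> \<one>\<^bsub>L\<^esub>"
  have lc: "?l' \<in> carrier L" by (rule r counit_closed[OF Hc] counit_closed[OF Lc] | assumption)+
  have eq1: "pure a1 l1 \<star> smash_antipode (pure a2 l2) = pure a1 (l1 \<otimes>\<^bsub>L\<^esub> \<psi> l2) \<star> pure (\<chi> a2) \<one>\<^bsub>L\<^esub>"
    if c: "a1 \<in> carrier H" "a2 \<in> carrier H" "l1 \<in> carrier L" "l2 \<in> carrier L" for a1 a2 l1 l2
  proof -
    note k = chi_closed[OF c(2)] psi_closed[OF c(4)]
    have "pure a1 l1 \<star> smash_antipode (pure a2 l2) = (pure a1 l1 \<star> pure \<one>\<^bsub>H\<^esub> (\<psi> l2)) \<star> pure (\<chi> a2) \<one>\<^bsub>L\<^esub>"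
      unfolding smash_antipode_pure[OF c(2,4)] by (rule S.m_assoc[symmetric]; intro pure_closed c k unit_closed)
    then show ?thesis by (simp only: smash_one_right c k)
  qed
  have eq2: "?l (\<lambda>l1 l2. pure a1 (l1 \<otimes>\<^bsub>L\<^esub> \<psi> l2) \<star> pure (\<chi> a2) \<one>\<^bsub>L\<^esub>) l = pure (a1 \<otimes>\<^bsub>H\<^esub> \<chi> a2) ?l'"
    if c: "a1 \<in> carrier H" "a2 \<in> carrier H" for a1 a2
  proof -
    have "pure a1 (sweedler K L L (\<lambda>y z. y \<otimes>\<^bsub>L\<^esub> \<psi> z) l) \<star> pure (\<chi> a2) \<one>\<^bsub>L\<^esub> =
        ?l (\<lambda>l1 l2. pure a1 (l1 \<otimes>\<^bsub>L\<^esub> \<psi> l2) \<star> pure (\<chi> a2) \<one>\<^bsub>L\<^esub>) l"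
      by (rule linear_sweedler_commute[OF LL Lm smash_module, where g = "\<lambda>w. pure a1 w \<star> pure (\<chi> a2) \<one>\<^bsub>L\<^esub>"])
        (rule c r | assumption)+
    moreover have "pure a1 ?l' \<star> pure (\<chi> a2) \<one>\<^bsub>L\<^esub> = pure (a1 \<otimes>\<^bsub>H\<^esub> \<chi> a2) ?l'"
      using c by (simp only: pure_smult2 counit_closed[OF Hc] counit_closed[OF Lc] l unit_closed S.smult_mult_left pure_closed chi_closed smash_one_left mh.H.m_closed)
    ultimately show ?thesis by (simp only: psi_antipode l)
  qed
  have "sweedler K \<S> \<S> (\<lambda>y z. y \<star> smash_antipode z) (pure a l) = ?h (\<lambda>a1 a2. ?l (\<lambda>l1 l2. pure a1 l1 \<star> smash_antipode (pure a2 l2)) l) a"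
    by (rule sweedler_pure[OF smash_module b a l])
  also have "\<dots> = ?h (\<lambda>a1 a2. ?l (\<lambda>l1 l2. pure a1 (l1 \<otimes>\<^bsub>L\<^esub> \<psi> l2) \<star> pure (\<chi> a2) \<one>\<^bsub>L\<^esub>) l) a"
    by (rule sweedler_cong[OF HL smash_module a] sweedler_cong[OF LL smash_module l] eq1 r | assumption)+
  also have "\<dots> = ?h (\<lambda>a1 a2. pure (a1 \<otimes>\<^bsub>H\<^esub> \<chi> a2) ?l') a"
    by (rule sweedler_cong[OF HL smash_module a]; (rule eq2 lc r | assumption)+)
  also have "\<dots> = pure (sweedler K H H (\<lambda>y z. y \<otimes>\<^bsub>H\<^esub> \<chi> z) a) ?l'"
    by (rule linear_sweedler_commute[OF HL Hm smash_module, where g = "\<lambda>w. pure w ?l'", symmetric]) (rule lc r | assumption)+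
  finally show "sweedler K \<S> \<S> (\<lambda>y z. y \<star> smash_antipode z) (pure a l) = counit \<S> (pure a l) \<odot>\<^bsub>\<S>\<^esub> \<one>\<^bsub>\<S>\<^esub>"
    by (simp only: chi_antipode a pure_scalars counit_closed[OF Hc] counit_closed[OF Lc] l smash_counit_pure)
qed

text \<open>
  The twist sends \<open>a \<otimes> l\<close> to the Sweedler sum of \<open>l\<^sub>1 \<cdot> a \<otimes> l\<^sub>2\<close>. It is undone by letting \<open>\<psi> l\<^sub>1\<close> act
  instead of \<open>l\<^sub>1\<close>: coassociativity merges the two actions into one of \<open>\<psi> l\<^sub>2\<close> and \<open>l\<^sub>1\<close>, which cocommutativity brings
  into the order that the antipode law requires.
\<close>

definition smash_untwist :: "('h \<times> 'l \<Rightarrow> 'k) set \<Rightarrow> ('h \<times> 'l \<Rightarrow> 'k) set"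
  where "smash_untwist = tensor_lift K \<S> (\<lambda>a l. sweedler K L \<S> (\<lambda>p q. pure (act (\<psi> p) a) q) l)"

lemma smash_untwist_linear: "linear_map K \<S> \<S> smash_untwist"
  and smash_untwist_pure: "a \<in> carrier H \<Longrightarrow> l \<in> carrier L \<Longrightarrow>
    smash_untwist (pure a l) = sweedler K L \<S> (\<lambda>p q. pure (act (\<psi> p) a) q) l"
proof -
  have "bilinear_map K H L \<S> (\<lambda>a l. sweedler K L \<S> (\<lambda>p q. pure (act (\<psi> p) a) q) l)"
    by (rule antipode_rules | assumption)+
  note lift = smash_lift[OF smash_module this]
  show "linear_map K \<S> \<S> smash_untwist" unfolding smash_untwist_def by (rule lift)
  show "a \<in> carrier H \<Longrightarrow> l \<in> carrier L \<Longrightarrow>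
    smash_untwist (pure a l) = sweedler K L \<S> (\<lambda>p q. pure (act (\<psi> p) a) q) l"
    unfolding smash_untwist_def by (rule lift)
qed

lemma sweedler_act_cancel:
  assumes B: "bilinear_map K L L L B"
    and BB: "\<And>x. x \<in> carrier L \<Longrightarrow> sweedler K L L B x = counit L x \<odot>\<^bsub>L\<^esub> \<one>\<^bsub>L\<^esub>"
    and c: "a \<in> carrier H" "l \<in> carrier L"
  shows "sweedler K L \<S> (\<lambda>p q. sweedler K L \<S> (\<lambda>u v. pure (act (B p u) a) v) q) l = pure a l"
proof -
  note B' = linear_comp[OF bilinear_mapD(1)[OF B]] linear_comp[OF bilinear_mapD(2)[OF B]] linear_map_closed[OF bilinear_mapD(1)[OF B]]
  note r = c B' antipode_rules
  have eq: "sweedler K L \<S> (\<lambda>p u. pure (act (B p u) a) v) x = counit L x \<odot>\<^bsub>\<S>\<^esub> pure a v"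
    if xv: "x \<in> carrier L" "v \<in> carrier L" for x v
  proof -
    have "pure (act (sweedler K L L B x) a) v = sweedler K L \<S> (\<lambda>p u. pure (act (B p u) a) v) x"
      by (rule linear_sweedler_commute[OF LL Lm smash_module _ B xv(1), where g = "\<lambda>z. pure (act z a) v"]) (rule xv r | assumption)+
    then show ?thesis
      by (simp only: BB xv linear_map_smult[OF bilinear_mapD(2)[OF act_bilinear]] c unit_closed counit_closed[OF Hc] counit_closed[OF Lc] act_one_left pure_smult1)
  qed
  have "sweedler K L \<S> (\<lambda>p q. sweedler K L \<S> (\<lambda>u v. pure (act (B p u) a) v) q) l =
      sweedler K L \<S> (\<lambda>x v. sweedler K L \<S> (\<lambda>p u. pure (act (B p u) a) v) x) l"
    by (rule sweedler_coassoc[OF Lc smash_module c(2), symmetric]) (rule r | assumption)+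
  also have "\<dots> = sweedler K L \<S> (\<lambda>x v. counit L x \<odot>\<^bsub>\<S>\<^esub> pure a v) l"
    by (rule sweedler_cong[OF LL smash_module c(2)]; (rule eq r | assumption)+)
  also have "\<dots> = pure a l" by (rule sweedler_counit_left[OF Lc smash_module c(2)]) (rule r | assumption)+
  finally show ?thesis .
qed

context
  assumes coc: "cocommutative K L"
begin

lemma psi_antipode_flip:
  assumes x: "x \<in> carrier L"
  shows "sweedler K L L (\<lambda>z y. \<psi> y \<otimes>\<^bsub>L\<^esub> z) x = counit L x \<odot>\<^bsub>L\<^esub> \<one>\<^bsub>L\<^esub>"
    and "sweedler K L L (\<lambda>z y. y \<otimes>\<^bsub>L\<^esub> \<psi> z) x = counit L x \<odot>\<^bsub>L\<^esub> \<one>\<^bsub>L\<^esub>"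
  using sweedler_flip[OF Lc coc Lm psi_bilinear(1) x] sweedler_flip[OF Lc coc Lm psi_bilinear(2) x] psi_antipode[OF x]
  by simp_all

lemma smash_untwist_twist:
  assumes s: "s \<in> carrier \<S>"
  shows "smash_untwist (smash_twist s) = s"
proof (rule smash_ext[OF smash_module linear_comp[OF smash_untwist_linear smash_twist_linear] linear_ident s])
  fix a l assume c: "a \<in> carrier H" "l \<in> carrier L"
  have "smash_untwist (smash_twist (pure a l)) = sweedler K L \<S> (\<lambda>p q. smash_untwist (pure (act p a) q)) l"
    unfolding smash_twist_pure[OF c] by (rule linear_sweedler_commute[OF LL smash_module smash_module smash_untwist_linear _ c(2)]) (rule c antipode_rules | assumption)+
  also have "\<dots> = sweedler K L \<S> (\<lambda>p q. sweedler K L \<S> (\<lambda>u v. pure (act (\<psi> u \<otimes>\<^bsub>L\<^esub> p) a) v) q) l"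
  proof (rule sweedler_cong[OF LL smash_module c(2)])
    fix p q assume pq: "p \<in> carrier L" "q \<in> carrier L"
    have "smash_untwist (pure (act p a) q) = sweedler K L \<S> (\<lambda>u v. pure (act (\<psi> u) (act p a)) v) q"
      by (rule smash_untwist_pure) (rule c pq antipode_rules | assumption)+
    also have "\<dots> = sweedler K L \<S> (\<lambda>u v. pure (act (\<psi> u \<otimes>\<^bsub>L\<^esub> p) a) v) q"
      by (rule sweedler_cong[OF LL smash_module pq(2)] c pq antipode_rules | assumption
        | (simp only: act_mult_left c pq psi_closed; fail))+
    finally show "smash_untwist (pure (act p a) q) = sweedler K L \<S> (\<lambda>u v. pure (act (\<psi> u \<otimes>\<^bsub>L\<^esub> p) a) v) q" .
  qed (rule linear_comp[OF smash_untwist_linear] c antipode_rules | assumption)+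
  also have "\<dots> = pure a l" by (rule sweedler_act_cancel[OF psi_bilinear'(1) psi_antipode_flip(1) c])
  finally show "smash_untwist (smash_twist (pure a l)) = pure a l" .
qed

lemma smash_twist_untwist:
  assumes s: "s \<in> carrier \<S>"
  shows "smash_twist (smash_untwist s) = s"
proof (rule smash_ext[OF smash_module linear_comp[OF smash_twist_linear smash_untwist_linear] linear_ident s])
  fix a l assume c: "a \<in> carrier H" "l \<in> carrier L"
  have "smash_twist (smash_untwist (pure a l)) = sweedler K L \<S> (\<lambda>p q. smash_twist (pure (act (\<psi> p) a) q)) l"
    unfolding smash_untwist_pure[OF c] by (rule linear_sweedler_commute[OF LL smash_module smash_module smash_twist_linear _ c(2)]) (rule c antipode_rules | assumption)+
  also have "\<dots> = sweedler K L \<S> (\<lambda>p q. sweedler K L \<S> (\<lambda>u v. pure (act (u \<otimes>\<^bsub>L\<^esub> \<psi> p) a) v) q) l"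
  proof (rule sweedler_cong[OF LL smash_module c(2)])
    fix p q assume pq: "p \<in> carrier L" "q \<in> carrier L"
    have "smash_twist (pure (act (\<psi> p) a) q) = sweedler K L \<S> (\<lambda>u v. pure (act u (act (\<psi> p) a)) v) q"
      by (rule smash_twist_pure) (rule c pq antipode_rules | assumption)+
    also have "\<dots> = sweedler K L \<S> (\<lambda>u v. pure (act (u \<otimes>\<^bsub>L\<^esub> \<psi> p) a) v) q"
      by (rule sweedler_cong[OF LL smash_module pq(2)] c pq antipode_rules | assumption
        | (simp only: act_mult_left c pq psi_closed; fail))+
    finally show "smash_twist (pure (act (\<psi> p) a) q) = sweedler K L \<S> (\<lambda>u v. pure (act (u \<otimes>\<^bsub>L\<^esub> \<psi> p) a) v) q" .
  qed (rule linear_comp[OF smash_twist_linear] c antipode_rules | assumption)+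
  also have "\<dots> = pure a l" by (rule sweedler_act_cancel[OF psi_bilinear'(2) psi_antipode_flip(2) c])
  finally show "smash_twist (smash_untwist (pure a l)) = pure a l" .
qed

lemma smash_twist_bij: "bij_betw smash_twist (carrier \<S>) (carrier \<S>)"
  by (rule bij_betw_byWitness[where f' = smash_untwist])
    (use smash_twist_untwist smash_untwist_twist linear_map_closed[OF smash_twist_linear]
      linear_map_closed[OF smash_untwist_linear] in blast)+

end

end

theorem smash_hopf_algebra:
  assumes coc: "cocommutative K L"
  shows "hopf_algebra K \<S>"
proof -
  obtain \<chi> where \<chi>: "is_antipode K H \<chi>" "bij_betw \<chi> (carrier H) (carrier H)"
    using mh.H.bij_antipode by blast
  obtain \<psi> where \<psi>: "is_antipode K L \<psi>" "bij_betw \<psi> (carrier L) (carrier L)"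
    using mh.L.bij_antipode by blast
  let ?S = "smash_antipode \<chi> \<psi>"
  note \<sigma> = smash_tensor_maps_bij[OF chi_linear[OF \<chi>(1) \<psi>(1)] \<chi>(2) psi_linear[OF \<chi>(1) \<psi>(1)] \<psi>(2)]
  have "bij_betw ?S (carrier \<S>) (carrier \<S>)"
    using bij_betw_trans[OF \<sigma> smash_twist_bij[OF \<chi>(1) \<psi>(1) coc]]
    by (simp add: comp_def smash_antipode_def[OF \<chi>(1) \<psi>(1), abs_def])
  moreover have "is_antipode K \<S> ?S"
    unfolding is_antipode_def using smash_antipode_left[OF \<chi>(1) \<psi>(1)] smash_antipode_right[OF \<chi>(1) \<psi>(1)]
      smash_antipode_linear[OF \<chi>(1) \<psi>(1)] by blast
  ultimately show ?thesis
    by (intro hopf_algebra.intro smash_bialgebra[OF coc] hopf_algebra_axioms.intro exI[of _ ?S] conjI)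
qed

end

section \<open>The enveloping algebra of a Lie algebra acting by biderivations\<close>

theorem lemma2p6:
  fixes K :: "('k, 'c) ring_scheme"
    and H :: "('k, 'h, 'd) hopf_scheme"
    and G :: "('k, 'g, 'e) lie_scheme"
    and act :: "'g \<Rightarrow> 'h \<Rightarrow> 'h"
  assumes "field K"
    and "hopf_algebra K H"
    and "lie_algebra K G"
    and "acts_by_biderivations K G H act"
  shows "(\<forall>x\<in>carrier G. \<forall>a\<in>carrier H. uea_action K H act (uea_incl K G x) a = act x a) \<and>
    module_hopf_algebra K (uea K G) H (uea_action K H act) \<and>
    hopf_algebra K (smash K H (uea K G) (uea_action K H act))"
proof (intro conjI ballI)
  have H: "module K H" by (intro coalgebra_module bialgebraD assms(2))
  have act: "lie_module_action K G H act" using assms(4) by (simp add: acts_by_biderivations_def)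
  show "uea_action K H act (uea_incl K G x) a = act x a" if "x \<in> carrier G" "a \<in> carrier H" for x a
    by (rule uea_action_incl[OF assms(3) H act that])
  show mh: "module_hopf_algebra K (uea K G) H (uea_action K H act)"
    by (rule uea_module_hopf_algebra[OF assms(2-4)])
  show "hopf_algebra K (smash K H (uea K G) (uea_action K H act))"
    by (rule smash_hopf_algebra[OF mh uea_cocommutative[OF assms(3)]])
qed

end
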